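(* Let $n\ge3$ and $\gamma\in[0,n/2)$. There exist $r_{n,\gamma}$ and $\alpha^*_{n,\gamma}$ in $(0,1)$, both depending only on $n$ and $\gamma$, such that the following holds. Let $\Omega\subset\mathbb{R}^n$ be a bounded domain with $0\in\partial\Omega$, let $D=\sup_{x\in\Omega}|x|$, and assume that $\Omega$ satisfies an exterior ball condition at zero, that is, there exists a ball $B_\rho$ of radius $\rho$ with $0\in\partial B_\rho$ and $B_\rho\subset\mathbb{R}^n\setminus\overline{\Omega}$. If $\rho\ge D/r_{n,\gamma}$, then for all $0<\alpha\le\alpha^*_{n,\gamma}$ and all $u\in C_c^\infty(\Omega)$ there holds $$\int_\Omega|\nabla u|^2dx\ \ge\ \frac{n^2}{4}\int_\Omega\frac{u^2}{|x|^2}dx+(n-2\gamma)^{-\frac{2(n-1)}{n}}S^*_{n,\gamma}\bigg(\int_\Omega X^{\frac{2n-2}{n-2}}\big(\alpha|x|/D\big)\,|u|^{\frac{2n}{n-2}}dx\bigg)^{\frac{n-2}{n}}.$$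
   Context: $X(t)=\frac{1}{1-\ln t}$ for $t\in(0,1)$, and $X^{q}(t)=(X(t))^q$. Functions are real-valued. $\mathbb{R}^n_+=\{x\in\mathbb{R}^n: x_n>0\}$. For $n\ge3$ and $0\le\gamma<n/2$, $S^*_{n,\gamma}$ denotes the best (largest) constant in the inequality $$\int_{\mathbb{R}^n_+}|\nabla u|^2dx-\gamma(n-\gamma)\int_{\mathbb{R}^n_+}\frac{u^2}{|x|^2}dx\ge S^*_{n,\gamma}\Big(\int_{\mathbb{R}^n_+}|u|^{\frac{2n}{n-2}}dx\Big)^{\frac{n-2}{n}},\qquad u\in C_c^\infty(\mathbb{R}^n_+).$$ *)

theory Defs
  imports "HOL-Analysis.Analysis"
begin

definition partial_deriv :: "'n::finite \<Rightarrow> (real ^ 'n \<Rightarrow> real) \<Rightarrow> real ^ 'n \<Rightarrow> real" where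
  "partial_deriv i f x = frechet_derivative f (at x) (axis i 1)"

definition grad :: "(real ^ 'n \<Rightarrow> real) \<Rightarrow> real ^ 'n::finite \<Rightarrow> real ^ 'n" where
  "grad f x = (\<chi> i. partial_deriv i f x)"

fun Ck_function :: "nat \<Rightarrow> (real ^ 'n::finite \<Rightarrow> real) \<Rightarrow> bool" where
  "Ck_function 0 f = continuous_on UNIV f"
| "Ck_function (Suc k) f =
     ((\<forall>x. f differentiable (at x)) \<and> (\<forall>i. Ck_function k (partial_deriv i f)))"

definition smooth_function :: "(real ^ 'n::finite \<Rightarrow> real) \<Rightarrow> bool" where
  "smooth_function f = (\<forall>k. Ck_function k f)"

text \<open>A test function on an open set \<open>A\<close> is identified with its extension by zero to the
  whole space.\<close>

definition test_functions :: "(real ^ 'n::finite) set \<Rightarrow> (real ^ 'n \<Rightarrow> real) set" where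
  "test_functions A = {u. smooth_function u \<and> compact (closure {x. u x \<noteq> 0})
                            \<and> closure {x. u x \<noteq> 0} \<subseteq> A}"

definition X :: "real \<Rightarrow> real" where
  "X t = 1 / (1 - ln t)"

text \<open>The index type \<open>'n\<close> carries no order, so the distinguished coordinate that plays the
  role of the last one is a parameter \<open>i\<close>.\<close>

definition half_space :: "'n::finite \<Rightarrow> (real ^ 'n) set" where
  "half_space i = {x. x $ i > 0}"

text \<open>The supremum below is attained whenever \<open>CARD('n) \<ge> 3\<close> and \<open>0 \<le> \<gamma> < CARD('n) / 2\<close>: the
  set of admissible constants is then closed, bounded above, and contains \<open>0\<close> by the Hardy
  inequality in the half-space.\<close>

definition best_const :: "'n::finite \<Rightarrow> real \<Rightarrow> real" where
  "best_const i \<gamma> = (let n = real CARD('n) in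
     Sup {S. \<forall>u \<in> test_functions (half_space i).
        (LINT x:half_space i|lborel. (norm (grad u x))\<^sup>2)
          - \<gamma> * (n - \<gamma>) * (LINT x:half_space i|lborel. (u x)\<^sup>2 / (norm x)\<^sup>2)
        \<ge> S * (LINT x:half_space i|lborel. \<bar>u x\<bar> powr (2 * n / (n - 2))) powr ((n - 2) / n)})"

definition exterior_ball_at_zero :: "(real ^ 'n::finite) set \<Rightarrow> real \<Rightarrow> bool" where
  "exterior_ball_at_zero \<Omega> \<rho> =
     (\<rho> > 0 \<and> (\<exists>c. 0 \<in> frontier (ball c \<rho>) \<and> ball c \<rho> \<subseteq> UNIV - closure \<Omega>))"

end

theory Submission
  imports Defs
begin

text \<open>If \<open>Z = \<nabla>\<Phi> / \<Phi>\<close> for a positive \<open>\<Phi>\<close>, integrating \<open>div (u\<^sup>2 Z)\<close> turns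
  \<open>\<integral> |\<nabla>u|\<^sup>2 + u\<^sup>2 \<Delta>\<Phi> / \<Phi>\<close> into \<open>\<integral> |\<nabla>u - u Z|\<^sup>2 = \<integral> \<Phi>\<^sup>2 |\<nabla>(u / \<Phi>)|\<^sup>2\<close>. In the half-space this is
  applied to \<open>\<psi> = z\<^sub>i |z|\<^sup>-\<^sup>\<gamma>\<close>, which solves the equation with potential \<open>\<gamma> (n - \<gamma>) / |z|\<^sup>2\<close>, and in
  \<open>\<Omega>\<close> to a supersolution \<open>\<Phi>\<close> for the critical potential \<open>n\<^sup>2 / (4 |x|\<^sup>2)\<close>. An inversion maps the
  exterior of the ball onto a half-space, and a logarithmic change \<open>r \<mapsto> t\<close> of the radius with
  \<open>t\<^sup>-\<^sup>\<beta> \<approx> const - ln r\<close>, \<open>\<beta> = n - 2 \<gamma>\<close>, matches the radial parts of the two weighted energies up to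
  the factor \<open>\<beta>\<close> and produces the weight \<open>X\<close>; the angular part has room to spare once \<open>\<alpha>\<close> is small.
  So \<open>w = \<psi> (u / \<Phi>) \<circ> S\<close>, where \<open>S\<close> is the inverse of the composed map, is a test function of the
  half-space, and its inequality with constant \<open>S\<^sup>*\<close> is the claim for \<open>u\<close>.\<close>

section \<open>Functions of class C^k on open sets\<close>

text \<open>Dirichlet energy is conformally covariant, so the inversion and the rotation cost
  nothing and only a radial map has to be found. For the quotients by the ground states the radial
  weights are r dr in \<Omega> and t^(\<beta>+1) dt in the half-space. Equality up to \<beta> asks
  for t^(\<beta>+1) r' = \<beta> r, whose solutions are logarithmic; for the critical Sobolev
  exponent the Jacobian of the same map produces exactly the power (2n-2)/(n-2) of X. Energy and
  Lebesgue integral each lose a factor \<beta>, and 1 + (n-2)/n = 2(n-1)/n is the exponent in the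
  claim. The obstacle is curvature. For the ball of radius \<rho> around c, the Kelvin transform of
  the half-space ground state belongs to the potential n^2 \<rho>^2 / (|x|^2 |x-2c|^2), which can
  fall short of n^2 / (4|x|^2) by order 1/(\<rho>|x|). The factor 1 - \<epsilon>|x| makes this up
  with \<epsilon> of order n^2/\<rho>, and it stays well away from zero on \<Omega> if D is small
  compared to \<rho>: hence the assumption \<rho> \<ge> D/r.\<close>

lemma partial_deriv_eqI: "(f has_derivative f') (at x) \<Longrightarrow> partial_deriv i f x = f' (axis i 1)"
  unfolding partial_deriv_def by (metis frechet_derivative_at)

text \<open>The ground states and the map \<open>S\<close> are smooth only on open sets, so
  smoothness has to be localised. Derivatives are taken \<open>at x\<close>, not within
  \<open>S\<close>, so that the same \<open>partial_deriv\<close> serves; the notion is meant for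
  open \<open>S\<close>.\<close>

fun Ck_on :: "nat \<Rightarrow> (real ^ 'n::finite) set \<Rightarrow> (real ^ 'n \<Rightarrow> real) \<Rightarrow> bool" where
  "Ck_on 0 S f = continuous_on S f"
| "Ck_on (Suc k) S f =
     ((\<forall>x\<in>S. f differentiable (at x)) \<and> (\<forall>i. Ck_on k S (partial_deriv i f)))"

lemma Ck_function_iff: "Ck_function k f \<longleftrightarrow> Ck_on k UNIV f"
  by (induction k arbitrary: f) auto

lemma Ck_on_cong:
  assumes "open S" "\<And>x. x \<in> S \<Longrightarrow> f x = g x"
  shows "Ck_on k S f \<longleftrightarrow> Ck_on k S g"
proof -
  have "Ck_on k S f \<Longrightarrow> Ck_on k S g" if "\<And>x. x \<in> S \<Longrightarrow> f x = g x" for f g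
    using that
  proof (induction k arbitrary: f g)
    case 0
    then show ?case using continuous_on_cong by (metis Ck_on.simps(1))
  next
    case (Suc k)
    have D: "(g has_derivative frechet_derivative f (at x)) (at x)" if "x \<in> S" for x
      using Suc.prems that assms(1)
      by (auto simp: frechet_derivative_works intro: has_derivative_transform_within_open)
    have "partial_deriv i f x = partial_deriv i g x" if "x \<in> S" for i x
      using partial_deriv_eqI[OF D[OF that]] by (simp add: partial_deriv_def)
    moreover from this have "Ck_on k S (partial_deriv i g)" for i
      using Suc.IH[of "partial_deriv i f" "partial_deriv i g"] Suc.prems(1) by simp
    ultimately show ?case using D unfolding Ck_on.simps differentiable_def by blast
  qed
  then show ?thesis using assms(2) by metis
qed

text \<open>The closure rules below all go through this one: the derivative need only be known on
  \<open>S\<close>, where it may replace the partial derivatives by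
  \<open>Ck_on_cong\<close>.\<close>

lemma Ck_on_SucI:
  assumes "open S" "\<And>x. x \<in> S \<Longrightarrow> (f has_derivative f' x) (at x)"
    "\<And>i. Ck_on k S (\<lambda>x. f' x (axis i 1))"
  shows "Ck_on (Suc k) S f"
proof -
  have "Ck_on k S (partial_deriv i f)" for i
    using Ck_on_cong[OF assms(1), of "partial_deriv i f" "\<lambda>x. f' x (axis i 1)"] assms(2,3)
      partial_deriv_eqI by blast
  then show ?thesis using assms(2) by (auto simp: differentiable_def)
qed

lemma differentiable_grad:
  fixes f :: "real ^ 'n::finite \<Rightarrow> real"
  assumes "f differentiable (at x)"
  shows "(f has_derivative (\<lambda>h. grad f x \<bullet> h)) (at x)"
proof -
  have D: "(f has_derivative frechet_derivative f (at x)) (at x)"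
    using assms by (simp add: frechet_derivative_works)
  then interpret linear "frechet_derivative f (at x)"
    using has_derivative_linear by blast
  have "frechet_derivative f (at x) h = grad f x \<bullet> h" for h
  proof -
    have "frechet_derivative f (at x) h = frechet_derivative f (at x) (\<Sum>i\<in>UNIV. h $ i *\<^sub>R axis i 1)"
      using basis_expansion[of h] by (simp add: scalar_mult_eq_scaleR)
    also have "\<dots> = grad f x \<bullet> h"
      by (simp add: sum scale grad_def inner_vec_def partial_deriv_def mult.commute)
    finally show ?thesis .
  qed
  then have "frechet_derivative f (at x) = (\<lambda>h. grad f x \<bullet> h)" by blast
  then show ?thesis using D by simp
qed

lemma grad_eqI:
  fixes f :: "real ^ 'n::finite \<Rightarrow> real"
  assumes "(f has_derivative (\<lambda>h. v \<bullet> h)) (at x)"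
  shows "grad f x = v"
  using partial_deriv_eqI[OF assms] by (simp add: grad_def vec_eq_iff inner_axis)

lemma Ck_on_imp_continuous_on: "Ck_on k S f \<Longrightarrow> continuous_on S f"
  by (cases k) (auto intro!: continuous_at_imp_continuous_on differentiable_imp_continuous_within)

lemma Ck_on_SucD: "Ck_on (Suc k) S f \<Longrightarrow> Ck_on k S f"
proof (induction k arbitrary: f)
  case 0
  then show ?case using Ck_on_imp_continuous_on by (metis Ck_on.simps(1))
next
  case (Suc k)
  then show ?case by (meson Ck_on.simps(2))
qed

lemma Ck_on_subset: "Ck_on k S f \<Longrightarrow> T \<subseteq> S \<Longrightarrow> Ck_on k T f"
  by (induction k arbitrary: f) (auto intro: continuous_on_subset)

text \<open>Used to glue a function that is smooth near its support with zero off the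
  support.\<close>

lemma Ck_on_Un: "open S \<Longrightarrow> open T \<Longrightarrow> Ck_on k S f \<Longrightarrow> Ck_on k T f \<Longrightarrow> Ck_on k (S \<union> T) f"
  by (induction k arbitrary: f) (auto intro: continuous_on_open_Un)

lemma Ck_on_const: "open S \<Longrightarrow> Ck_on k S (\<lambda>x. c)"
proof (induction k arbitrary: c)
  case (Suc k)
  then show ?case by (intro Ck_on_SucI[where f' = "\<lambda>x h. 0"]) auto
qed simp

lemma Ck_on_linear:
  assumes "open S" "linear f" shows "Ck_on k S f"
proof (cases k)
  case 0
  then show ?thesis using assms by (simp add: linear_continuous_on linear_linear)
next
  case (Suc k')
  show ?thesis unfolding Suc using assms
    by (intro Ck_on_SucI[where f' = "\<lambda>x. f"] Ck_on_const)
       (auto intro: bounded_linear_imp_has_derivative simp: linear_linear)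
qed

lemma Ck_on_add:
  assumes "open S" "Ck_on k S f" "Ck_on k S g"
  shows "Ck_on k S (\<lambda>x. f x + g x)"
  using assms(2,3)
proof (induction k arbitrary: f g)
  case 0
  then show ?case by (simp add: continuous_on_add)
next
  case (Suc k)
  have "Ck_on k S (\<lambda>x. frechet_derivative f (at x) (axis i 1) + frechet_derivative g (at x) (axis i 1))" for i
    using Suc.IH[of "partial_deriv i f" "partial_deriv i g"] Suc.prems
    by (simp add: partial_deriv_def[abs_def])
  with Suc.prems show ?case
    by (intro Ck_on_SucI[where f' = "\<lambda>x h. frechet_derivative f (at x) h + frechet_derivative g (at x) h"] assms(1))
      (auto intro!: derivative_intros simp: frechet_derivative_works)
qed

lemma Ck_on_mult:
  assumes "open S" "Ck_on k S f" "Ck_on k S g"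
  shows "Ck_on k S (\<lambda>x. f x * g x)"
  using assms(2,3)
proof (induction k arbitrary: f g)
  case 0
  then show ?case by (simp add: continuous_on_mult)
next
  case (Suc k)
  have "Ck_on k S (\<lambda>x. f x * frechet_derivative g (at x) (axis i 1) + frechet_derivative f (at x) (axis i 1) * g x)" for i
    using Suc.IH[of f "partial_deriv i g"] Suc.IH[of "partial_deriv i f" g] Suc.prems
      Ck_on_SucD[of k S f] Ck_on_SucD[of k S g]
    by (intro Ck_on_add assms(1)) (auto simp: partial_deriv_def[abs_def])
  with Suc.prems show ?case
    by (intro Ck_on_SucI[where f' = "\<lambda>x h. f x * frechet_derivative g (at x) h + frechet_derivative f (at x) h * g x"] assms(1))
      (auto intro!: derivative_intros simp: frechet_derivative_works)
qed

lemma Ck_on_sum: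
  assumes "open S" "\<And>j. j \<in> J \<Longrightarrow> Ck_on k S (f j)"
  shows "Ck_on k S (\<lambda>x. \<Sum>j\<in>J. f j x)"
  using assms(2)
  by (induction J rule: infinite_finite_induct) (auto intro: Ck_on_add Ck_on_const assms(1))

lemma Ck_on_diff:
  assumes "open S" "Ck_on k S f" "Ck_on k S g"
  shows "Ck_on k S (\<lambda>x. f x - g x)"
  using Ck_on_add[OF assms(1,2), of "\<lambda>x. (-1) * g x"] Ck_on_mult[OF assms(1) _ assms(3), of "\<lambda>x. -1"]
    Ck_on_const[OF assms(1)] by auto

text \<open>Differentiation lowers the exponent, hence the induction over all \<open>a\<close> at
  once. Reciprocals, square roots and norms are later written with \<open>powr\<close> so that this
  single rule covers them.\<close>

lemma Ck_on_powr:
  assumes "open S" "Ck_on k S f" "\<And>x. x \<in> S \<Longrightarrow> f x > 0"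
  shows "Ck_on k S (\<lambda>x. f x powr a)"
  using assms(2)
proof (induction k arbitrary: a)
  case 0
  then show ?case using assms(3) by (auto intro!: continuous_intros) (metis less_irrefl)
next
  case (Suc k)
  have "Ck_on k S (\<lambda>x. a * (f x powr (a - 1) * frechet_derivative f (at x) (axis i 1)))" for i
    using Suc.IH[of "a - 1"] Suc.prems Ck_on_SucD[of k S f]
    by (intro Ck_on_mult Ck_on_const assms(1)) (auto simp: partial_deriv_def[abs_def])
  moreover have "((\<lambda>x. f x powr a) has_derivative (\<lambda>h. a * (f x powr (a - 1) * frechet_derivative f (at x) h))) (at x)"
    if "x \<in> S" for x
    using Suc.prems that assms(3)[OF that]
    by (auto intro!: derivative_eq_intros simp: frechet_derivative_works powr_diff field_simps)
  ultimately show ?case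
    by (intro Ck_on_SucI assms(1)) auto
qed

lemma Ck_on_exp:
  assumes "open S" "Ck_on k S f"
  shows "Ck_on k S (\<lambda>x. exp (f x))"
  using assms(2)
proof (induction k)
  case 0
  then show ?case by (auto intro!: continuous_intros)
next
  case (Suc k)
  have "Ck_on k S (\<lambda>x. exp (f x) * frechet_derivative f (at x) (axis i 1))" for i
    using Suc.IH Suc.prems Ck_on_SucD[of k S f]
    by (intro Ck_on_mult assms(1)) (auto simp: partial_deriv_def[abs_def])
  moreover have "((\<lambda>x. exp (f x)) has_derivative (\<lambda>h. exp (f x) * frechet_derivative f (at x) h)) (at x)"
    if "x \<in> S" for x
    using Suc.prems that
    by (auto intro!: derivative_eq_intros simp: frechet_derivative_works)
  ultimately show ?case
    by (intro Ck_on_SucI assms(1)) auto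
qed

lemma Ck_on_compose:
  fixes G :: "real ^ 'n::finite \<Rightarrow> real ^ 'm::finite"
  assumes "open S" "open T" "G ` S \<subseteq> T" "\<And>j. Ck_on k S (\<lambda>x. G x $ j)" "Ck_on k T f"
  shows "Ck_on k S (\<lambda>x. f (G x))"
  using assms(4,5)
proof (induction k arbitrary: f)
  case 0
  then have "continuous_on S (\<lambda>x. \<chi> j. G x $ j)"
    by (intro continuous_on_vec_lambda) auto
  then have "continuous_on S G" by simp
  then show ?case using 0 assms(3) by (auto intro: continuous_on_compose2)
next
  case (Suc k)
  let ?G = "\<lambda>x h. \<chi> j. frechet_derivative (\<lambda>x. G x $ j) (at x) h"
  have G: "(G has_derivative ?G x) (at x)" if "x \<in> S" for x
  proof -
    have "((\<lambda>x. \<chi> j. G x $ j) has_derivative ?G x) (at x)"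
      using Suc.prems(1) that
      by (subst has_derivative_componentwise_within) (auto simp: frechet_derivative_works Basis_vec_def inner_axis)
    then show ?thesis by simp
  qed
  have f: "(f has_derivative (\<lambda>h. grad f x \<bullet> h)) (at x)" if "x \<in> T" for x
    using Suc.prems(2) that differentiable_grad by auto
  have "Ck_on k S (\<lambda>x. grad f (G x) \<bullet> ?G x (axis i 1))" for i
    unfolding inner_vec_def grad_def
    using Suc.IH[of "partial_deriv _ f"] Suc.prems Ck_on_SucD[of k S]
    by (auto intro!: Ck_on_sum Ck_on_mult assms(1) simp: partial_deriv_def[abs_def])
  then show ?case using assms(3)
    by (intro Ck_on_SucI[where f' = "\<lambda>x h. grad f (G x) \<bullet> ?G x h"] assms(1))
      (auto intro!: has_derivative_compose[OF G f])
qed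

lemma Ck_on_inner:
  assumes "open S" shows "Ck_on k S (\<lambda>x. (x - p) \<bullet> (x - p))"
proof -
  have "Ck_on k S (\<lambda>x. \<Sum>j\<in>UNIV. (x $ j - p $ j) * (x $ j - p $ j))"
    using assms
    by (intro Ck_on_sum Ck_on_mult Ck_on_diff Ck_on_const Ck_on_linear) (auto intro: linearI)
  then show ?thesis by (simp add: inner_vec_def)
qed

section \<open>Change of variables for an arbitrary finite index type\<close>

text \<open>The change-of-variables theorem of the library asks for a well-ordered index type. Every finite
  type has a well-ordered copy, to which coordinates are transferred.\<close>

typedef 'a wo_copy = "UNIV :: 'a set" by simp

instance wo_copy :: (finite) finite
proof
  have "UNIV = range (Abs_wo_copy :: 'a \<Rightarrow> _)"
    by (metis Abs_wo_copy_cases surjI)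
  then show "finite (UNIV :: 'a wo_copy set)"
    by (metis finite finite_imageI)
qed

instantiation wo_copy :: (finite) wellorder
begin

definition less_eq_wo_copy :: "'a wo_copy \<Rightarrow> 'a wo_copy \<Rightarrow> bool" where
  "less_eq_wo_copy a b \<longleftrightarrow> to_nat (Rep_wo_copy a) \<le> to_nat (Rep_wo_copy b)"

definition less_wo_copy :: "'a wo_copy \<Rightarrow> 'a wo_copy \<Rightarrow> bool" where
  "less_wo_copy a b \<longleftrightarrow> to_nat (Rep_wo_copy a) < to_nat (Rep_wo_copy b)"

instance
proof
  fix P :: "'a wo_copy \<Rightarrow> bool" and a
  assume "\<And>x. (\<And>y. y < x \<Longrightarrow> P y) \<Longrightarrow> P x"
  then show "P a"
    by (rule measure_induct_rule[of "\<lambda>a. to_nat (Rep_wo_copy a)"]) (simp add: less_wo_copy_def)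
qed (auto simp: less_wo_copy_def less_eq_wo_copy_def Rep_wo_copy_inject dest!: antisym)

end

text \<open>In the Leibniz formula, conjugation by \<open>g\<close> matches the permutations of the
  two index types and preserves signs.\<close>

lemma det_reindex:
  fixes A :: "real ^ 'n::finite ^ 'n" and g :: "'m::finite \<Rightarrow> 'n"
  assumes "bij g"
  shows "det (\<chi> i j. A $ g i $ g j) = det A"
proof -
  let ?M = "map_permutation UNIV g"
  have bij: "bij_betw ?M {p. p permutes UNIV} {p. p permutes UNIV}"
  proof (rule bij_betw_byWitness[where f' = "map_permutation UNIV (inv g)"])
    show "\<forall>p\<in>{p. p permutes UNIV}. map_permutation UNIV (inv g) (?M p) = p"
      using assms by (auto intro!: map_permutation_compose_inv simp: bij_is_inj)
    show "\<forall>p\<in>{p. p permutes UNIV}. ?M (map_permutation UNIV (inv g) p) = p"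
      using assms bij_imp_bij_inv[OF assms]
      by (auto intro!: map_permutation_compose_inv simp: bij_is_surj surj_f_inv_f)
  qed (use assms bij_imp_bij_inv[OF assms] in \<open>auto intro!: map_permutation_permutes\<close>)
  have "det A = (\<Sum>p\<in>{p. p permutes UNIV}. of_int (sign (?M p)) * (\<Prod>i\<in>UNIV. A $ i $ ?M p i))"
    unfolding det_def by (rule sum.reindex_bij_betw[OF bij, symmetric])
  also have "\<dots> = (\<Sum>p\<in>{p. p permutes UNIV}. of_int (sign p) * (\<Prod>i\<in>UNIV. A $ g i $ g (p i)))"
  proof (intro sum.cong refl)
    fix p :: "'m \<Rightarrow> 'm" assume p: "p \<in> {p. p permutes UNIV}"
    have "(\<Prod>i\<in>UNIV. A $ i $ ?M p i) = (\<Prod>i\<in>UNIV. A $ g i $ ?M p (g i))"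
      using prod.reindex_bij_betw[OF assms, of "\<lambda>i. A $ i $ ?M p i"] by simp
    also have "\<dots> = (\<Prod>i\<in>UNIV. A $ g i $ g (p i))"
      using assms by (simp add: map_permutation_apply bij_is_inj)
    finally show "of_int (sign (?M p)) * (\<Prod>i\<in>UNIV. A $ i $ ?M p i) =
        of_int (sign p) * (\<Prod>i\<in>UNIV. A $ g i $ g (p i))"
      using p assms by (simp add: sign_map_permutation bij_is_inj)
  qed
  finally show ?thesis by (simp add: det_def)
qed

definition reindex :: "('m \<Rightarrow> 'n) \<Rightarrow> real ^ 'n::finite \<Rightarrow> real ^ 'm::finite" where
  "reindex g x = (\<chi> j. x $ g j)"

lemma linear_reindex: "linear (reindex g)"
  by (auto simp: reindex_def vec_eq_iff intro!: linearI)

lemma continuous_on_reindex [continuous_intros]: "continuous_on S (reindex g)"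
  by (simp add: linear_continuous_on linear_linear linear_reindex)

lemma measurable_reindex [measurable]: "reindex g \<in> borel_measurable borel"
  by (intro borel_measurable_continuous_onI continuous_intros)

lemma reindex_inv:
  assumes "bij g"
  shows "reindex g (reindex (inv g) x) = x" "reindex (inv g) (reindex g y) = y"
  using assms by (auto simp: reindex_def vec_eq_iff bij_is_inj bij_is_surj surj_f_inv_f)

lemma prod_Basis_cart: "(\<Prod>b\<in>Basis. (x :: real ^ 'n::finite) \<bullet> b) = (\<Prod>i\<in>UNIV. x $ i)"
proof -
  have "Basis = range (\<lambda>i. axis i 1 :: real ^ 'n)" by (auto simp: Basis_vec_def)
  moreover have "inj (\<lambda>i. axis i 1 :: real ^ 'n)" by (auto intro!: injI simp: axis_eq_axis)
  ultimately show ?thesis using prod.reindex[of "\<lambda>i. axis i 1" UNIV "\<lambda>b. x \<bullet> b"]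
    by (simp add: inner_axis)
qed

text \<open>Reindexing permutes the edges of a box, so both measures agree on boxes, and these
  determine \<open>lborel\<close>.\<close>

lemma distr_lborel_reindex:
  fixes g :: "'m::finite \<Rightarrow> 'n::finite"
  assumes "bij g"
  shows "distr lborel borel (reindex g) = lborel"
proof (rule lborel_eqI[symmetric])
  fix l u :: "real ^ 'm" assume le: "\<And>b. b \<in> Basis \<Longrightarrow> l \<bullet> b \<le> u \<bullet> b"
  have le': "l $ i \<le> u $ i" for i
    using le[of "axis i 1"] by (simp add: inner_axis)
  have "reindex g -` box l u = box (reindex (inv g) l) (reindex (inv g) u)"
  proof -
    have "(\<forall>j. l $ j < x $ g j \<and> x $ g j < u $ j) \<longleftrightarrow> (\<forall>i. l $ inv g i < x $ i \<and> x $ i < u $ inv g i)" for x :: "real ^ 'n"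
      using assms bij_is_inj[THEN inv_f_f, of g] bij_is_surj[THEN surj_f_inv_f, of g] by metis
    then show ?thesis by (auto simp: mem_box_cart reindex_def)
  qed
  moreover have "reindex (inv g) l \<bullet> b \<le> reindex (inv g) u \<bullet> b" if "b \<in> Basis" for b
    using that le' by (auto simp: Basis_vec_def inner_axis reindex_def)
  ultimately have "emeasure (distr lborel borel (reindex g)) (box l u)
      = (\<Prod>b\<in>Basis. (reindex (inv g) u - reindex (inv g) l) \<bullet> b)"
    by (simp add: emeasure_distr emeasure_lborel_box)
  also have "\<dots> = (\<Prod>i\<in>UNIV. (u - l) $ inv g i)"
    by (simp only: prod_Basis_cart) (simp add: reindex_def)
  also have "\<dots> = (\<Prod>b\<in>Basis. (u - l) \<bullet> b)"
    by (simp only: prod_Basis_cart prod.reindex_bij_betw[OF bij_imp_bij_inv[OF assms]])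
  finally show "emeasure (distr lborel borel (reindex g)) (box l u) = (\<Prod>b\<in>Basis. (u - l) \<bullet> b)" .
qed simp

lemma
  fixes g :: "'m::finite \<Rightarrow> 'n::finite" and f :: "real ^ 'm \<Rightarrow> real"
  assumes "bij g" and f: "f \<in> borel_measurable borel"
  shows integrable_reindex: "integrable lborel (\<lambda>x. f (reindex g x)) \<longleftrightarrow> integrable lborel f"
    and integral_reindex: "(LINT x|lborel. f (reindex g x)) = (LINT x|lborel. f x)"
  using integrable_distr_eq[of "reindex g" lborel borel f] integral_distr[of "reindex g" lborel borel f] f
  by (simp_all add: distr_lborel_reindex[OF assms(1)])

text \<open>\<open>has_absolute_integral_change_of_variables\<close> speaks of vector-valued
  integrands and Lebesgue measurability. The detour through \<open>real ^ 1\<close> handles the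
  first; continuity of \<open>J\<close> and \<open>f\<close> gives the Borel measurability needed to
  return to \<open>lborel\<close>. \<open>J\<close> is a separate parameter so that no continuity of
  \<open>S'\<close> has to be proved.\<close>

lemma change_of_variables_wellorder:
  fixes f :: "real ^ 'm::{finite,wellorder} \<Rightarrow> real" and S :: "real ^ 'm::_ \<Rightarrow> real ^ 'm::_"
  assumes U: "open U" and S: "\<And>z. z \<in> U \<Longrightarrow> (S has_derivative S' z) (at z)" and inj: "inj_on S U"
    and J: "continuous_on U J" "\<And>z. z \<in> U \<Longrightarrow> J z = \<bar>det (matrix (S' z))\<bar>"
    and f: "continuous_on (S ` U) f" "set_integrable lborel (S ` U) f" and SU: "open (S ` U)"
  shows "set_integrable lborel U (\<lambda>z. J z * f (S z))"
    and "(LINT z:U|lborel. J z * f (S z)) = (LINT x:S ` U|lborel. f x)"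
proof -
  let ?f = "\<lambda>x. vec (f x) :: real ^ 1"
  have leb: "f absolutely_integrable_on S ` U"
    using f(2) unfolding set_integrable_def
    by (subst integrable_completion) auto
  have vec: "(\<lambda>x. ?f x) absolutely_integrable_on S ` U"
    using leb by (simp add: absolutely_integrable_on_1_iff)
  have "(\<lambda>x. \<bar>det (matrix (S' x))\<bar> *\<^sub>R ?f (S x)) absolutely_integrable_on U \<and>
           integral U (\<lambda>x. \<bar>det (matrix (S' x))\<bar> *\<^sub>R ?f (S x)) = integral (S ` U) ?f"
    using has_absolute_integral_change_of_variables[of U S S' ?f "integral (S ` U) ?f"]
      U S inj vec by (auto intro: has_derivative_at_withinI)
  then have *: "(\<lambda>x. \<bar>det (matrix (S' x))\<bar> * f (S x)) absolutely_integrable_on U"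
     and **: "integral U (\<lambda>x. \<bar>det (matrix (S' x))\<bar> * f (S x)) = integral (S ` U) f"
    using leb absolutely_integrable_on_def
    by (auto simp: absolutely_integrable_on_1_iff integral_on_1_eq vec_eq_iff)
  have cont: "continuous_on U (\<lambda>z. J z * f (S z))"
    using has_derivative_continuous_on[of U S S'] S
    by (intro continuous_on_mult J(1) continuous_on_compose2[OF f(1)])
      (auto simp: has_derivative_at_withinI)
  have eq: "(\<lambda>z. indicator U z *\<^sub>R (J z * f (S z)))
      = (\<lambda>z. indicator U z *\<^sub>R (\<bar>det (matrix (S' z))\<bar> * f (S z)))"
    using J(2) by (auto simp: indicator_def)
  have "(\<lambda>z. J z * f (S z)) absolutely_integrable_on U"
    using * unfolding set_integrable_def eq .
  moreover have "(\<lambda>z. indicator U z *\<^sub>R (J z * f (S z))) \<in> borel_measurable lborel"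
    using borel_measurable_continuous_on_indicator[OF _ cont] U by simp
  ultimately show int: "set_integrable lborel U (\<lambda>z. J z * f (S z))"
    unfolding set_integrable_def using integrable_completion by blast
  have "integral U (\<lambda>z. J z * f (S z)) = integral (S ` U) f"
    using ** J(2) by (metis (mono_tags, lifting) integral_cong)
  then show "(LINT z:U|lborel. J z * f (S z)) = (LINT x:S ` U|lborel. f x)"
    using set_borel_integral_eq_integral(2)[OF int] set_borel_integral_eq_integral(2)[OF f(2)] by simp
qed

text \<open>Conjugating \<open>S\<close> with a coordinate relabelling changes neither the integrals
  nor, by \<open>det_reindex\<close>, the Jacobian determinant.\<close>

lemma change_of_variables:
  fixes f :: "real ^ 'n::finite \<Rightarrow> real" and S :: "real ^ 'n \<Rightarrow> real ^ 'n"
  assumes U: "open U" and S: "\<And>z. z \<in> U \<Longrightarrow> (S has_derivative S' z) (at z)" and inj: "inj_on S U"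
    and J: "continuous_on U J" "\<And>z. z \<in> U \<Longrightarrow> J z = \<bar>det (matrix (S' z))\<bar>"
    and f: "continuous_on (S ` U) f" "set_integrable lborel (S ` U) f" and SU: "open (S ` U)"
  shows "set_integrable lborel U (\<lambda>z. J z * f (S z))"
    and "(LINT z:U|lborel. J z * f (S z)) = (LINT x:S ` U|lborel. f x)"
proof -
  define g :: "'n wo_copy \<Rightarrow> 'n" where "g = Rep_wo_copy"
  have g: "bij g"
    unfolding g_def using type_definition_wo_copy
    by (metis bijI injI Rep_wo_copy_inject type_definition.Rep_range)
  let ?R = "reindex g" and ?R' = "reindex (inv g)"
  note R [simp] = reindex_inv[OF g]
  define V where "V = ?R ` U"
  have V_iff: "y \<in> V \<longleftrightarrow> ?R' y \<in> U" for y
  proof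
    assume "?R' y \<in> U"
    then have "?R (?R' y) \<in> V" unfolding V_def by (rule imageI)
    then show "y \<in> V" by simp
  qed (auto simp: V_def)
  define T where "T = (\<lambda>y. ?R (S (?R' y)))"
  define T' where "T' = (\<lambda>y h. ?R (S' (?R' y) (?R' h)))"
  define K where "K = (\<lambda>y. J (?R' y))"
  have TV: "x \<in> T ` V \<longleftrightarrow> ?R' x \<in> S ` U" for x
  proof
    assume "?R' x \<in> S ` U"
    then obtain z where z: "z \<in> U" "?R' x = S z" by auto
    then have "T (?R z) = x" unfolding T_def using R(1)[of x] by simp
    with z show "x \<in> T ` V" unfolding V_def by blast
  qed (auto simp: T_def V_def)
  have contR': "continuous_on A ?R'" for A by (intro continuous_intros)
  have V: "open V"
  proof -
    have "V = ?R' -` U" using V_iff by auto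
    then show ?thesis using open_vimage[OF U contR'] by simp
  qed
  have TVo: "open (T ` V)"
  proof -
    have "T ` V = ?R' -` (S ` U)" using TV by blast
    then show ?thesis using open_vimage[OF SU contR'] by simp
  qed
  have T: "(T has_derivative T' y) (at y)" if "y \<in> V" for y
  proof -
    have lin: "(reindex k has_derivative reindex k) F" for k :: "'c::finite \<Rightarrow> 'd::finite" and F
      using linear_reindex[of k] by (simp add: bounded_linear_imp_has_derivative linear_linear)
    have "?R' y \<in> U" using that V_iff by simp
    from has_derivative_compose[OF has_derivative_compose[OF lin S[OF this]] lin, of g]
    show ?thesis by (simp add: T_def T'_def)
  qed
  have injT: "inj_on T V"
  proof (rule inj_onI)
    fix x y assume "x \<in> V" "y \<in> V" "T x = T y"
    then have "?R' (T x) = ?R' (T y)" "?R' x \<in> U" "?R' y \<in> U"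
      using V_iff by auto
    then have "S (?R' x) = S (?R' y)" "?R' x \<in> U" "?R' y \<in> U"
      by (simp_all add: T_def)
    then have "?R' x = ?R' y" using inj by (auto dest: inj_onD)
    then have "?R (?R' x) = ?R (?R' y)" by simp
    then show "x = y" by simp
  qed
  have K1: "continuous_on V K"
    unfolding K_def using J(1) V_iff by (auto intro!: continuous_on_compose2[OF J(1) contR'])
  have K2: "K y = \<bar>det (matrix (T' y))\<bar>" if "y \<in> V" for y
  proof -
    have "?R' (axis j 1) = axis (g j) 1" for j
    proof -
      have "inv g i = j \<longleftrightarrow> i = g j" for i
        using bij_inv_eq_iff[OF g, of j i] by auto
      then show ?thesis by (auto simp: reindex_def vec_eq_iff axis_def)
    qed
    then have "matrix (T' y) = (\<chi> i j. matrix (S' (?R' y)) $ g i $ g j)"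
      by (simp add: matrix_def T'_def vec_eq_iff) (simp add: reindex_def)
    then show ?thesis using det_reindex[OF g] J(2) that V_iff by (simp add: K_def)
  qed
  let ?f = "\<lambda>x. f (?R' x)"
  have f1: "continuous_on (T ` V) ?f"
    using TV by (auto intro!: continuous_on_compose2[OF f(1) contR'])
  have m1: "(\<lambda>x. indicator (S ` U) x *\<^sub>R f x) \<in> borel_measurable borel"
    using borel_measurable_continuous_on_indicator[OF _ f(1)] SU by simp
  have ind1: "indicator (S ` U) (?R' x) *\<^sub>R f (?R' x) = indicator (T ` V) x *\<^sub>R ?f x" for x
    using TV by (auto simp: indicator_def)
  have f2: "set_integrable lborel (T ` V) ?f"
    using integrable_reindex[OF bij_imp_bij_inv[OF g] m1] f(2) unfolding set_integrable_def ind1 by blast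
  have f3: "(LINT x:T ` V|lborel. ?f x) = (LINT x:S ` U|lborel. f x)"
    using integral_reindex[OF bij_imp_bij_inv[OF g] m1] unfolding set_lebesgue_integral_def ind1 .
  note cv = change_of_variables_wellorder[OF V T injT K1 K2 f1 f2 TVo]
  have eq: "K y * ?f (T y) = J (?R' y) * f (S (?R' y))" for y
    by (simp add: K_def T_def)
  have cont: "continuous_on U (\<lambda>z. J z * f (S z))"
    using has_derivative_continuous_on[of U S S'] S
    by (intro continuous_on_mult J(1) continuous_on_compose2[OF f(1)])
      (auto simp: has_derivative_at_withinI)
  have m2: "(\<lambda>z. indicator U z *\<^sub>R (J z * f (S z))) \<in> borel_measurable borel"
    using borel_measurable_continuous_on_indicator[OF _ cont] U by simp
  have ind2: "indicator U (?R' y) *\<^sub>R (J (?R' y) * f (S (?R' y))) = indicator V y *\<^sub>R (K y * ?f (T y))" for y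
    using V_iff by (auto simp: indicator_def eq)
  show "set_integrable lborel U (\<lambda>z. J z * f (S z))"
    using integrable_reindex[OF bij_imp_bij_inv[OF g] m2] cv(1) unfolding set_integrable_def ind2 by blast
  show "(LINT z:U|lborel. J z * f (S z)) = (LINT x:S ` U|lborel. f x)"
    using integral_reindex[OF bij_imp_bij_inv[OF g] m2] cv(2) f3
    unfolding set_lebesgue_integral_def ind2 by (rule trans[OF sym trans])
qed

section \<open>Integration by parts and ground states\<close>

lemma continuous_on_UNIV_extend:
  fixes f :: "'a::t2_space \<Rightarrow> 'b::real_normed_vector"
  assumes "open S" "continuous_on S f" "compact K" "K \<subseteq> S" "\<And>x. x \<notin> K \<Longrightarrow> f x = 0"
  shows "continuous_on UNIV f"
proof -
  have "continuous_on (- K) f"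
    using assms(5) by (subst continuous_on_cong[where g = "\<lambda>x. 0"]) auto
  moreover have "UNIV = S \<union> - K" using assms(4) by auto
  moreover have "open (- K)" using assms(3) by (simp add: compact_imp_closed open_Compl)
  ultimately show ?thesis using continuous_on_open_Un assms(1,2) by metis
qed

lemma has_derivative_zero_off:
  assumes "closed K" "\<And>x. x \<notin> K \<Longrightarrow> f x = 0" "x \<notin> K"
  shows "(f has_derivative (\<lambda>h. 0)) (at x)"
proof (rule has_derivative_transform_within_open[OF has_derivative_const])
  show "open (- K)" using assms(1) by (simp add: open_Compl)
qed (use assms in auto)

lemma integrable_compact_support:
  fixes f :: "'a::euclidean_space \<Rightarrow> real"
  assumes "continuous_on UNIV f" "compact K" "\<And>x. x \<notin> K \<Longrightarrow> f x = 0"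
  shows "integrable lborel f"
proof -
  have "integrable lborel (\<lambda>x. indicator K x *\<^sub>R f x)"
    using assms by (intro borel_integrable_compact) (auto intro: continuous_on_subset)
  moreover have "(\<lambda>x. indicator K x *\<^sub>R f x) = f"
    using assms(3) by (fastforce simp: indicator_def fun_eq_iff)
  ultimately show ?thesis by simp
qed

text \<open>The difference quotients of \<open>f\<close> in direction \<open>e\<close> have integral
  zero by translation invariance; they are bounded by the mean value theorem and live on one compact
  set, so dominated convergence passes to the derivative.\<close>

lemma integral_directional_derivative_zero:
  fixes f :: "'a::euclidean_space \<Rightarrow> real"
  assumes f: "\<And>x. (f has_derivative f' x) (at x)" and cont: "continuous_on UNIV (\<lambda>x. f' x e)"
    and K: "compact K" "\<And>x. x \<notin> K \<Longrightarrow> f x = 0"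
  shows "integrable lborel (\<lambda>x. f' x e)" "(LINT x|lborel. f' x e) = 0"
proof -
  have zero: "f' x e = 0" if "x \<notin> K" for x
  proof -
    have "(f has_derivative (\<lambda>h. 0)) (at x)"
      using has_derivative_zero_off[OF compact_imp_closed[OF K(1)], of f] K(2) that by blast
    then show ?thesis using f has_derivative_unique by metis
  qed
  show int: "integrable lborel (\<lambda>x. f' x e)"
    using integrable_compact_support[OF cont K(1)] zero by simp
  obtain M where M: "M > 0" "\<And>x. x \<in> K \<Longrightarrow> \<bar>f' x e\<bar> \<le> M"
  proof -
    have "compact ((\<lambda>x. f' x e) ` K)"
      using cont K(1) by (intro compact_continuous_image) (auto intro: continuous_on_subset)
    then obtain b where "b > 0" "\<forall>y\<in>(\<lambda>x. f' x e) ` K. norm y \<le> b"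
      using bounded_pos compact_imp_bounded by metis
    then show ?thesis using that by auto
  qed
  have M': "\<bar>f' x e\<bar> \<le> M" for x
    using M zero by (cases "x \<in> K") auto
  have contf: "continuous_on UNIV f"
    using has_derivative_continuous_on[of UNIV f f'] f by simp
  have intf: "integrable lborel f"
    using integrable_compact_support[OF contf K] by simp
  \<comment> \<open>The set swept out by \<open>K\<close> under the shifts by \<open>- s e\<close>
    with 0 \<le> s \<le> 1; off it, the difference quotients with steps 1/(k+1) all vanish.\<close>
  define L where "L = (\<lambda>p. fst p - snd p *\<^sub>R e) ` (K \<times> {0..1})"
  have L: "compact L"
    unfolding L_def using K(1) by (intro compact_continuous_image compact_Times continuous_intros) auto
  define s where "s = (\<lambda>k x. (f (x + (1 / real (Suc k)) *\<^sub>R e) - f x) * real (Suc k))"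
  have line: "((\<lambda>t. f (x + t *\<^sub>R e)) has_derivative (\<lambda>t. t * f' (x + s *\<^sub>R e) e)) (at s)" for x s
  proof -
    have "((\<lambda>t. f (x + t *\<^sub>R e)) has_derivative (\<lambda>t. f' (x + s *\<^sub>R e) (t *\<^sub>R e))) (at s)"
      by (rule has_derivative_compose[OF _ f]) (auto intro!: derivative_eq_intros)
    then show ?thesis
      using linear_scale[OF has_derivative_linear[OF f]] by simp
  qed
  have bound: "norm (s k x) \<le> M * indicator L x" for k x
  proof (cases "x \<in> L")
    case True
    obtain t where "f (x + (1 / real (Suc k)) *\<^sub>R e) - f (x + 0 *\<^sub>R e) = (1 / real (Suc k) - 0) * f' (x + t *\<^sub>R e) e"
      using mvt_very_simple[of 0 "1 / real (Suc k)" "\<lambda>t. f (x + t *\<^sub>R e)" "\<lambda>s t. t * f' (x + s *\<^sub>R e) e"]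
        line has_derivative_at_withinI by (metis (no_types, lifting) divide_nonneg_nonneg of_nat_0_le_iff zero_le_one)
    then have "s k x = f' (x + t *\<^sub>R e) e" by (simp add: s_def)
    then show ?thesis using M' True by simp
  next
    case False
    have "x + t *\<^sub>R e \<notin> K" if "t \<in> {0..1}" for t
    proof
      assume "x + t *\<^sub>R e \<in> K"
      then have "x \<in> L" unfolding L_def using that by (intro image_eqI[of _ _ "(x + t *\<^sub>R e, t)"]) auto
      then show False using False by simp
    qed
    from this[of 0] this[of "1 / real (Suc k)"] have "s k x = 0"
      using K(2) by (simp add: s_def)
    then show ?thesis using False by simp
  qed
  have lim: "(\<lambda>k. s k x) \<longlonglongrightarrow> f' x e" for x
  proof -
    have "((\<lambda>t. f (x + t *\<^sub>R e)) has_field_derivative f' x e) (at 0)"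
      using line[of x 0] by (simp add: has_field_derivative_def mult_commute_abs)
    then have "((\<lambda>h. (f (x + h *\<^sub>R e) - f x) / h) \<longlongrightarrow> f' x e) (at 0)"
      by (simp add: DERIV_def)
    moreover have "filterlim (\<lambda>k. 1 / real (Suc k)) (at 0) sequentially"
      using LIMSEQ_inverse_real_of_nat by (auto simp: filterlim_at inverse_eq_divide intro!: always_eventually)
    ultimately have "(\<lambda>k. (f (x + (1 / real (Suc k)) *\<^sub>R e) - f x) / (1 / real (Suc k))) \<longlonglongrightarrow> f' x e"
      by (rule filterlim_compose)
    then show ?thesis by (simp add: s_def)
  qed
  have shift: "integrable lborel (\<lambda>x. f (x + v))" "(LINT x|lborel. f (x + v)) = (LINT x|lborel. f x)" for v
  proof -
    have m: "f \<in> borel_measurable borel" using contf by (rule borel_measurable_continuous_onI)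
    show "integrable lborel (\<lambda>x. f (x + v))" "(LINT x|lborel. f (x + v)) = (LINT x|lborel. f x)"
      using integrable_distr_eq[of "(+) v" lborel borel f] integral_distr[of "(+) v" lborel borel f] m intf
      by (simp_all add: lborel_distr_plus add.commute)
  qed
  have ints: "(LINT x|lborel. s k x) = 0" for k
    unfolding s_def using shift[of "(1 / real (Suc k)) *\<^sub>R e"] intf by simp
  have "(\<lambda>k. LINT x|lborel. s k x) \<longlonglongrightarrow> (LINT x|lborel. f' x e)"
  proof (rule integral_dominated_convergence[where w = "\<lambda>x. M * indicator L x"])
    show "(\<lambda>x. f' x e) \<in> borel_measurable lborel" using int by blast
    show "s k \<in> borel_measurable lborel" for k
      unfolding s_def using contf
      by (auto intro!: borel_measurable_continuous_onI continuous_intros continuous_on_compose2[OF contf])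
    show "integrable lborel (\<lambda>x. M * indicator L x)"
      using L emeasure_bounded_finite[OF compact_imp_bounded[OF L]]
      by (intro integrable_mult_right integrable_real_indicator) (auto simp: compact_imp_closed)
  qed (use lim bound in auto)
  then show "(LINT x|lborel. f' x e) = 0"
    unfolding ints using LIMSEQ_const_iff by metis
qed

section \<open>Test functions: derivatives, supports, integrability\<close>

lemma test_functionsD:
  assumes "u \<in> test_functions \<Omega>"
  shows "\<And>x. (u has_derivative (\<lambda>h. grad u x \<bullet> h)) (at x)"
    "continuous_on S u" "continuous_on S (grad u)"
proof -
  have sm: "Ck_function k u" for k
    using assms by (auto simp: test_functions_def smooth_function_def)
  show d: "(u has_derivative (\<lambda>h. grad u x \<bullet> h)) (at x)" for x
    using sm[of 1] differentiable_grad by auto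
  show "continuous_on S u"
    using sm[of 0] continuous_on_subset by auto
  have "continuous_on UNIV (grad u)"
    unfolding grad_def using sm[of 1] by (intro continuous_on_vec_lambda) auto
  then show "continuous_on S (grad u)" using continuous_on_subset by blast
qed

lemma test_functionsE:
  assumes "u \<in> test_functions \<Omega>"
  obtains K where "compact K" "K \<subseteq> \<Omega>" "\<And>x. x \<notin> K \<Longrightarrow> u x = 0" "\<And>x. x \<notin> K \<Longrightarrow> grad u x = 0"
proof -
  define K where "K = closure {x. u x \<noteq> 0}"
  have K: "compact K" "K \<subseteq> \<Omega>"
    using assms by (auto simp: test_functions_def K_def)
  have z: "u x = 0" if "x \<notin> K" for x
  proof (rule ccontr)
    assume "u x \<noteq> 0"
    then have "x \<in> K" unfolding K_def by (intro closure_subset[THEN subsetD]) simp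
    with that show False by simp
  qed
  have "grad u x = 0" if "x \<notin> K" for x
  proof (rule grad_eqI)
    show "(u has_derivative (\<lambda>h. 0 \<bullet> h)) (at x)"
      using has_derivative_zero_off[OF compact_imp_closed[OF K(1)] z that] by simp
  qed
  with K z show ?thesis using that by blast
qed

text \<open>\<open>F\<close> stands for an expression that vanishes together with \<open>u\<close>
  and \<open>grad u\<close>. Its support is then compact inside \<Omega>, so continuity on \<Omega>
  suffices even if its coefficients blow up at the boundary.\<close>

lemma set_integrable_test_function:
  fixes F :: "real ^ 'n::finite \<Rightarrow> real"
  assumes "open \<Omega>" "u \<in> test_functions \<Omega>" "continuous_on \<Omega> F"
    and "\<And>x. u x = 0 \<Longrightarrow> grad u x = 0 \<Longrightarrow> F x = 0"
  shows "set_integrable lborel \<Omega> F" "integrable lborel F" "(LINT x:\<Omega>|lborel. F x) = (LINT x|lborel. F x)"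
proof -
  obtain K where K: "compact K" "K \<subseteq> \<Omega>" "\<And>x. x \<notin> K \<Longrightarrow> u x = 0" "\<And>x. x \<notin> K \<Longrightarrow> grad u x = 0"
    using test_functionsE[OF assms(2)] by metis
  have F: "F x = 0" if "x \<notin> K" for x
    using assms(4) K(3,4) that by blast
  then have "continuous_on UNIV F"
    using continuous_on_UNIV_extend[OF assms(1,3) K(1,2)] by blast
  then show I: "integrable lborel F"
    using integrable_compact_support K(1) F by blast
  have "(\<lambda>x. indicator \<Omega> x *\<^sub>R F x) = F"
    using F K(2) by (fastforce simp: indicator_def fun_eq_iff)
  then show "set_integrable lborel \<Omega> F" "(LINT x:\<Omega>|lborel. F x) = (LINT x|lborel. F x)"
    using I by (auto simp: set_integrable_def set_lebesgue_integral_def)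
qed

text \<open>The sum is the divergence of \<open>Z\<close>, and div Z + |Z|^2 becomes
  \<Delta>\<Phi>/\<Phi> for a logarithmic gradient. Formulating it with \<open>Z\<close> alone
  avoids second derivatives of \<Phi>.\<close>

lemma ground_state_identity:
  fixes Z :: "real ^ 'n::finite \<Rightarrow> real ^ 'n"
  assumes "open \<Omega>" and test: "u \<in> test_functions \<Omega>"
    and Z: "\<And>x. x \<in> \<Omega> \<Longrightarrow> (Z has_derivative Z' x) (at x)"
    and Z': "\<And>i. continuous_on \<Omega> (\<lambda>x. Z' x (axis i 1) $ i)"
  shows "(LINT x:\<Omega>|lborel. (norm (grad u x))\<^sup>2 + (u x)\<^sup>2 * ((\<Sum>i\<in>UNIV. Z' x (axis i 1) $ i) + (norm (Z x))\<^sup>2))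
       = (LINT x:\<Omega>|lborel. (norm (grad u x - u x *\<^sub>R Z x))\<^sup>2)"
proof -
  note u = test_functionsD[OF test]
  obtain K where K: "compact K" "K \<subseteq> \<Omega>" "\<And>x. x \<notin> K \<Longrightarrow> u x = 0" "\<And>x. x \<notin> K \<Longrightarrow> grad u x = 0"
    using test_functionsE[OF test] by metis
  have contZ: "continuous_on \<Omega> Z"
    using has_derivative_continuous_on[of \<Omega> Z Z'] Z has_derivative_at_withinI by blast
  define f' where "f' = (\<lambda>i x h. 2 * u x * (grad u x \<bullet> h) * Z x $ i + (u x)\<^sup>2 * Z' x h $ i)"
  have f': "((\<lambda>x. (u x)\<^sup>2 * Z x $ i) has_derivative f' i x) (at x)" for i x
  proof (cases "x \<in> \<Omega>")
    case True
    have "((\<lambda>x. Z x $ i) has_derivative (\<lambda>h. Z' x h $ i)) (at x)"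
      using Z[OF True] bounded_linear.has_derivative[OF bounded_linear_vec_nth] by blast
    from has_derivative_mult[OF has_derivative_power[OF u(1)[of x], of 2] this] show ?thesis
      by (rule has_derivative_eq_rhs) (simp add: f'_def fun_eq_iff)
  next
    case False
    then have "x \<notin> K" using K(2) by blast
    then have "((\<lambda>x. (u x)\<^sup>2 * Z x $ i) has_derivative (\<lambda>h. 0)) (at x)"
      using K(3) by (intro has_derivative_zero_off[OF compact_imp_closed[OF K(1)]]) auto
    moreover have "f' i x = (\<lambda>h. 0)"
      using K(3,4) \<open>x \<notin> K\<close> by (simp add: f'_def fun_eq_iff)
    ultimately show ?thesis by simp
  qed
  have cont: "continuous_on \<Omega> (\<lambda>x. f' i x (axis i 1))" for i
    unfolding f'_def using Z' contZ
    by (intro continuous_intros u(2,3) Z') auto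
  have "continuous_on UNIV (\<lambda>x. f' i x (axis i 1))" for i
    using continuous_on_UNIV_extend[OF assms(1) cont K(1,2)] K(3,4) by (simp add: f'_def)
  then have f'0: "integrable lborel (\<lambda>x. f' i x (axis i 1))" "(LINT x|lborel. f' i x (axis i 1)) = 0" for i
    using integral_directional_derivative_zero[OF f' _ K(1)] K(3) by auto
  let ?div = "\<lambda>x. (\<Sum>i\<in>UNIV. Z' x (axis i 1) $ i)"
  have sumf': "(\<Sum>i\<in>UNIV. f' i x (axis i 1)) = 2 * u x * (grad u x \<bullet> Z x) + (u x)\<^sup>2 * ?div x" for x
    unfolding f'_def
    by (simp add: sum.distrib inner_axis sum_distrib_left mult.assoc) (simp add: inner_vec_def sum_distrib_left)
  have "(LINT x|lborel. 2 * u x * (grad u x \<bullet> Z x) + (u x)\<^sup>2 * ?div x) = 0"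
    using f'0 by (simp flip: sumf')
  moreover have "(LINT x:\<Omega>|lborel. 2 * u x * (grad u x \<bullet> Z x) + (u x)\<^sup>2 * ?div x)
      = (LINT x|lborel. 2 * u x * (grad u x \<bullet> Z x) + (u x)\<^sup>2 * ?div x)"
    and 1: "set_integrable lborel \<Omega> (\<lambda>x. 2 * u x * (grad u x \<bullet> Z x) + (u x)\<^sup>2 * ?div x)"
    by (intro set_integrable_test_function[OF assms(1) test] continuous_intros contZ u Z'; simp)+
  ultimately have 0: "(LINT x:\<Omega>|lborel. 2 * u x * (grad u x \<bullet> Z x) + (u x)\<^sup>2 * ?div x) = 0" by simp
  have 2: "set_integrable lborel \<Omega> (\<lambda>x. (norm (grad u x - u x *\<^sub>R Z x))\<^sup>2)"
    by (intro set_integrable_test_function[OF assms(1) test] continuous_intros contZ u; simp)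
  have "(norm (grad u x))\<^sup>2 + (u x)\<^sup>2 * (?div x + (norm (Z x))\<^sup>2)
      = (norm (grad u x - u x *\<^sub>R Z x))\<^sup>2 + (2 * u x * (grad u x \<bullet> Z x) + (u x)\<^sup>2 * ?div x)" for x
    unfolding power2_norm_eq_inner
    by (simp add: inner_diff inner_commute algebra_simps power2_eq_square)
  then show ?thesis
    using 0 set_integral_add(2)[OF 2 1] by simp
qed

section \<open>The Hardy inequality in the half-space\<close>

lemma open_half_space: "open (half_space i)"
  unfolding half_space_def by (intro open_Collect_less continuous_intros)

text \<open>The logarithmic gradient of the half-space ground state z_i |z|^(-\<gamma>).\<close>

definition half_space_field :: "'n::finite \<Rightarrow> real \<Rightarrow> real ^ 'n \<Rightarrow> real ^ 'n" where
  "half_space_field i \<gamma> z = (1 / z $ i) *\<^sub>R axis i 1 - (\<gamma> / (z \<bullet> z)) *\<^sub>R z"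

text \<open>An identity because the ground state solves its equation exactly. It exhibits the left
  side of the inequality behind \<open>best_const\<close> as the integral of a square, so that 0 is
  an admissible constant.\<close>

lemma half_space_hardy:
  fixes w :: "real ^ 'n::finite \<Rightarrow> real"
  assumes w: "w \<in> test_functions (half_space i)"
  shows "(LINT x:half_space i|lborel. (norm (grad w x))\<^sup>2)
          - \<gamma> * (real CARD('n) - \<gamma>) * (LINT x:half_space i|lborel. (w x)\<^sup>2 / (norm x)\<^sup>2)
       = (LINT x:half_space i|lborel. (norm (grad w x - w x *\<^sub>R half_space_field i \<gamma> x))\<^sup>2)"
proof -
  let ?H = "half_space i" and ?Z = "half_space_field i \<gamma>"
  define Z' where "Z' = (\<lambda>z h :: real ^ 'n. - (h $ i / (z $ i)\<^sup>2) *\<^sub>R axis i 1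
      - (\<gamma> / (z \<bullet> z)) *\<^sub>R h + (2 * \<gamma> * (z \<bullet> h) / (z \<bullet> z)\<^sup>2) *\<^sub>R z)"
  note u = test_functionsD[OF w]
  have nz: "z $ i \<noteq> 0" "z \<bullet> z \<noteq> 0" "z \<noteq> 0" if "z \<in> ?H" for z
    using that by (auto simp: half_space_def)
  have Z: "(?Z has_derivative Z' z) (at z)" if "z \<in> ?H" for z
    unfolding half_space_field_def[abs_def] Z'_def using nz[OF that]
    by (auto intro!: derivative_eq_intros bounded_linear.has_derivative[OF bounded_linear_vec_nth] simp: fun_eq_iff field_simps power2_eq_square inner_commute)
  have cont: "continuous_on ?H (\<lambda>x. Z' x (axis j 1) $ j)" for j
    unfolding Z'_def using nz by (auto intro!: continuous_intros)
  have "(\<Sum>j\<in>UNIV. Z' z (axis j 1) $ j) + (norm (?Z z))\<^sup>2 = - \<gamma> * (real CARD('n) - \<gamma>) / (norm z)\<^sup>2"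
    if "z \<in> ?H" for z
  proof -
    have "(\<Sum>j\<in>UNIV. Z' z (axis j 1) $ j) =
      - (1 / (z $ i)\<^sup>2) - \<gamma> / (z \<bullet> z) * real CARD('n) + (\<Sum>j\<in>UNIV. 2 * \<gamma> * (z $ j * z $ j) / (z \<bullet> z)\<^sup>2)"
      unfolding Z'_def
      by (simp add: sum.distrib sum_subtractf inner_axis sum_negf)
        (simp add: axis_def mult_ac if_distrib[of "\<lambda>x. x * _"] if_distrib[of "\<lambda>x. _ * x"] if_distrib[of "\<lambda>x. x / _"] sum.delta cong: if_cong)
    also have "(\<Sum>j\<in>UNIV. 2 * \<gamma> * (z $ j * z $ j) / (z \<bullet> z)\<^sup>2) = 2 * \<gamma> * (z \<bullet> z) / (z \<bullet> z)\<^sup>2"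
      by (simp add: inner_vec_def sum_distrib_left sum_divide_distrib)
    finally have 1: "(\<Sum>j\<in>UNIV. Z' z (axis j 1) $ j) =
      - (1 / (z $ i)\<^sup>2) - \<gamma> / (z \<bullet> z) * real CARD('n) + 2 * \<gamma> * (z \<bullet> z) / (z \<bullet> z)\<^sup>2" .
    have 2: "(norm (?Z z))\<^sup>2 = 1 / (z $ i)\<^sup>2 - 2 * \<gamma> / (z \<bullet> z) + \<gamma>\<^sup>2 * (z \<bullet> z) / (z \<bullet> z)\<^sup>2"
      unfolding power2_norm_eq_inner half_space_field_def using nz[OF that]
      by (simp add: inner_diff inner_axis inner_axis' field_simps power2_eq_square)
    show ?thesis
      unfolding 1 2 unfolding power2_norm_eq_inner using nz[OF that]
      by (simp add: field_simps power2_eq_square)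
  qed
  then have *: "(norm (grad w x))\<^sup>2 + (w x)\<^sup>2 * ((\<Sum>j\<in>UNIV. Z' x (axis j 1) $ j) + (norm (?Z x))\<^sup>2)
     = (norm (grad w x))\<^sup>2 - \<gamma> * (real CARD('n) - \<gamma>) * ((w x)\<^sup>2 / (norm x)\<^sup>2)" if "x \<in> ?H" for x
    using that by simp
  have i1: "set_integrable lborel ?H (\<lambda>x. (norm (grad w x))\<^sup>2)"
    by (intro set_integrable_test_function[OF open_half_space w] continuous_intros u) simp
  have i2: "set_integrable lborel ?H (\<lambda>x. (w x)\<^sup>2 / (norm x)\<^sup>2)"
    using nz by (intro set_integrable_test_function[OF open_half_space w] continuous_intros u) auto
  have "(LINT x:?H|lborel. (norm (grad w x))\<^sup>2 - \<gamma> * (real CARD('n) - \<gamma>) * ((w x)\<^sup>2 / (norm x)\<^sup>2))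
    = (LINT x:?H|lborel. (norm (grad w x))\<^sup>2 + (w x)\<^sup>2 * ((\<Sum>j\<in>UNIV. Z' x (axis j 1) $ j) + (norm (?Z x))\<^sup>2))"
  proof (rule set_lebesgue_integral_cong)
    show "?H \<in> sets lborel" using open_half_space[of i] by simp
  qed (auto simp only: *)
  also have "\<dots> = (LINT x:?H|lborel. (norm (grad w x - w x *\<^sub>R ?Z x))\<^sup>2)"
    by (rule ground_state_identity[OF open_half_space w Z cont])
  finally have "(LINT x:?H|lborel. (norm (grad w x))\<^sup>2 - \<gamma> * (real CARD('n) - \<gamma>) * ((w x)\<^sup>2 / (norm x)\<^sup>2))
    = (LINT x:?H|lborel. (norm (grad w x - w x *\<^sub>R ?Z x))\<^sup>2)" .
  then show ?thesis
    using set_integral_diff(2)[OF i1 set_integrable_mult_right[OF i2, of "\<gamma> * (real CARD('n) - \<gamma>)"]]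
    unfolding set_integral_mult_right by simp
qed

text \<open>A test function with \<open>N > 0\<close> bounds the set of admissible constants, so that the supremum in
  \<^const>\<open>best_const\<close> is not a junk value.\<close>

lemma best_const_bound:
  fixes w :: "real ^ 'n::finite \<Rightarrow> real" and \<gamma> :: real
  assumes w: "w \<in> test_functions (half_space i)"
  defines "n \<equiv> real CARD('n)"
  defines "N \<equiv> (LINT x:half_space i|lborel. \<bar>w x\<bar> powr (2 * n / (n - 2)))"
  defines "E \<equiv> (LINT x:half_space i|lborel. (norm (grad w x - w x *\<^sub>R half_space_field i \<gamma> x))\<^sup>2)"
  shows "E \<ge> 0" "N > 0 \<Longrightarrow> best_const i \<gamma> \<ge> 0" "N > 0 \<Longrightarrow> E \<ge> best_const i \<gamma> * N powr ((n - 2) / n)"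
proof -
  define A where "A = {S. \<forall>u \<in> test_functions (half_space i).
        (LINT x:half_space i|lborel. (norm (grad u x))\<^sup>2)
          - \<gamma> * (n - \<gamma>) * (LINT x:half_space i|lborel. (u x)\<^sup>2 / (norm x)\<^sup>2)
        \<ge> S * (LINT x:half_space i|lborel. \<bar>u x\<bar> powr (2 * n / (n - 2))) powr ((n - 2) / n)}"
  have best: "best_const i \<gamma> = Sup A"
    unfolding best_const_def A_def n_def Let_def ..
  have nonneg: "0 \<le> (LINT x:half_space i|lborel. (norm (grad u x - u x *\<^sub>R half_space_field i \<gamma> x))\<^sup>2)"
    for u :: "real ^ 'n \<Rightarrow> real"
    unfolding set_lebesgue_integral_def by (intro integral_nonneg_AE) auto
  then show "E \<ge> 0" unfolding E_def .
  have A0: "0 \<in> A"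
    unfolding A_def n_def using half_space_hardy[of _ i \<gamma>] nonneg by simp
  assume N: "N > 0"
  have A1: "S \<le> E / N powr ((n - 2) / n)" if "S \<in> A" for S
  proof -
    have "E \<ge> S * N powr ((n - 2) / n)"
      using that w half_space_hardy[OF w, of \<gamma>] unfolding A_def E_def N_def n_def by auto
    then show ?thesis using N by (simp add: pos_le_divide_eq)
  qed
  then have bdd: "bdd_above A" by (meson bdd_aboveI)
  show "best_const i \<gamma> \<ge> 0" unfolding best using A0 bdd by (rule cSup_upper)
  have "best_const i \<gamma> \<le> E / N powr ((n - 2) / n)"
    unfolding best using A0 A1 by (intro cSup_least) auto
  then show "E \<ge> best_const i \<gamma> * N powr ((n - 2) / n)"
    using N by (simp add: pos_le_divide_eq)
qed

section \<open>Inversions and radial maps\<close>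

lemma linear_rank_one_perturbation: "linear (\<lambda>v. a *\<^sub>R v + (b * (w \<bullet> v)) *\<^sub>R w)"
  by (auto intro!: linearI simp: inner_right_distrib algebra_simps)

text \<open>A rotation taking |w| e_k to \<open>w\<close> conjugates the map to a diagonal one, with
  eigenvalue \<open>a\<close> orthogonally to \<open>w\<close> and a + b|w|^2 along
  \<open>w\<close>.\<close>

lemma det_rank_one_perturbation:
  fixes w :: "real ^ 'n::finite"
  shows "det (matrix (\<lambda>v. a *\<^sub>R v + (b * (w \<bullet> v)) *\<^sub>R w)) = a ^ (CARD('n) - 1) * (a + b * (norm w)\<^sup>2)"
proof -
  obtain k :: 'n where True by simp
  define f where "f = (\<lambda>v. a *\<^sub>R v + (b * (w \<bullet> v)) *\<^sub>R w)"
  define g where "g = (\<lambda>v :: real ^ 'n. a *\<^sub>R v + (b * (norm w)\<^sup>2 * v $ k) *\<^sub>R axis k 1)"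
  have "norm (norm w *\<^sub>R axis k 1 :: real ^ 'n) = norm w" by (simp add: norm_axis_1)
  then obtain Q :: "real ^ 'n \<Rightarrow> real ^ 'n" where Q: "orthogonal_transformation Q" "Q (norm w *\<^sub>R axis k 1) = w"
    by (rule orthogonal_transformation_exists)
  have linQ: "linear Q" using Q(1) by (simp add: orthogonal_transformation_linear)
  have linf: "linear f" "linear g"
    unfolding f_def g_def by (auto intro!: linearI simp: inner_right_distrib algebra_simps)
  have w: "w = norm w *\<^sub>R Q (axis k 1)"
    using Q(2) linear_scale[OF linQ] by metis
  have "w \<bullet> Q v = norm w * v $ k" for v
  proof -
    have "Q (axis k 1) \<bullet> Q v = v $ k"
      using Q(1) by (simp add: orthogonal_transformation_def inner_axis')
    then show ?thesis by (subst w) simp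
  qed
  then have "f (Q v) = a *\<^sub>R Q v + (b * (norm w * v $ k)) *\<^sub>R (norm w *\<^sub>R Q (axis k 1))" for v
    unfolding f_def using w by simp
  then have "f (Q v) = Q (g v)" for v
    by (simp add: g_def linear_add[OF linQ] linear_scale[OF linQ] power2_eq_square mult_ac)
  then have "f \<circ> Q = Q \<circ> g" by auto
  then have "matrix f ** matrix Q = matrix Q ** matrix g"
    using matrix_compose[OF linQ linf(1)] matrix_compose[OF linf(2) linQ] by simp
  then have "det (matrix f) * det (matrix Q) = det (matrix Q) * det (matrix g)"
    by (metis det_mul)
  moreover have "det (matrix Q) \<noteq> 0"
    using Q(1) det_orthogonal_matrix orthogonal_transformation_matrix by fastforce
  ultimately have "det (matrix f) = det (matrix g)" by simp
  also have "\<dots> = (\<Prod>i\<in>UNIV. a + (if i = k then b * (norm w)\<^sup>2 else 0))"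
    by (subst det_diagonal) (auto simp: matrix_def g_def axis_def intro!: prod.cong)
  also have "\<dots> = (a + b * (norm w)\<^sup>2) * (\<Prod>i\<in>UNIV - {k}. a)"
    by (subst prod.remove[of _ k]) (auto intro!: prod.cong)
  finally show ?thesis by (simp add: f_def card_Diff_singleton mult.commute)
qed

text \<open>The map is symmetric, and for nonzero \<open>z\<close> its eigenvalues are among
  \<open>a\<close> and a + b|z|^2; both are nonnegative here, so the larger bounds its norm.\<close>

lemma norm_rank_one_perturbation_le:
  fixes z :: "'a::real_inner"
  assumes "a \<ge> 0" "a + b * (norm z)\<^sup>2 \<ge> 0"
  shows "norm (a *\<^sub>R h + (b * (z \<bullet> h)) *\<^sub>R z) \<le> max a (a + b * (norm z)\<^sup>2) * norm h"
proof (rule power2_le_imp_le)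
  have "(norm (a *\<^sub>R h + (b * (z \<bullet> h)) *\<^sub>R z))\<^sup>2 = a\<^sup>2 * (norm h)\<^sup>2 + (2 * a * b + b\<^sup>2 * (norm z)\<^sup>2) * (z \<bullet> h)\<^sup>2"
    unfolding power2_norm_eq_inner
    by (simp add: inner_add inner_commute algebra_simps power2_eq_square)
  also have "\<dots> \<le> (max a (a + b * (norm z)\<^sup>2))\<^sup>2 * (norm h)\<^sup>2"
  \<comment> \<open>This coefficient times |z|^2 is the difference of the squared eigenvalues, so
    its sign tells which of the two dominates.\<close>
  proof (cases "2 * a * b + b\<^sup>2 * (norm z)\<^sup>2 \<le> 0")
    case True
    then have "a\<^sup>2 * (norm h)\<^sup>2 + (2 * a * b + b\<^sup>2 * (norm z)\<^sup>2) * (z \<bullet> h)\<^sup>2 \<le> a\<^sup>2 * (norm h)\<^sup>2"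
      by (simp add: mult_nonpos_nonneg)
    also have "\<dots> \<le> (max a (a + b * (norm z)\<^sup>2))\<^sup>2 * (norm h)\<^sup>2"
      using assms by (intro mult_right_mono power_mono) auto
    finally show ?thesis .
  next
    case False
    have "(z \<bullet> h)\<^sup>2 \<le> (norm z)\<^sup>2 * (norm h)\<^sup>2"
      using Cauchy_Schwarz_ineq[of z h] by (simp add: power2_norm_eq_inner)
    then have "a\<^sup>2 * (norm h)\<^sup>2 + (2 * a * b + b\<^sup>2 * (norm z)\<^sup>2) * (z \<bullet> h)\<^sup>2
       \<le> a\<^sup>2 * (norm h)\<^sup>2 + (2 * a * b + b\<^sup>2 * (norm z)\<^sup>2) * ((norm z)\<^sup>2 * (norm h)\<^sup>2)"
      using False by (intro add_left_mono mult_left_mono) auto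
    also have "\<dots> = (a + b * (norm z)\<^sup>2)\<^sup>2 * (norm h)\<^sup>2"
      by (simp add: algebra_simps power2_eq_square)
    also have "\<dots> \<le> (max a (a + b * (norm z)\<^sup>2))\<^sup>2 * (norm h)\<^sup>2"
      using assms by (intro mult_right_mono power_mono) auto
    finally show ?thesis .
  qed
  finally show "(norm (a *\<^sub>R h + (b * (z \<bullet> h)) *\<^sub>R z))\<^sup>2 \<le> (max a (a + b * (norm z)\<^sup>2) * norm h)\<^sup>2"
    by (simp add: power_mult_distrib)
qed (use assms in auto)

lemma has_derivative_radial:
  fixes z :: "'a::real_inner"
  assumes "z \<noteq> 0" "(g has_real_derivative g') (at (norm z))"
  shows "((\<lambda>z. g (norm z) *\<^sub>R z) has_derivative
    (\<lambda>h. g (norm z) *\<^sub>R h + (g' / norm z * (z \<bullet> h)) *\<^sub>R z)) (at z)"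
proof -
  have "(norm has_derivative (\<lambda>h. sgn z \<bullet> h)) (at z)"
    using has_derivative_norm[OF assms(1)] by (simp add: inner_commute)
  from has_derivative_compose[OF this, of g "\<lambda>h. g' * h"] assms(2)
  have "((\<lambda>z. g (norm z)) has_derivative (\<lambda>h. g' * (sgn z \<bullet> h))) (at z)"
    by (simp add: has_field_derivative_def)
  from has_derivative_scaleR[OF this has_derivative_ident]
  show ?thesis
    by (rule has_derivative_eq_rhs) (simp add: fun_eq_iff sgn_div_norm field_simps)
qed

text \<open>Reflection in the sphere around \<open>p\<close> whose squared radius is
  \<open>s\<close>.\<close>

definition inversion :: "'a::real_inner \<Rightarrow> real \<Rightarrow> 'a \<Rightarrow> 'a" where
  "inversion p s y = p + (s / ((y - p) \<bullet> (y - p))) *\<^sub>R (y - p)"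

lemma has_derivative_inverse_square:
  fixes y :: "'a::real_inner"
  assumes "y \<noteq> p"
  shows "((\<lambda>y. (s / ((y - p) \<bullet> (y - p))) *\<^sub>R (y - p)) has_derivative
    (\<lambda>h. (s / ((y - p) \<bullet> (y - p))) *\<^sub>R h + (- 2 * s / ((y - p) \<bullet> (y - p))\<^sup>2 * ((y - p) \<bullet> h)) *\<^sub>R (y - p))) (at y)"
  using assms
  by (auto intro!: derivative_eq_intros simp: fun_eq_iff inner_commute power2_eq_square)

lemma has_derivative_inversion:
  assumes "y \<noteq> p"
  shows "(inversion p s has_derivative
    (\<lambda>h. (s / ((y - p) \<bullet> (y - p))) *\<^sub>R h + (- 2 * s / ((y - p) \<bullet> (y - p))\<^sup>2 * ((y - p) \<bullet> h)) *\<^sub>R (y - p))) (at y)"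
  unfolding inversion_def[abs_def]
  using has_derivative_add[OF has_derivative_const[of p] has_derivative_inverse_square[OF assms, of s]] by simp

text \<open>Conformality: the derivative is s/|w|^2 times the reflection in the hyperplane
  orthogonal to \<open>w\<close>.\<close>

lemma norm_inversion_derivative:
  fixes w :: "'a::real_inner"
  assumes "w \<noteq> 0" "s > 0"
  shows "norm ((s / (w \<bullet> w)) *\<^sub>R h + (- 2 * s / (w \<bullet> w)\<^sup>2 * (w \<bullet> h)) *\<^sub>R w) = s / (w \<bullet> w) * norm h"
proof (rule power2_eq_imp_eq)
  have "(norm ((s / (w \<bullet> w)) *\<^sub>R h + (- 2 * s / (w \<bullet> w)\<^sup>2 * (w \<bullet> h)) *\<^sub>R w))\<^sup>2
    = (s / (w \<bullet> w))\<^sup>2 * (h \<bullet> h) + 2 * (s / (w \<bullet> w)) * (- 2 * s / (w \<bullet> w)\<^sup>2 * (w \<bullet> h)) * (w \<bullet> h)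
      + (- 2 * s / (w \<bullet> w)\<^sup>2 * (w \<bullet> h))\<^sup>2 * (w \<bullet> w)"
    unfolding power2_norm_eq_inner
    by (simp add: inner_add inner_commute power2_eq_square algebra_simps)
  also have "\<dots> = (s / (w \<bullet> w))\<^sup>2 * (h \<bullet> h)"
    using assms(1) by (simp add: field_simps power2_eq_square)
  also have "\<dots> = (s / (w \<bullet> w) * norm h)\<^sup>2"
    unfolding power_mult_distrib power2_norm_eq_inner ..
  finally show "(norm ((s / (w \<bullet> w)) *\<^sub>R h + (- 2 * s / (w \<bullet> w)\<^sup>2 * (w \<bullet> h)) *\<^sub>R w))\<^sup>2 = (s / (w \<bullet> w) * norm h)\<^sup>2" .
qed (use assms in auto)

lemma det_inversion_derivative:
  fixes w :: "real ^ 'n::finite"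
  assumes "w \<noteq> 0" "s > 0"
  shows "\<bar>det (matrix (\<lambda>h. (s / (w \<bullet> w)) *\<^sub>R h + (- 2 * s / (w \<bullet> w)\<^sup>2 * (w \<bullet> h)) *\<^sub>R w))\<bar> = (s / (w \<bullet> w)) ^ CARD('n)"
proof -
  have "s / (w \<bullet> w) + - 2 * s / (w \<bullet> w)\<^sup>2 * (norm w)\<^sup>2 = - (s / (w \<bullet> w))"
    unfolding power2_norm_eq_inner using assms(1) by (simp add: field_simps power2_eq_square)
  then show ?thesis
    unfolding det_rank_one_perturbation using assms power_minus_mult[of "CARD('n)" "s / (w \<bullet> w)"]
    by (simp only: abs_mult power_abs abs_minus abs_of_pos) (simp add: abs_mult power_abs)
qed

lemma inversion_diff: "inversion p s y - p = (s / ((y - p) \<bullet> (y - p))) *\<^sub>R (y - p)"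
  by (simp add: inversion_def)

lemma inversion_inversion:
  fixes y :: "'a::real_inner"
  assumes "y \<noteq> p" "s \<noteq> 0"
  shows "inversion p s (inversion p s y) = y" "inversion p s y \<noteq> p"
proof -
  show 1: "inversion p s y \<noteq> p"
    using inversion_diff[of p s y] assms by auto
  show "inversion p s (inversion p s y) = y"
  proof -
    define w where "w = y - p"
    have w: "w \<noteq> 0" "y = p + w" using assms by (auto simp: w_def)
    show ?thesis
      unfolding inversion_def[of p s "inversion p s y"] inversion_diff using assms(2) w
      by (simp add: field_simps)
  qed
qed

text \<open>With squared radius |p|^2 the sphere of inversion passes through the origin, which is
  therefore fixed. The first formula is the distortion of the distance to this fixed point.\<close>

lemma inner_inversion:
  fixes y :: "'a::real_inner"
  assumes "y \<noteq> p"
  defines "k \<equiv> p \<bullet> p / ((y - p) \<bullet> (y - p))"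
  shows "inversion p (p \<bullet> p) y \<bullet> inversion p (p \<bullet> p) y = k * (y \<bullet> y)"
    "(inversion p (p \<bullet> p) y - p) \<bullet> (inversion p (p \<bullet> p) y - p) = k * (p \<bullet> p)"
proof -
  have k: "k * ((y - p) \<bullet> (y - p)) = p \<bullet> p" using assms by simp
  have "inversion p (p \<bullet> p) y \<bullet> inversion p (p \<bullet> p) y = p \<bullet> p + 2 * k * (p \<bullet> (y - p)) + k * (k * ((y - p) \<bullet> (y - p)))"
    unfolding inversion_def k_def[symmetric] by (simp add: inner_add inner_commute algebra_simps)
  also have "\<dots> = k * ((y - p) \<bullet> (y - p)) + 2 * k * (p \<bullet> (y - p)) + k * (p \<bullet> p)"
    unfolding k by simp
  also have "\<dots> = k * (y \<bullet> y)"
    by (simp add: inner_diff inner_commute algebra_simps)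
  finally show "inversion p (p \<bullet> p) y \<bullet> inversion p (p \<bullet> p) y = k * (y \<bullet> y)" .
  have "(inversion p (p \<bullet> p) y - p) \<bullet> (inversion p (p \<bullet> p) y - p) = k * (k * ((y - p) \<bullet> (y - p)))"
    unfolding inversion_diff k_def[symmetric] by simp
  then show "(inversion p (p \<bullet> p) y - p) \<bullet> (inversion p (p \<bullet> p) y - p) = k * (p \<bullet> p)"
    unfolding k .
qed

lemma inner_powr_half: "((x :: 'a::real_inner) \<bullet> x) powr (a / 2) = norm x powr a"
proof (cases "x = 0")
  case False
  then have "x \<bullet> x = norm x powr 2"
    using powr_realpow[of "norm x" 2] by (simp add: power2_norm_eq_inner)
  then show ?thesis by (simp only: powr_powr) simp
qed simp

lemma trace_rank_one_sum:
  fixes v1 w1 :: "real ^ 'n::finite"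
  shows "(\<Sum>j\<in>UNIV. (a *\<^sub>R axis j 1 + (b1 * (v1 \<bullet> axis j 1)) *\<^sub>R w1) $ j)
    = a * real CARD('n) + b1 * (v1 \<bullet> w1)"
proof -
  have "(\<Sum>j\<in>UNIV. (a *\<^sub>R axis j 1 + (b1 * (v1 \<bullet> axis j 1)) *\<^sub>R w1) $ j)
    = (\<Sum>j\<in>UNIV. a + b1 * (v1 $ j * w1 $ j))"
    by (simp add: inner_axis axis_nth mult.assoc)
  then show ?thesis
    by (simp add: sum.distrib inner_vec_def sum_distrib_left)
qed

section \<open>A supersolution outside a ball\<close>

text \<open>The algebra of \<open>Z_supersolution\<close>: the left side is div Z + |Z|^2 with all
  inner products expressed by A = |x|^2, \<open>q\<close> and \<open>G\<close>. The first term on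
  the right comes from the Kelvin transform alone, the second is the effect of the factor 1 -
  \<epsilon> r.\<close>

lemma ground_state_rational_identity:
  fixes A q G \<rho> \<epsilon> r n :: real
  assumes "A > 0" "q > 0" "G > 0" "r > 0" "A = r\<^sup>2" "q = G - A + 4 * \<rho>\<^sup>2" "1 - \<epsilon> * r > 0"
  defines "a1 \<equiv> - (n / 2) / A" and "a2 \<equiv> - (n / 2) / q" and "a3 \<equiv> 4 / G" and "a4 \<equiv> - \<epsilon> / (r * (1 - \<epsilon> * r))"
    and "g' \<equiv> \<epsilon> * (1 - 2 * \<epsilon> * r) / (r * (1 - \<epsilon> * r))\<^sup>2"
  shows "(a1 + a2 + a3 + a4) * n + n / A\<^sup>2 * A + g' / r * A + n / q\<^sup>2 * q - 16 / G\<^sup>2 * (G / 2 + \<rho>\<^sup>2)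
     + ((a1 + a4)\<^sup>2 * A + a2\<^sup>2 * q + a3\<^sup>2 * (G / 2 + \<rho>\<^sup>2) + 2 * (a1 + a4) * a2 * (G / 2)
        + 2 * (a1 + a4) * a3 * (A / 2 + G / 4) + 2 * a2 * a3 * (3 * G / 4 + 2 * \<rho>\<^sup>2 - A / 2))
   = - (n\<^sup>2 * \<rho>\<^sup>2 / (A * q)) + a4 * (1 - n * G / (2 * q) + 4 * A / G)"
proof -
  \<comment> \<open>As 1 - \<epsilon> r is affine in r, its logarithmic derivative r a4 satisfies (r
    a4)' = - (r a4)^2. Hence the terms quadratic in a4 cancel and the correction is linear in
    a4.\<close>
  have g': "g' / r * A = - a4 - a4\<^sup>2 * A"
  proof -
    have "g' / r * A = \<epsilon> * (1 - 2 * \<epsilon> * r) / (r * (1 - \<epsilon> * r)\<^sup>2)"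
    proof -
      have "\<epsilon> * t / (r * s)\<^sup>2 / r * A = \<epsilon> * t / (r * s\<^sup>2)" if "s > 0" for s t
        using assms(4,5) that by (simp add: field_simps power2_eq_square)
      then show ?thesis unfolding g'_def using assms(7) by blast
    qed
    moreover have "- a4 - a4\<^sup>2 * A = \<epsilon> * (1 - 2 * \<epsilon> * r) / (r * (1 - \<epsilon> * r)\<^sup>2)"
      unfolding a4_def using assms(4,5,7) by (simp add: divide_simps) (simp add: power2_eq_square algebra_simps)
    ultimately show ?thesis by simp
  qed
  have e1: "a1 * n + a1\<^sup>2 * A = - (n\<^sup>2 / (4 * A))"
    unfolding a1_def using assms(1) by (simp add: field_simps power2_eq_square)
  have e2: "a2 * n + a2\<^sup>2 * q = - (n\<^sup>2 / (4 * q))"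
    unfolding a2_def using assms(2) by (simp add: field_simps power2_eq_square)
  have e3: "a3\<^sup>2 = 16 / G\<^sup>2"
    unfolding a3_def by (simp add: power_divide)
  have e4: "2 * a1 * a2 * (G / 2) - n\<^sup>2 / (4 * A) - n\<^sup>2 / (4 * q) = - (n\<^sup>2 * \<rho>\<^sup>2 / (A * q))"
  proof -
    have "2 * a1 * a2 * (G / 2) - n\<^sup>2 / (4 * A) - n\<^sup>2 / (4 * q) = n\<^sup>2 * (G - q - A) / (4 * A * q)"
      unfolding a1_def a2_def using assms(1,2) by (simp add: field_simps power2_eq_square)
    also have "G - q - A = - 4 * \<rho>\<^sup>2" using assms(6) by simp
    finally show ?thesis by simp
  qed
  have e5: "2 * a1 * a3 * (A / 2 + G / 4) = - 2 * n / G - n / A"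
    unfolding a1_def a3_def using assms(1,3) by (simp add: field_simps)
  have e6: "2 * a2 * a3 * (3 * G / 4 + 2 * \<rho>\<^sup>2 - A / 2) = - 2 * n / G - n / q"
  proof -
    have *: "3 * G / 4 + 2 * \<rho>\<^sup>2 - A / 2 = q / 2 + G / 4" using assms(6) by (simp add: field_simps)
    show ?thesis unfolding * unfolding a2_def a3_def using assms(2,3) by (simp add: field_simps)
  qed
  have e7: "2 * a4 * (a1 * A + a2 * (G / 2) + a3 * (A / 2 + G / 4)) + n * a4 - a4
     = a4 * (1 - n * G / (2 * q) + 4 * A / G)"
    unfolding a1_def a2_def a3_def using assms(1-3) by (simp add: field_simps)
  have e8: "n / A\<^sup>2 * A = n / A" "n / q\<^sup>2 * q = n / q"
    using assms(1,2) by (simp_all add: power2_eq_square)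
  have e9: "a3 * n = 4 * n / G" unfolding a3_def by simp
  have "(a1 + a2 + a3 + a4) * n + n / A\<^sup>2 * A + g' / r * A + n / q\<^sup>2 * q - 16 / G\<^sup>2 * (G / 2 + \<rho>\<^sup>2)
     + ((a1 + a4)\<^sup>2 * A + a2\<^sup>2 * q + a3\<^sup>2 * (G / 2 + \<rho>\<^sup>2) + 2 * (a1 + a4) * a2 * (G / 2)
        + 2 * (a1 + a4) * a3 * (A / 2 + G / 4) + 2 * a2 * a3 * (3 * G / 4 + 2 * \<rho>\<^sup>2 - A / 2))
    = (a1 * n + a1\<^sup>2 * A) + (a2 * n + a2\<^sup>2 * q) + a3 * n + n / A\<^sup>2 * A + n / q\<^sup>2 * q
     + (a3\<^sup>2 - 16 / G\<^sup>2) * (G / 2 + \<rho>\<^sup>2) + 2 * a1 * a2 * (G / 2) + 2 * a1 * a3 * (A / 2 + G / 4)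
     + 2 * a2 * a3 * (3 * G / 4 + 2 * \<rho>\<^sup>2 - A / 2) + (g' / r * A + a4 + a4\<^sup>2 * A)
     + (2 * a4 * (a1 * A + a2 * (G / 2) + a3 * (A / 2 + G / 4)) + n * a4 - a4)"
    by (simp add: power2_eq_square algebra_simps)
  also have "\<dots> = - (n\<^sup>2 * \<rho>\<^sup>2 / (A * q)) + a4 * (1 - n * G / (2 * q) + 4 * A / G)"
    unfolding g' e1 e2 e3 e5 e6 e7 e8 e9 e4[symmetric] by simp
  finally show ?thesis .
qed

text \<open>The excluded ball has centre \<open>c\<close> and carries 0 on its boundary.
  \<open>Q\<close> turns the inner normal e_i of the half-space into the direction of
  \<open>c\<close>. In \<open>D_small\<close>, the size of the constant is what keeps \<epsilon>|x|
  below 1/16.\<close>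

locale exterior_ball_geometry =
  fixes \<Omega> :: "(real ^ 'n::finite) set" and c :: "real ^ 'n" and N \<rho> D \<gamma> :: real and i :: 'n
    and Q :: "real ^ 'n \<Rightarrow> real ^ 'n"
  assumes N_def: "N = real CARD('n)" and dim: "CARD('n) \<ge> 3" and gamma: "\<gamma> < N / 2"
    and open_Omega: "open \<Omega>" and rho_pos: "\<rho> > 0" and norm_c: "norm c = \<rho>"
    and outside: "x \<in> \<Omega> \<Longrightarrow> \<rho> < norm (x - c)"
    and D_pos: "D > 0" and norm_le_D: "x \<in> \<Omega> \<Longrightarrow> norm x \<le> D"
    and D_small: "40 * N\<^sup>2 * D \<le> \<rho>"
    and Q: "orthogonal_transformation Q" "Q (axis i 1) = (1 / \<rho>) *\<^sub>R c"
begin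

definition "\<beta> = N - 2 * \<gamma>"
text \<open>Chosen such that \<epsilon>/(2r) equals the bound 5 N^2/(4 \<rho> r) on the curvature
  defect in \<open>Z_supersolution\<close>.\<close>

definition "\<epsilon> = 5 * N\<^sup>2 / (2 * \<rho>)"
definition "q x = (x - 2 *\<^sub>R c) \<bullet> (x - 2 *\<^sub>R c)"
text \<open>Twice |x-c|^2 - \<rho>^2, hence positive exactly outside the closed ball.\<close>

definition "G x = 2 * (x \<bullet> x) - 4 * (c \<bullet> x)"
text \<open>Kelvin transform of the half-space ground state \<open>y\<^sub>i |y|\<^sup>-\<^sup>n\<^sup>/\<^sup>2\<close>; the factor \<open>1 - \<epsilon> |x|\<close>
  compensates the defect of the potential caused by the curvature of the ball.\<close>

definition "\<Phi> x = (4 * \<rho>\<^sup>2) powr (N / 4) / (4 * \<rho>) * (x \<bullet> x) powr (- N / 4) * q x powr (- N / 4) * G x * (1 - \<epsilon> * norm x)"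
definition "Z x = (- (N / 2) / (x \<bullet> x)) *\<^sub>R x + (- (N / 2) / q x) *\<^sub>R (x - 2 *\<^sub>R c)
   + (4 / G x) *\<^sub>R (x - c) + (- \<epsilon> / (norm x * (1 - \<epsilon> * norm x))) *\<^sub>R x"

lemma N_ge_3: "N \<ge> 3"
  using dim N_def by simp

lemma beta_pos: "\<beta> > 0" and eps_pos: "\<epsilon> > 0"
  using N_ge_3 gamma rho_pos by (auto simp: \<beta>_def \<epsilon>_def)

lemma eps_D: "\<epsilon> * D \<le> 1 / 16"
  using D_small rho_pos by (simp add: \<epsilon>_def field_simps)

lemma c_inner: "c \<bullet> c = \<rho>\<^sup>2"
  using norm_c by (simp flip: power2_norm_eq_inner)

lemma inner_products:
  "q x = G x - x \<bullet> x + 4 * \<rho>\<^sup>2" "(x - c) \<bullet> (x - c) = G x / 2 + \<rho>\<^sup>2" "x \<bullet> (x - 2 *\<^sub>R c) = G x / 2"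
  "x \<bullet> (x - c) = x \<bullet> x / 2 + G x / 4" "(x - 2 *\<^sub>R c) \<bullet> (x - c) = 3 * G x / 4 + 2 * \<rho>\<^sup>2 - x \<bullet> x / 2"
  by (simp_all add: q_def G_def inner_diff inner_commute c_inner field_simps)

text \<open>Here \<open>D_small\<close> is turned into usable form. Since |x| \<le> \<rho>/(40 N^2)
  \<le> \<rho>/360 on \<Omega>, the centre 2c of the inversion stays at distance at least \<rho>,
  and the quadratic part of \<open>G\<close> is negligible against the linear one.\<close>

lemma Omega_bounds:
  assumes "x \<in> \<Omega>"
  shows "x \<noteq> 0" "x \<bullet> x > 0" "G x > 0" "q x \<ge> \<rho>\<^sup>2" "q x > 0" "\<epsilon> * norm x \<le> 1 / 16" "1 - \<epsilon> * norm x > 0"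
    "G x \<le> 5 * \<rho> * norm x" "N * G x / (2 * q x) \<le> 1 / 2"
proof -
  show "x \<noteq> 0" using outside[OF assms] norm_c by auto
  then show "x \<bullet> x > 0" by simp
  have "\<rho>\<^sup>2 < (norm (x - c))\<^sup>2" using outside[OF assms] rho_pos by (intro power_strict_mono) auto
  then show G: "G x > 0" unfolding power2_norm_eq_inner using inner_products(2)[of x] by simp
  have "\<epsilon> * norm x \<le> \<epsilon> * D" using norm_le_D[OF assms] eps_pos by simp
  then show "\<epsilon> * norm x \<le> 1 / 16" "1 - \<epsilon> * norm x > 0" using eps_D by auto
  have N2: "N\<^sup>2 \<ge> 3 * N" using N_ge_3 by (simp add: power2_eq_square)
  have "40 * N\<^sup>2 * norm x \<le> 40 * N\<^sup>2 * D" using norm_le_D[OF assms] by (intro mult_left_mono) auto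
  then have n2: "40 * N\<^sup>2 * norm x \<le> \<rho>" using D_small by simp
  have "40 * (3 * N) * norm x \<le> 40 * N\<^sup>2 * norm x" using N2 by (intro mult_right_mono) auto
  moreover have "120 * N * norm x = 40 * (3 * N) * norm x" by simp
  ultimately have n1: "120 * N * norm x \<le> \<rho>" using n2 by linarith
  have "360 * norm x \<le> 120 * N * norm x" using N_ge_3 by (intro mult_right_mono) auto
  then have n0: "360 * norm x \<le> \<rho>" using n1 by simp
  have "norm (2 *\<^sub>R c) - norm x \<le> norm (x - 2 *\<^sub>R c)" by (metis norm_minus_commute norm_triangle_ineq2)
  moreover have "norm (2 *\<^sub>R c) = 2 * \<rho>" using norm_c by simp
  ultimately have "\<rho> \<le> norm (x - 2 *\<^sub>R c)" using n0 norm_ge_zero[of x] by linarith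
  then have "\<rho>\<^sup>2 \<le> (norm (x - 2 *\<^sub>R c))\<^sup>2" using rho_pos by (intro power_mono) auto
  then show q: "q x \<ge> \<rho>\<^sup>2" unfolding power2_norm_eq_inner q_def .
  then show "q x > 0" using rho_pos by (smt (verit) zero_less_power)
  have "- (c \<bullet> x) \<le> \<rho> * norm x" using Cauchy_Schwarz_ineq2[of c x] norm_c by simp
  moreover have "x \<bullet> x \<le> \<rho> / 360 * norm x"
    unfolding power2_norm_eq_inner[symmetric] power2_eq_square using n0 by (intro mult_right_mono) auto
  moreover have "0 \<le> \<rho> * norm x" using rho_pos by simp
  ultimately show G5: "G x \<le> 5 * \<rho> * norm x" by (simp add: G_def)
  have "N * G x \<le> N * (5 * \<rho> * norm x)" using G5 N_ge_3 by (intro mult_left_mono) auto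
  also have "\<dots> = 5 * \<rho> * (N * norm x)" by simp
  also have "\<dots> \<le> 5 * \<rho> * (\<rho> / 120)" using n1 rho_pos by (intro mult_left_mono) auto
  also have "\<dots> \<le> \<rho>\<^sup>2" by (simp add: power2_eq_square)
  also note q
  finally show "N * G x / (2 * q x) \<le> 1 / 2" using \<open>q x > 0\<close> by (simp add: field_simps)
qed

lemma Phi_pos: "x \<in> \<Omega> \<Longrightarrow> \<Phi> x > 0"
  unfolding \<Phi>_def using Omega_bounds[of x] rho_pos by (simp add: zero_less_mult_iff)

text \<open>Logarithmic differentiation of a product of five factors that are positive on
  \<Omega>.\<close>

lemma has_derivative_Phi:
  assumes x: "x \<in> \<Omega>"
  shows "(\<Phi> has_derivative (\<lambda>h. \<Phi> x * (Z x \<bullet> h))) (at x)"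
proof -
  define L where "L = (\<lambda>x. ln ((4 * \<rho>\<^sup>2) powr (N / 4) / (4 * \<rho>)) - N / 4 * ln (x \<bullet> x) - N / 4 * ln (q x) + ln (G x) + ln (1 - \<epsilon> * norm x))"
  have eL: "exp (L x) = \<Phi> x" if "x \<in> \<Omega>" for x
  proof -
    note b = Omega_bounds[OF that]
    have "ln (a * A powr s * B powr s * g * f) = ln a + s * ln A + s * ln B + ln g + ln f"
      if "a > 0" "A > 0" "B > 0" "g > 0" "f > 0" for a A B g f s :: real
      using that by (simp add: ln_mult ln_powr)
    from this[of "(4 * \<rho>\<^sup>2) powr (N / 4) / (4 * \<rho>)" "x \<bullet> x" "q x" "G x" "1 - \<epsilon> * norm x" "- N / 4"]
    have "ln (\<Phi> x) = L x"
      unfolding \<Phi>_def L_def using b(2,3,5,7) rho_pos by simp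
    then show ?thesis using Phi_pos[OF that] by (metis exp_ln)
  qed
  note b = Omega_bounds[OF x]
  have 1: "((\<lambda>x. ln (x \<bullet> x)) has_derivative (\<lambda>h. 2 * (x \<bullet> h) / (x \<bullet> x))) (at x)"
    using b by (auto intro!: derivative_eq_intros simp: fun_eq_iff inner_commute field_simps)
  have 2: "((\<lambda>x. ln (q x)) has_derivative (\<lambda>h. 2 * ((x - 2 *\<^sub>R c) \<bullet> h) / q x)) (at x)"
    unfolding q_def using b(5) by (auto intro!: derivative_eq_intros simp: q_def fun_eq_iff inner_commute field_simps)
  have 3: "((\<lambda>x. ln (G x)) has_derivative (\<lambda>h. 4 * ((x - c) \<bullet> h) / G x)) (at x)"
    unfolding G_def using b(3) by (auto intro!: derivative_eq_intros simp: G_def fun_eq_iff inner_commute inner_diff_left inner_diff_right field_simps)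
  have 4: "((\<lambda>x. ln (1 - \<epsilon> * norm x)) has_derivative (\<lambda>h. (- \<epsilon> / (norm x * (1 - \<epsilon> * norm x))) * (x \<bullet> h))) (at x)"
    using b(1,7)
    by (auto intro!: derivative_eq_intros has_derivative_norm[OF b(1)] simp: fun_eq_iff sgn_div_norm inner_commute divide_simps)
  have "(L has_derivative (\<lambda>h. 0 - N / 4 * (2 * (x \<bullet> h) / (x \<bullet> x)) - N / 4 * (2 * ((x - 2 *\<^sub>R c) \<bullet> h) / q x)
     + 4 * ((x - c) \<bullet> h) / G x + (- \<epsilon> / (norm x * (1 - \<epsilon> * norm x))) * (x \<bullet> h))) (at x)"
    unfolding L_def by (intro has_derivative_add has_derivative_diff has_derivative_mult_right has_derivative_const 1 2 3 4)
  then have "(L has_derivative (\<lambda>h. Z x \<bullet> h)) (at x)"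
    by (rule has_derivative_eq_rhs) (simp add: fun_eq_iff Z_def inner_add_left inner_diff_left, simp add: ring_distribs diff_divide_distrib)
  then have "((\<lambda>x. exp (L x)) has_derivative (\<lambda>h. exp (L x) * (Z x \<bullet> h))) (at x)"
    by (auto intro!: derivative_eq_intros)
  then have "((\<lambda>x. exp (L x)) has_derivative (\<lambda>h. \<Phi> x * (Z x \<bullet> h))) (at x)"
    using eL[OF x] by simp
  then show ?thesis
    by (rule has_derivative_transform_within_open[OF _ open_Omega x]) (rule eL)
qed

text \<open>Arranged as a multiple of the identity plus rank-one maps, so that the divergence can be
  read off from \<open>trace_rank_one_sum\<close>.\<close>

definition "Z' x h = (- (N / 2) / (x \<bullet> x) + - (N / 2) / q x + 4 / G x + - \<epsilon> / (norm x * (1 - \<epsilon> * norm x))) *\<^sub>R h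
  + ((N / (x \<bullet> x)\<^sup>2 + \<epsilon> * (1 - 2 * \<epsilon> * norm x) / (norm x * (1 - \<epsilon> * norm x))\<^sup>2 / norm x) * (x \<bullet> h)) *\<^sub>R x
  + (N / (q x)\<^sup>2 * ((x - 2 *\<^sub>R c) \<bullet> h)) *\<^sub>R (x - 2 *\<^sub>R c) + (- 16 / (G x)\<^sup>2 * ((x - c) \<bullet> h)) *\<^sub>R (x - c)"

lemma has_derivative_Z:
  assumes x: "x \<in> \<Omega>"
  shows "(Z has_derivative Z' x) (at x)"
proof -
  note b = Omega_bounds[OF x]
  let ?r = "norm x"
  have 1: "((\<lambda>x. (- (N / 2) / (x \<bullet> x)) *\<^sub>R x) has_derivative
     (\<lambda>h. (- (N / 2) / (x \<bullet> x)) *\<^sub>R h + (N / (x \<bullet> x)\<^sup>2 * (x \<bullet> h)) *\<^sub>R x)) (at x)"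
    using has_derivative_inverse_square[of x 0 "- (N / 2)"] b(1) by simp
  have 2: "((\<lambda>x. (- (N / 2) / q x) *\<^sub>R (x - 2 *\<^sub>R c)) has_derivative
     (\<lambda>h. (- (N / 2) / q x) *\<^sub>R h + (N / (q x)\<^sup>2 * ((x - 2 *\<^sub>R c) \<bullet> h)) *\<^sub>R (x - 2 *\<^sub>R c))) (at x)"
    using has_derivative_inverse_square[of x "2 *\<^sub>R c" "- (N / 2)"] b(5) unfolding q_def by auto
  have G': "(G has_derivative (\<lambda>h. 4 * ((x - c) \<bullet> h))) (at x)"
    unfolding G_def by (auto intro!: derivative_eq_intros simp: fun_eq_iff inner_commute inner_diff_left inner_diff_right)
  have 3: "((\<lambda>x. (4 / G x) *\<^sub>R (x - c)) has_derivative
     (\<lambda>h. (4 / G x) *\<^sub>R h + (- 16 / (G x)\<^sup>2 * ((x - c) \<bullet> h)) *\<^sub>R (x - c))) (at x)"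
    using b(3) by (auto intro!: derivative_eq_intros G' simp: fun_eq_iff power2_eq_square)
  have "((\<lambda>r. - \<epsilon> / (r * (1 - \<epsilon> * r))) has_real_derivative \<epsilon> * (1 - 2 * \<epsilon> * ?r) / (?r * (1 - \<epsilon> * ?r))\<^sup>2) (at ?r)"
    using b(1,7)
    by (auto intro!: derivative_eq_intros simp: power2_eq_square algebra_simps) (simp add: diff_divide_distrib)
  from has_derivative_radial[OF b(1) this]
  have 4: "((\<lambda>x. (- \<epsilon> / (norm x * (1 - \<epsilon> * norm x))) *\<^sub>R x) has_derivative
     (\<lambda>h. (- \<epsilon> / (?r * (1 - \<epsilon> * ?r))) *\<^sub>R h + (\<epsilon> * (1 - 2 * \<epsilon> * ?r) / (?r * (1 - \<epsilon> * ?r))\<^sup>2 / ?r * (x \<bullet> h)) *\<^sub>R x)) (at x)" .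
  from has_derivative_add[OF has_derivative_add[OF has_derivative_add[OF 1 2] 3] 4]
  show ?thesis
    unfolding Z_def[abs_def]
    by (rule has_derivative_eq_rhs) (simp add: fun_eq_iff Z'_def scaleR_left_distrib scaleR_left_diff_distrib ring_distribs)
qed

lemma continuous_on_Z: "continuous_on \<Omega> Z"
  using has_derivative_continuous_on[of \<Omega> Z Z'] has_derivative_Z has_derivative_at_withinI by blast

lemma continuous_on_Z': "continuous_on \<Omega> (\<lambda>x. Z' x (axis j 1) $ j)"
proof -
  have "x \<in> \<Omega> \<Longrightarrow> x \<bullet> x \<noteq> 0 \<and> q x \<noteq> 0 \<and> G x \<noteq> 0 \<and> norm x * (1 - \<epsilon> * norm x) \<noteq> 0 \<and> norm x \<noteq> 0" for x
    using Omega_bounds[of x] by auto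
  moreover have "continuous_on \<Omega> q" "continuous_on \<Omega> G"
    unfolding q_def G_def by (intro continuous_intros)+
  ultimately show ?thesis
    unfolding Z'_def by (intro continuous_intros ballI) (auto simp del: mult_eq_0_iff)
qed

text \<open>The Kelvin transform alone yields the potential N^2 \<rho>^2/(A q), short of N^2/(4A) by
  at most \<epsilon>/(2r); the term with a4 supplies at least this amount, because its bracket is at
  least 1/2.\<close>

lemma Z_supersolution:
  assumes x: "x \<in> \<Omega>"
  shows "(\<Sum>j\<in>UNIV. Z' x (axis j 1) $ j) + (norm (Z x))\<^sup>2 \<le> - (N\<^sup>2 / 4) / (norm x)\<^sup>2"
proof -
  note b = Omega_bounds[OF x]
  define A where "A = x \<bullet> x"
  define r where "r = norm x"
  have A: "A = r\<^sup>2" by (simp add: A_def r_def power2_norm_eq_inner)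
  have r: "r > 0" using b(1) by (simp add: r_def)
  define a4 where "a4 = - \<epsilon> / (r * (1 - \<epsilon> * r))"
  \<comment> \<open>The summands with coefficient 0 give every rank-one piece the shape required by
    \<open>trace_rank_one_sum\<close>.\<close>
  have split: "Z' x (axis j 1) =
     ((- (N / 2) / A + - (N / 2) / q x + 4 / G x + a4) *\<^sub>R axis j 1
      + ((N / A\<^sup>2 + \<epsilon> * (1 - 2 * \<epsilon> * r) / (r * (1 - \<epsilon> * r))\<^sup>2 / r) * (x \<bullet> axis j 1)) *\<^sub>R x)
    + (0 *\<^sub>R axis j 1 + (N / (q x)\<^sup>2 * ((x - 2 *\<^sub>R c) \<bullet> axis j 1)) *\<^sub>R (x - 2 *\<^sub>R c))
    + (0 *\<^sub>R axis j 1 + (- 16 / (G x)\<^sup>2 * ((x - c) \<bullet> axis j 1)) *\<^sub>R (x - c))" for j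
    unfolding Z'_def A_def r_def a4_def by simp
  have div: "(\<Sum>j\<in>UNIV. Z' x (axis j 1) $ j) =
     (- (N / 2) / A + - (N / 2) / q x + 4 / G x + a4) * N
      + (N / A\<^sup>2 + \<epsilon> * (1 - 2 * \<epsilon> * r) / (r * (1 - \<epsilon> * r))\<^sup>2 / r) * A
      + N / (q x)\<^sup>2 * q x + - 16 / (G x)\<^sup>2 * (G x / 2 + \<rho>\<^sup>2)"
    unfolding split vector_add_component[of "_ + _"] sum.distrib
    unfolding vector_add_component[of "_ + _" "0 *\<^sub>R _ + _"] sum.distrib trace_rank_one_sum
    by (simp add: A_def inner_products(2) N_def flip: q_def)
  have Z: "Z x = (- (N / 2) / A + a4) *\<^sub>R x + (- (N / 2) / q x) *\<^sub>R (x - 2 *\<^sub>R c) + (4 / G x) *\<^sub>R (x - c)"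
    unfolding Z_def A_def[symmetric] r_def[symmetric] a4_def by (simp only: scaleR_left_distrib add_ac)
  have expand: "(norm (b1 *\<^sub>R v1 + b2 *\<^sub>R v2 + b3 *\<^sub>R v3))\<^sup>2 = b1\<^sup>2 * (v1 \<bullet> v1) + b2\<^sup>2 * (v2 \<bullet> v2) + b3\<^sup>2 * (v3 \<bullet> v3)
     + 2 * b1 * b2 * (v1 \<bullet> v2) + 2 * b1 * b3 * (v1 \<bullet> v3) + 2 * b2 * b3 * (v2 \<bullet> v3)" for b1 b2 b3 and v1 v2 v3 :: "real ^ 'n"
    unfolding power2_norm_eq_inner
    by (simp add: inner_add_left inner_add_right inner_commute power2_eq_square algebra_simps)
  have nrm: "(norm (Z x))\<^sup>2 = (- (N / 2) / A + a4)\<^sup>2 * A + (- (N / 2) / q x)\<^sup>2 * q x + (4 / G x)\<^sup>2 * (G x / 2 + \<rho>\<^sup>2)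
     + 2 * (- (N / 2) / A + a4) * (- (N / 2) / q x) * (G x / 2)
        + 2 * (- (N / 2) / A + a4) * (4 / G x) * (A / 2 + G x / 4) + 2 * (- (N / 2) / q x) * (4 / G x) * (3 * G x / 4 + 2 * \<rho>\<^sup>2 - A / 2)"
    unfolding Z expand inner_products(2-5) q_def[symmetric] A_def[symmetric] ..
  have id: "(\<Sum>j\<in>UNIV. Z' x (axis j 1) $ j) + (norm (Z x))\<^sup>2
      = - (N\<^sup>2 * \<rho>\<^sup>2 / (A * q x)) + a4 * (1 - N * G x / (2 * q x) + 4 * A / G x)"
    unfolding div nrm
    using ground_state_rational_identity[of A "q x" "G x" r \<rho> \<epsilon> N] b A r inner_products(1)[of x]
    unfolding a4_def A_def[symmetric] r_def[symmetric] by (simp add: ring_distribs)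
  have q: "q x > 0" and G: "G x > 0" and Apos: "A > 0" using b by (auto simp: A_def)
  have "a4 * (1 - N * G x / (2 * q x) + 4 * A / G x) \<le> - \<epsilon> / r * (1 / 2)"
  proof -
    have "\<epsilon> / r * (1 / 2) \<le> \<epsilon> / (r * (1 - \<epsilon> * r)) * (1 - N * G x / (2 * q x) + 4 * A / G x)"
    proof (rule mult_mono)
      have "r * (1 - \<epsilon> * r) \<le> r" using r eps_pos by (simp add: mult_le_cancel_left1)
      then show "\<epsilon> / r \<le> \<epsilon> / (r * (1 - \<epsilon> * r))"
        using r b(7) eps_pos by (intro divide_left_mono) (auto simp: r_def)
      show "1 / 2 \<le> 1 - N * G x / (2 * q x) + 4 * A / G x"
      proof -
        have "4 * A / G x > 0" using Apos G by simp
        with b(9) show ?thesis by linarith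
      qed
    qed (use r b(7) eps_pos in \<open>auto simp: r_def\<close>)
    then show ?thesis unfolding a4_def by simp
  qed
  moreover have "N\<^sup>2 / (4 * A) - N\<^sup>2 * \<rho>\<^sup>2 / (A * q x) \<le> \<epsilon> / r * (1 / 2)"
  proof -
    have "N\<^sup>2 / (4 * A) - N\<^sup>2 * \<rho>\<^sup>2 / (A * q x) = N\<^sup>2 / (4 * A) * ((q x - 4 * \<rho>\<^sup>2) / q x)"
      using Apos q by (simp add: field_simps)
    also have "\<dots> \<le> N\<^sup>2 / (4 * A) * (5 * r / \<rho>)"
    proof (rule mult_left_mono)
      \<comment> \<open>The curvature defect: q - 4\<rho>^2 = G - A is at most G, hence of first
        order in r.\<close>
      have "(q x - 4 * \<rho>\<^sup>2) / q x \<le> G x / q x"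
        using q inner_products(1)[of x] b(2) by (intro divide_right_mono) auto
      also have "\<dots> \<le> G x / \<rho>\<^sup>2"
        using b(4) G rho_pos q by (intro divide_left_mono) auto
      also have "\<dots> \<le> 5 * \<rho> * r / \<rho>\<^sup>2"
        using b(8) by (intro divide_right_mono) (auto simp: r_def)
      also have "\<dots> = 5 * r / \<rho>" using rho_pos by (simp add: power2_eq_square)
      finally show "(q x - 4 * \<rho>\<^sup>2) / q x \<le> 5 * r / \<rho>" .
    qed (use Apos in auto)
    also have "\<dots> = \<epsilon> / r * (1 / 2)"
      unfolding A \<epsilon>_def using r by (simp add: power2_eq_square mult_ac)
    finally show ?thesis .
  qed
  moreover have "- (N\<^sup>2 / 4) / (norm x)\<^sup>2 = - (N\<^sup>2 / (4 * A))" by (simp add: A r_def)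
  ultimately show ?thesis
    unfolding id by linarith
qed

end

section \<open>The change of variables to the half-space\<close>

text \<open>Reduces the comparison of the weighted energies to one condition in the radial
  variables. Here \<open>m\<close> is the stretch of the radial map and \<open>k\<close> the
  conformal factor of the inversion; \<open>k\<close> drops out since k^n k^(2-n) = k^2, which is
  the conformal covariance of the energy.\<close>

lemma gradient_weight_inequality:
  fixes n \<beta> \<gamma> k r t r' \<phi> z m :: real
  assumes pos: "k > 0" "r > 0" "t > 0" and \<beta>: "\<beta> = n - 2 * \<gamma>"
    and m: "m\<^sup>2 * t powr (\<beta> + 1) \<le> \<beta> * r * r' * \<phi>\<^sup>2"
  shows "(z * t powr (- \<gamma>))\<^sup>2 * (k * m)\<^sup>2
     \<le> \<beta> * (k powr n * (r / t) powr (n - 1) * r') * ((k * r) powr (1 - n / 2) * (z / t) * \<phi>)\<^sup>2"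
proof -
  define C where "C = z\<^sup>2 * k\<^sup>2 * t powr (- n - 1)"
  have sq: "(a powr b)\<^sup>2 = a powr (2 * b)" for a b :: real
    by (simp add: power2_eq_square flip: powr_add)
  have "t powr (2 * (- \<gamma>)) = t powr (\<beta> + 1) * t powr (- n - 1)"
    by (simp add: \<beta> flip: powr_add)
  then have "(z * t powr (- \<gamma>))\<^sup>2 * (k * m)\<^sup>2 = (m\<^sup>2 * t powr (\<beta> + 1)) * C"
    unfolding power_mult_distrib sq C_def by (simp add: mult_ac)
  also have "\<dots> \<le> (\<beta> * r * r' * \<phi>\<^sup>2) * C"
    using m by (intro mult_right_mono) (auto simp: C_def)
  also have "\<dots> = \<beta> * (k powr n * (r / t) powr (n - 1) * r') * ((k * r) powr (1 - n / 2) * (z / t) * \<phi>)\<^sup>2"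
  proof -
    have k: "k powr n * k powr (2 - n) = k\<^sup>2"
      using pos powr_realpow[of k 2] by (simp flip: powr_add)
    have r: "r powr (n - 1) * r powr (2 - n) = r"
      using pos by (simp flip: powr_add)
    have t: "t powr (- n - 1) = 1 / (t powr (n - 1) * t\<^sup>2)"
    proof -
      have "t powr (n - 1) * t\<^sup>2 = t powr (n + 1)"
        using pos powr_realpow[of t 2] powr_add[of t "n - 1" 2] by (simp add: add.commute)
      then show ?thesis using powr_minus_divide[of t "n + 1"] by simp
    qed
    have "((k * r) powr (1 - n / 2))\<^sup>2 = k powr (2 - n) * r powr (2 - n)"
      unfolding sq using pos by (simp add: powr_mult algebra_simps)
    then have "\<beta> * (k powr n * (r / t) powr (n - 1) * r') * ((k * r) powr (1 - n / 2) * (z / t) * \<phi>)\<^sup>2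
      = \<beta> * r' * \<phi>\<^sup>2 * z\<^sup>2 * (k powr n * k powr (2 - n)) * (r powr (n - 1) * r powr (2 - n)) / (t powr (n - 1) * t\<^sup>2)"
      using pos by (simp add: power_mult_distrib powr_divide power_divide)
    then show ?thesis unfolding k r C_def t by (simp add: mult_ac)
  qed
  finally show ?thesis .
qed

text \<open>A comparison of logarithms. The powers of k r cancel because s(1 - n/2) = -n for the
  critical exponent s, and the powers of t balance because of \<beta> p = n + \<beta> + s - s
  \<gamma>, which is what determines the exponent p = (2n-2)/(n-2) of X.\<close>

lemma sobolev_weight_inequality:
  fixes n \<beta> \<gamma> k r t d \<phi> z X :: real
  assumes pos: "k > 0" "r > 0" "t > 0" "z > 0" "X > 0" "\<beta> > 0" "d > 0" "\<phi> > 0" and n: "n > 2" and \<beta>: "\<beta> = n - 2 * \<gamma>"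
    and X: "X \<le> t powr \<beta>" and le1: "d \<le> 1" "\<phi> \<le> 1"
  shows "(k powr n * (r / t) powr (n - 1) * (\<beta> * t powr (- \<beta> - 1) * r * d))
       * (X powr ((2 * n - 2) / (n - 2)) * ((k * r) powr (1 - n / 2) * (z / t) * \<phi>) powr (2 * n / (n - 2)))
     \<le> \<beta> * (z * t powr (- \<gamma>)) powr (2 * n / (n - 2))" (is "?L \<le> ?R")
proof -
  define s where "s = 2 * n / (n - 2)"
  define p where "p = (2 * n - 2) / (n - 2)"
  have s: "s > 0" and p: "p > 0" using n by (auto simp: s_def p_def)
  have sn: "s * (1 - n / 2) = - n" using n by (simp add: s_def field_simps)
  have ps: "\<beta> * p = n + \<beta> + s - s * \<gamma>"
  proof -
    have s2: "s * (n - 2) = 2 * n" and p2: "p * (n - 2) = 2 * n - 2" using n by (auto simp: s_def p_def)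
    have "(\<beta> * p) * (n - 2) = \<beta> * (p * (n - 2))" by simp
    also have "\<dots> = (n + \<beta>) * (n - 2) + (s * (n - 2)) * (1 - \<gamma>)"
      unfolding s2 p2 \<beta> by (simp add: algebra_simps)
    also have "\<dots> = (n + \<beta> + s - s * \<gamma>) * (n - 2)" by (simp add: algebra_simps)
    finally show ?thesis using n by simp
  qed
  have LR: "?L > 0" "?R > 0" using pos by auto
  have lnX: "ln X \<le> \<beta> * ln t"
    using X pos by (metis ln_mono ln_powr)
  have "ln ?L = (n * ln k + (n - 1) * (ln r - ln t) + (ln \<beta> - (\<beta> + 1) * ln t + ln r + ln d))
     + (p * ln X + s * ((1 - n / 2) * (ln k + ln r) + (ln z - ln t) + ln \<phi>))"
    using pos unfolding s_def[symmetric] p_def[symmetric]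
    by (simp add: ln_mult ln_div ln_powr algebra_simps)
  also have "\<dots> = ln \<beta> + s * ln z + ln d + s * ln \<phi> + p * ln X - (n + \<beta> + s) * ln t
      + (n + s * (1 - n / 2)) * (ln k + ln r)"
    by (simp add: algebra_simps)
  also have "\<dots> = ln \<beta> + s * ln z + ln d + s * ln \<phi> + p * ln X - (n + \<beta> + s) * ln t"
    unfolding sn by simp
  also have "\<dots> \<le> ln \<beta> + s * ln z + p * (\<beta> * ln t) - (n + \<beta> + s) * ln t"
  proof -
    have "ln d \<le> 0" "ln \<phi> \<le> 0" using pos le1 by auto
    moreover from this have "s * ln \<phi> \<le> 0" using s by (simp add: mult_nonneg_nonpos)
    moreover have "p * ln X \<le> p * (\<beta> * ln t)" using lnX p by simp
    ultimately show ?thesis by linarith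
  qed
  also have "p * (\<beta> * ln t) = (n + \<beta> + s - s * \<gamma>) * ln t"
    unfolding ps[symmetric] by simp
  also have "ln \<beta> + s * ln z + (n + \<beta> + s - s * \<gamma>) * ln t - (n + \<beta> + s) * ln t = ln ?R"
    using pos unfolding s_def[symmetric] by (simp add: ln_mult ln_powr algebra_simps)
  finally show ?thesis using LR by simp
qed

context exterior_ball_geometry
begin

text \<open>\<open>r = rad t\<close> solves \<open>t\<^sup>-\<^sup>\<beta> = K\<^sub>0 - ln (r / (1 - \<delta> r))\<close>. The factor \<open>1 - \<delta> r\<close> is dominated by the
  square of the factor \<open>1 - \<epsilon> |x|\<close> of \<open>\<Phi>\<close> and keeps \<open>rad\<close> explicit.\<close>

definition "P = 2 *\<^sub>R c"
text \<open>The squared radius |P|^2, so that the inversion fixes 0. The boundary of the ball passes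
  through the centre \<open>P\<close>, hence becomes a plane, and the exterior of the ball is sent
  to the side c \<bullet> y > 0.\<close>

definition "\<sigma> = 4 * \<rho>\<^sup>2"
text \<open>One factor 2 comes from (1 - a)^2 \<ge> 1 - 2a with a = \<epsilon>|x|, the other from
  |x| \<le> 2|y| for the inverted point y.\<close>

definition "\<delta> = 4 * \<epsilon>"
text \<open>By \<open>inversion_bounds\<close>, 3D bounds r/(1 - \<delta> r) on the relevant range;
  the summand 2/\<beta> then keeps t^(-\<beta>) above 2/\<beta>, as the angular part of
  \<open>gradient_weight\<close> requires.\<close>

definition "K\<^sub>0 = ln (3 * D) + 2 / \<beta>"
definition "h t = exp (K\<^sub>0 - t powr (- \<beta>))"
definition "rad t = h t / (1 + \<delta> * h t)"
text \<open>The derivative of \<open>rad\<close> in the form of the separable differential equation,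
  from which t^(\<beta>+1) rad' = \<beta> r (1 - \<delta> r) is immediate.\<close>

definition "rad' t = \<beta> * t powr (- \<beta> - 1) * rad t * (1 - \<delta> * rad t)"
definition "Y z = (rad (norm z) / norm z) *\<^sub>R Q z"
definition "S z = inversion P \<sigma> (Y z)"
text \<open>The bound by \<rho> keeps \<open>Y z\<close> away from the centre \<open>P\<close> of
  the inversion, which has norm 2\<rho>. It excludes no point of \<Omega>, see
  \<open>inversion_Omega\<close>.\<close>

definition "U = {z. z $ i > 0 \<and> rad (norm z) < \<rho> \<and> S z \<in> \<Omega>}"
definition "\<kappa> y = \<sigma> / ((y - P) \<bullet> (y - P))"

lemma PP: "P \<bullet> P = \<sigma>" by (simp add: P_def \<sigma>_def c_inner)

lemma norm_P: "norm P = 2 * \<rho>" by (simp add: P_def norm_c)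

lemma sigma_pos: "\<sigma> > 0" using rho_pos by (simp add: \<sigma>_def)

lemma q_P: "q x = (x - P) \<bullet> (x - P)" by (simp add: q_def P_def)

lemma delta_pos: "\<delta> > 0" using eps_pos by (simp add: \<delta>_def)

lemma linear_Q: "linear Q" and norm_Q: "norm (Q x) = norm x"
  using Q(1) by (auto simp: orthogonal_transformation)

lemma c_inner_Q: "c \<bullet> Q z = \<rho> * z $ i"
proof -
  have "c = \<rho> *\<^sub>R Q (axis i 1)" using Q(2) rho_pos by simp
  then have "c \<bullet> Q z = \<rho> * (Q (axis i 1) \<bullet> Q z)" by (metis inner_scaleR_left)
  also have "\<dots> = \<rho> * z $ i" using Q(1) by (simp add: orthogonal_transformation_def inner_axis')
  finally show ?thesis .
qed

text \<open>The norms of x and y are comparable because |x| |y-P| = 2\<rho>|y| while |y-P| lies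
  between \<rho> and 3\<rho>.\<close>

lemma inversion_bounds:
  assumes x: "inversion P \<sigma> y \<in> \<Omega>" and y: "norm y < \<rho>"
  defines "x \<equiv> inversion P \<sigma> y" and "k \<equiv> \<kappa> y"
  shows "y \<noteq> P" "k > 0" "x \<bullet> x = k * (norm y)\<^sup>2" "q x = \<sigma> * k" "G x = 4 * k * (c \<bullet> y)" "y \<noteq> 0" "c \<bullet> y > 0"
    "norm x \<le> 2 * norm y" "2 * norm y \<le> 3 * norm x" "\<delta> * norm y \<le> 1 / 2" "norm y / (1 - \<delta> * norm y) \<le> 3 * D"
proof -
  note b = Omega_bounds[OF x, folded x_def]
  show yP: "y \<noteq> P" using y norm_P rho_pos by auto
  then have w: "(y - P) \<bullet> (y - P) > 0" by simp
  show k: "k > 0" using w sigma_pos by (simp add: k_def \<kappa>_def)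
  show xx: "x \<bullet> x = k * (norm y)\<^sup>2"
    using inner_inversion(1)[OF yP] unfolding PP k_def \<kappa>_def x_def power2_norm_eq_inner .
  show qx: "q x = \<sigma> * k"
    using inner_inversion(2)[OF yP] unfolding PP k_def \<kappa>_def x_def q_P by (simp add: mult.commute)
  have "G x = q x + x \<bullet> x - \<sigma>" using inner_products(1)[of x] by (simp add: \<sigma>_def)
  also have "\<dots> = k * (\<sigma> + y \<bullet> y) - k * ((y - P) \<bullet> (y - P))"
  proof -
    have "k * ((y - P) \<bullet> (y - P)) = \<sigma>" using w by (simp add: k_def \<kappa>_def)
    then show ?thesis unfolding qx xx power2_norm_eq_inner by (simp add: algebra_simps)
  qed
  also have "\<dots> = 4 * k * (c \<bullet> y)"
    by (simp add: inner_diff PP inner_commute algebra_simps) (simp add: P_def inner_commute)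
  finally show Gx: "G x = 4 * k * (c \<bullet> y)" .
  show "y \<noteq> 0" using xx b(2) by auto
  show "c \<bullet> y > 0" using Gx b(3) k by (simp add: zero_less_mult_iff)
  have n1: "norm (y - P) \<le> 3 * \<rho>" using norm_triangle_ineq4[of y P] norm_P y by simp
  have n2: "norm (y - P) \<ge> \<rho>" using norm_triangle_ineq2[of P y] norm_P y by (simp add: norm_minus_commute)
  have xy: "norm x * norm (y - P) = 2 * \<rho> * norm y"
  proof (rule power2_eq_imp_eq)
    show "(norm x * norm (y - P))\<^sup>2 = (2 * \<rho> * norm y)\<^sup>2"
      using w xx unfolding power_mult_distrib power2_norm_eq_inner k_def \<kappa>_def \<sigma>_def by simp
  qed (use rho_pos in auto)
  have "\<rho> * norm x \<le> norm (y - P) * norm x" using n2 by (intro mult_right_mono) auto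
  then have "\<rho> * norm x \<le> \<rho> * (2 * norm y)" using xy by (simp add: mult_ac)
  then show "norm x \<le> 2 * norm y" using rho_pos by simp
  have "norm (y - P) * norm x \<le> 3 * \<rho> * norm x" using n1 by (intro mult_right_mono) auto
  then have "\<rho> * (2 * norm y) \<le> \<rho> * (3 * norm x)" using xy by (simp add: mult_ac)
  then show yx: "2 * norm y \<le> 3 * norm x" using rho_pos by simp
  have "\<epsilon> * (2 * norm y) \<le> \<epsilon> * (3 * norm x)" using yx eps_pos by (intro mult_left_mono) auto
  then show d: "\<delta> * norm y \<le> 1 / 2" using b(6) by (simp add: \<delta>_def)
  have "norm y / (1 - \<delta> * norm y) \<le> norm y / (1 / 2)"
    using d by (intro divide_left_mono) auto
  also have "\<dots> \<le> 3 * norm x" using yx by simp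
  also have "\<dots> \<le> 3 * D" using norm_le_D[OF x] by (simp add: x_def)
  finally show "norm y / (1 - \<delta> * norm y) \<le> 3 * D" .
qed

section \<open>The radial map and the weights it transports\<close>

lemma h_pos: "h t > 0" and rad_pos: "rad t > 0" and one_minus_rad: "1 - \<delta> * rad t = 1 / (1 + \<delta> * h t)"
  and h_rad: "rad t / (1 - \<delta> * rad t) = h t"
proof -
  show h: "h t > 0" by (simp add: h_def)
  have d: "1 + \<delta> * h t > 0" using h delta_pos by (simp add: add_pos_pos)
  show "rad t > 0" using h d by (simp add: rad_def)
  show 1: "1 - \<delta> * rad t = 1 / (1 + \<delta> * h t)" using d by (simp add: rad_def field_simps)
  show "rad t / (1 - \<delta> * rad t) = h t" unfolding 1 using d by (simp add: rad_def)
qed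

lemma DERIV_rad:
  assumes "t > 0"
  shows "(rad has_real_derivative rad' t) (at t)"
proof -
  have d: "1 + \<delta> * h t > 0" using h_pos[of t] delta_pos by (simp add: add_pos_pos)
  have h: "(h has_real_derivative \<beta> * t powr (- \<beta> - 1) * h t) (at t)"
    unfolding h_def[abs_def] using assms by (auto intro!: derivative_eq_intros)
  have "(rad has_real_derivative \<beta> * t powr (- \<beta> - 1) * h t / (1 + \<delta> * h t)\<^sup>2) (at t)"
    unfolding rad_def[abs_def] using d
    by (auto intro!: derivative_eq_intros h simp: power2_eq_square) (simp add: algebra_simps)
  moreover have "rad' t = \<beta> * t powr (- \<beta> - 1) * h t / (1 + \<delta> * h t)\<^sup>2"
    unfolding rad'_def one_minus_rad by (simp add: rad_def power2_eq_square)
  ultimately show ?thesis by simp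
qed

lemma norm_Y: "z \<noteq> 0 \<Longrightarrow> norm (Y z) = rad (norm z)"
  using rad_pos[of "norm z"] by (simp add: Y_def norm_Q)

lemma c_inner_Y: "c \<bullet> Y z = \<rho> * (rad (norm z) * (z $ i / norm z))"
  by (simp add: Y_def c_inner_Q)

lemma U_D:
  assumes "z \<in> U"
  shows "z $ i > 0" "z \<noteq> 0" "norm (Y z) < \<rho>" "inversion P \<sigma> (Y z) \<in> \<Omega>"
proof -
  show "z $ i > 0" "inversion P \<sigma> (Y z) \<in> \<Omega>" using assms by (auto simp: U_def S_def)
  then show "z \<noteq> 0" by auto
  then show "norm (Y z) < \<rho>" using assms norm_Y[of z] by (simp add: U_def)
qed

text \<open>The lower bound controls the angular part of the energy, the upper one the weight
  X.\<close>

lemma powr_radius_bounds: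
  assumes "z \<in> U"
  shows "2 / \<beta> \<le> norm z powr (- \<beta>)" "norm z powr (- \<beta>) \<le> K\<^sub>0 - ln (rad (norm z))"
proof -
  note U = U_D[OF assms]
  have "ln (h (norm z)) \<le> ln (3 * D)"
    using inversion_bounds(11)[OF U(4,3)] h_pos[of "norm z"] D_pos norm_Y[OF U(2)] h_rad by simp
  then show "2 / \<beta> \<le> norm z powr (- \<beta>)" by (simp add: h_def K\<^sub>0_def)
  have "rad (norm z) \<le> h (norm z)"
    using h_pos[of "norm z"] delta_pos by (simp add: rad_def divide_le_eq mult_le_cancel_left1 add_pos_pos)
  then have "ln (rad (norm z)) \<le> ln (h (norm z))" using rad_pos h_pos by simp
  then show "norm z powr (- \<beta>) \<le> K\<^sub>0 - ln (rad (norm z))" by (simp add: h_def)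
qed

text \<open>The Kelvin relation: the power of \<kappa> is the Kelvin factor, and r^(1-N/2) z_i/|z|
  is the half-space ground state at \<open>Y z\<close>. The constant in front of \<Phi> is chosen to
  leave no other factor.\<close>

lemma Phi_S:
  assumes "z \<in> U"
  shows "\<Phi> (S z) = (\<kappa> (Y z) * rad (norm z)) powr (1 - N / 2) * (z $ i / norm z) * (1 - \<epsilon> * norm (S z))"
proof -
  note U = U_D[OF assms]
  note b = inversion_bounds[OF U(4,3), folded S_def]
  define k where "k = \<kappa> (Y z)"
  define r where "r = rad (norm z)"
  have k: "k > 0" and r: "r > 0" using b(2) rad_pos by (auto simp: k_def r_def)
  have *: "(4 * \<rho>\<^sup>2) powr (N / 4) / (4 * \<rho>) * (k * r\<^sup>2) powr (- N / 4) * (\<sigma> * k) powr (- N / 4) * (4 * k * (\<rho> * (r * s)))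
    = (k * r) powr (1 - N / 2) * s" for s
  proof -
    have "(\<sigma> * k) powr (- N / 4) = (4 * \<rho>\<^sup>2) powr (- N / 4) * k powr (- N / 4)"
      using k rho_pos by (simp add: \<sigma>_def powr_mult)
    moreover have "(k * r\<^sup>2) powr (- N / 4) = k powr (- N / 4) * r powr (- N / 2)"
    proof -
      have "r\<^sup>2 = r powr 2" using powr_realpow[of r 2] r by simp
      then show ?thesis using k r by (simp only: powr_mult powr_powr) simp
    qed
    moreover have "(4 * \<rho>\<^sup>2) powr (N / 4) * (4 * \<rho>\<^sup>2) powr (- N / 4) = 1"
      using rho_pos by (simp flip: powr_add)
    moreover have "(k * r) powr (1 - N / 2) = (k powr (- N / 4) * k powr (- N / 4)) * r powr (- N / 2) * k * r"
      using k r by (simp add: powr_mult powr_diff powr_minus_divide flip: powr_add)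
    ultimately show ?thesis using rho_pos by (simp add: field_simps)
  qed
  show ?thesis
    unfolding \<Phi>_def b(3,4,5) norm_Y[OF U(2)] c_inner_Y k_def[symmetric] r_def[symmetric] * ..
qed

definition "Y' z v = Q ((rad (norm z) / norm z) *\<^sub>R v
   + ((rad' (norm z) / norm z - rad (norm z) / (norm z)\<^sup>2) / norm z * (z \<bullet> v)) *\<^sub>R z)"
definition "S' z v = (\<sigma> / ((Y z - P) \<bullet> (Y z - P))) *\<^sub>R Y' z v
   + (- 2 * \<sigma> / ((Y z - P) \<bullet> (Y z - P))\<^sup>2 * ((Y z - P) \<bullet> Y' z v)) *\<^sub>R (Y z - P)"
definition "J z = \<kappa> (Y z) powr N * (rad (norm z) / norm z) powr (N - 1) * rad' (norm z)"

lemma has_derivative_S: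
  assumes "z \<noteq> 0" "Y z \<noteq> P"
  shows "(S has_derivative S' z) (at z)"
proof -
  have "((\<lambda>r. rad r / r) has_real_derivative rad' (norm z) / norm z - rad (norm z) / (norm z)\<^sup>2) (at (norm z))"
    using assms(1) by (auto intro!: derivative_eq_intros DERIV_rad simp: field_simps power2_eq_square)
  from bounded_linear.has_derivative[OF linear_linear[THEN iffD2, OF linear_Q] has_derivative_radial[OF assms(1) this]]
  have "(Y has_derivative Y' z) (at z)"
    unfolding Y'_def Y_def by (simp add: linear_scale[OF linear_Q])
  from has_derivative_compose[OF this has_derivative_inversion[OF assms(2), of \<sigma>]]
  show ?thesis unfolding S_def S'_def .
qed

lemma rad'_nonneg: "rad' t \<ge> 0"
proof -
  have "1 + \<delta> * h t > 0" using h_pos[of t] delta_pos by (simp add: add_pos_pos)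
  then show ?thesis
    unfolding rad'_def one_minus_rad using beta_pos rad_pos[of t] by simp
qed

lemma radial_coefficient:
  assumes "z \<noteq> 0"
  shows "rad (norm z) / norm z + (rad' (norm z) / norm z - rad (norm z) / (norm z)\<^sup>2) / norm z * (norm z)\<^sup>2 = rad' (norm z)"
  using assms by (simp add: field_simps power2_eq_square)

text \<open>The inversion scales all directions by \<kappa> and \<open>Q\<close> is isometric, so
  only the radial map distorts: angularly by r/t, radially by rad'.\<close>

lemma norm_S'_le:
  assumes "z \<noteq> 0" "Y z \<noteq> P"
  shows "norm (S' z v) \<le> \<kappa> (Y z) * max (rad (norm z) / norm z) (rad' (norm z)) * norm v"
proof -
  have "norm (S' z v) = \<kappa> (Y z) * norm (Y' z v)"
    unfolding S'_def \<kappa>_def by (rule norm_inversion_derivative) (use assms sigma_pos in auto)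
  moreover have "norm (Y' z v) \<le> max (rad (norm z) / norm z) (rad' (norm z)) * norm v"
    unfolding Y'_def norm_Q
    using norm_rank_one_perturbation_le[of "rad (norm z) / norm z" _ z v] radial_coefficient[OF assms(1)]
      rad_pos[of "norm z"] rad'_nonneg[of "norm z"] by (metis divide_nonneg_nonneg norm_ge_zero less_imp_le)
  moreover have "\<kappa> (Y z) \<ge> 0" using sigma_pos by (simp add: \<kappa>_def)
  ultimately show ?thesis
    by (simp add: mult.assoc mult_left_mono)
qed

lemma abs_det_S':
  assumes "z \<noteq> 0" "Y z \<noteq> P"
  shows "\<bar>det (matrix (S' z))\<bar> = J z"
proof -
  define I where "I = (\<lambda>v. (\<sigma> / ((Y z - P) \<bullet> (Y z - P))) *\<^sub>R v
   + (- 2 * \<sigma> / ((Y z - P) \<bullet> (Y z - P))\<^sup>2 * ((Y z - P) \<bullet> v)) *\<^sub>R (Y z - P))"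
  define b where "b = (rad' (norm z) / norm z - rad (norm z) / (norm z)\<^sup>2) / norm z"
  define R where "R = (\<lambda>v. (rad (norm z) / norm z) *\<^sub>R v + (b * (z \<bullet> v)) *\<^sub>R z)"
  have lin: "linear I" "linear R"
    unfolding I_def R_def by (rule linear_rank_one_perturbation)+
  have "S' z = I \<circ> (Q \<circ> R)"
    by (simp add: fun_eq_iff S'_def Y'_def I_def R_def b_def)
  then have "matrix (S' z) = matrix I ** (matrix Q ** matrix R)"
    by (simp add: matrix_compose lin linear_Q linear_compose)
  then have "\<bar>det (matrix (S' z))\<bar> = \<bar>det (matrix I)\<bar> * (\<bar>det (matrix Q)\<bar> * \<bar>det (matrix R)\<bar>)"
    by (simp add: det_mul abs_mult)
  moreover have "\<bar>det (matrix I)\<bar> = \<kappa> (Y z) ^ CARD('n)"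
    unfolding I_def \<kappa>_def by (rule det_inversion_derivative) (use assms sigma_pos in auto)
  moreover have "\<bar>det (matrix Q)\<bar> = 1"
    using Q(1) det_orthogonal_matrix orthogonal_transformation_matrix by fastforce
  moreover have "\<bar>det (matrix R)\<bar> = (rad (norm z) / norm z) ^ (CARD('n) - 1) * rad' (norm z)"
    unfolding R_def det_rank_one_perturbation b_def radial_coefficient[OF assms(1)]
    using rad_pos[of "norm z"] rad'_nonneg[of "norm z"] by (simp add: abs_mult)
  moreover have "\<kappa> (Y z) ^ CARD('n) = \<kappa> (Y z) powr N"
    using assms sigma_pos N_def by (simp add: \<kappa>_def powr_realpow)
  moreover have "(rad (norm z) / norm z) ^ (CARD('n) - 1) = (rad (norm z) / norm z) powr (N - 1)"
    using assms(1) rad_pos[of "norm z"] N_def dim by (simp flip: powr_realpow)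
  ultimately show ?thesis by (simp add: J_def)
qed

definition "\<psi> z = z $ i * norm z powr (- \<gamma>)"

lemma U_bounds:
  assumes "z \<in> U"
  shows "Y z \<noteq> P" "\<kappa> (Y z) > 0" "norm (S z) \<le> 2 * rad (norm z)" "\<delta> * rad (norm z) \<le> 1 / 2" "S z \<in> \<Omega>"
  using inversion_bounds[OF U_D(4,3)[OF assms]] norm_Y[OF U_D(2)[OF assms]] U_D(4)[OF assms]
  by (auto simp: S_def)

lemma Phi_factor_bounds:
  assumes "z \<in> U"
  defines "\<phi> \<equiv> 1 - \<epsilon> * norm (S z)"
  shows "\<phi> > 0" "\<phi> \<le> 1" "1 - \<delta> * rad (norm z) \<le> \<phi>\<^sup>2" "1 / 2 \<le> \<phi>\<^sup>2"
proof -
  show "\<phi> > 0" "\<phi> \<le> 1"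
    using Omega_bounds[OF U_bounds(5)[OF assms(1)]] eps_pos by (auto simp: \<phi>_def)
  have "\<epsilon> * norm (S z) \<le> \<epsilon> * (2 * rad (norm z))"
    using U_bounds(3)[OF assms(1)] eps_pos by simp
  then have "1 - \<delta> * rad (norm z) \<le> 1 - 2 * (\<epsilon> * norm (S z))" by (simp add: \<delta>_def)
  also have "\<dots> \<le> \<phi>\<^sup>2" using zero_le_power2[of "\<epsilon> * norm (S z)"] by (simp add: \<phi>_def power2_eq_square algebra_simps)
  finally show 1: "1 - \<delta> * rad (norm z) \<le> \<phi>\<^sup>2" .
  then show "1 / 2 \<le> \<phi>\<^sup>2" using U_bounds(4)[OF assms(1)] by simp
qed

text \<open>The pointwise comparison of the two weighted energies, with separate reasons according
  to which stretch of the radial map is larger.\<close>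

lemma gradient_weight:
  assumes z: "z \<in> U"
  shows "(\<psi> z)\<^sup>2 * (\<kappa> (Y z) * max (rad (norm z) / norm z) (rad' (norm z)))\<^sup>2 \<le> \<beta> * J z * (\<Phi> (S z))\<^sup>2"
proof -
  define t where "t = norm z"
  define r where "r = rad t"
  define \<phi> where "\<phi> = 1 - \<epsilon> * norm (S z)"
  have t: "t > 0" using U_D(2)[OF z] by (simp add: t_def)
  have r: "r > 0" by (simp add: r_def rad_pos)
  note \<phi> = Phi_factor_bounds[OF z, folded \<phi>_def t_def, folded r_def]
  have dr: "1 - \<delta> * r \<ge> 1 / 2" using U_bounds(4)[OF z] by (simp add: r_def t_def)
  have r': "rad' t * t powr (\<beta> + 1) = \<beta> * r * (1 - \<delta> * r)"
  proof -
    have "t powr (- \<beta> - 1) * t powr (\<beta> + 1) = 1" using t by (simp flip: powr_add)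
    then show ?thesis unfolding rad'_def r_def by (simp add: mult_ac)
  qed
  have r'0: "rad' t \<ge> 0" by (rule rad'_nonneg)
  have "(max (r / t) (rad' t))\<^sup>2 * t powr (\<beta> + 1) \<le> \<beta> * r * rad' t * \<phi>\<^sup>2"
  proof (cases "r / t \<le> rad' t")
    \<comment> \<open>The radial stretch dominates: the differential equation for \<open>rad\<close>
      leaves 1 - \<delta> r \<le> \<phi>^2 to be shown.\<close>
    case True
    then have "(max (r / t) (rad' t))\<^sup>2 * t powr (\<beta> + 1) = rad' t * (rad' t * t powr (\<beta> + 1))"
      by (simp add: max_def power2_eq_square)
    also have "\<dots> \<le> rad' t * (\<beta> * r * \<phi>\<^sup>2)"
      unfolding r' using \<phi>(3) r'0 beta_pos r by (intro mult_left_mono) auto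
    finally show ?thesis by (simp add: mult_ac)
  next
    case False
    \<comment> \<open>The angular stretch dominates: \<beta> t^(-\<beta>) \<ge> 2 enters squared,
      and the resulting 4 pays for the lower bounds 1/2 of 1 - \<delta> r and of \<phi>^2.\<close>
    have tb: "t powr (- \<beta>) \<ge> 2 / \<beta>" using powr_radius_bounds(1)[OF z] by (simp add: t_def)
    have "2 \<le> t powr (- \<beta>) * \<beta>" using tb beta_pos by (simp add: pos_divide_le_eq)
    then have "2\<^sup>2 \<le> (t powr (- \<beta>) * \<beta>)\<^sup>2" by (intro power_mono) auto
    then have b4: "4 \<le> (t powr (- \<beta>))\<^sup>2 * \<beta>\<^sup>2" by (simp add: power_mult_distrib)
    have "1 / 2 * (1 / 2) \<le> (1 - \<delta> * r) * \<phi>\<^sup>2" using dr \<phi>(4) by (intro mult_mono) auto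
    then have "4 * (1 / 4) \<le> ((t powr (- \<beta>))\<^sup>2 * \<beta>\<^sup>2) * ((1 - \<delta> * r) * \<phi>\<^sup>2)"
      using b4 by (intro mult_mono) auto
    then have "r\<^sup>2 * t powr (\<beta> - 1) * 1 \<le> r\<^sup>2 * t powr (\<beta> - 1) * (((t powr (- \<beta>))\<^sup>2 * \<beta>\<^sup>2) * ((1 - \<delta> * r) * \<phi>\<^sup>2))"
      by (intro mult_left_mono) auto
    also have "\<dots> = r\<^sup>2 * (t powr (\<beta> - 1) * (t powr (- \<beta>))\<^sup>2) * \<beta>\<^sup>2 * ((1 - \<delta> * r) * \<phi>\<^sup>2)"
      by (simp add: mult_ac)
    also have "t powr (\<beta> - 1) * (t powr (- \<beta>))\<^sup>2 = t powr (- \<beta> - 1)"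
      unfolding power2_eq_square by (simp flip: powr_add)
    also have "r\<^sup>2 * t powr (- \<beta> - 1) * \<beta>\<^sup>2 * ((1 - \<delta> * r) * \<phi>\<^sup>2) = \<beta> * r * rad' t * \<phi>\<^sup>2"
      unfolding rad'_def r_def[symmetric] by (simp add: power2_eq_square mult_ac)
    also have "r\<^sup>2 * t powr (\<beta> - 1) * 1 = (max (r / t) (rad' t))\<^sup>2 * t powr (\<beta> + 1)"
    proof -
      have "t powr (\<beta> + 1) = t powr (\<beta> - 1) * t\<^sup>2"
        using t powr_realpow[of t 2] powr_add[of t "\<beta> - 1" 2] by (simp add: add.commute)
      then show ?thesis using False t by (simp add: max_def power_divide)
    qed
    finally show ?thesis .
  qed
  from gradient_weight_inequality[OF U_bounds(2)[OF z] r t \<beta>_def this, of "z $ i"]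
  show ?thesis
    unfolding \<psi>_def J_def Phi_S[OF z] t_def[symmetric] r_def[symmetric] \<phi>_def[symmetric] .
qed

text \<open>The bound on \<alpha> yields t^(-\<beta>) \<le> 1 - ln(\<alpha>|x|/D), that is X \<le>
  t^\<beta>. Its 6 is the product of the 2 in |S z| \<le> 2r and the 3 in \<open>K\<^sub>0\<close>;
  its exponential cancels the 2/\<beta> there.\<close>

lemma sobolev_weight:
  assumes z: "z \<in> U" and \<alpha>: "0 < \<alpha>" "\<alpha> \<le> exp (- 2 / \<beta>) / 6"
  shows "J z * (X (\<alpha> * norm (S z) / D) powr ((2 * N - 2) / (N - 2)) * \<Phi> (S z) powr (2 * N / (N - 2)))
     \<le> \<beta> * \<psi> z powr (2 * N / (N - 2))" "X (\<alpha> * norm (S z) / D) > 0"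
proof -
  define t where "t = norm z"
  define r where "r = rad t"
  define \<phi> where "\<phi> = 1 - \<epsilon> * norm (S z)"
  have t: "t > 0" using U_D(2)[OF z] by (simp add: t_def)
  have r: "r > 0" by (simp add: r_def rad_pos)
  note \<phi> = Phi_factor_bounds[OF z, folded \<phi>_def t_def, folded r_def]
  have dr: "1 - \<delta> * r > 0" using U_bounds(4)[OF z] by (simp add: r_def t_def)
  have dr1: "1 - \<delta> * r \<le> 1" using r delta_pos by simp
  have Sz: "norm (S z) > 0" using Omega_bounds(1)[OF U_bounds(5)[OF z]] by simp
  have "ln (\<alpha> * norm (S z) / D) = ln \<alpha> + ln (norm (S z)) - ln D"
    using \<alpha> Sz D_pos by (simp add: ln_mult ln_div)
  also have "\<dots> \<le> (- 2 / \<beta> - ln 6) + (ln 2 + ln r) - ln D"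
  proof -
    have "ln \<alpha> \<le> ln (exp (- 2 / \<beta>) / 6)" using \<alpha> by simp
    then have "ln \<alpha> \<le> - 2 / \<beta> - ln 6" by (simp add: ln_div)
    moreover have "ln (norm (S z)) \<le> ln (2 * r)"
      using U_bounds(3)[OF z] Sz r by (simp add: r_def t_def)
    then have "ln (norm (S z)) \<le> ln 2 + ln r" using r by (simp add: ln_mult)
    ultimately show ?thesis by simp
  qed
  also have "\<dots> = ln r - K\<^sub>0"
  proof -
    have "ln (6 :: real) = ln 2 + ln 3" using ln_mult[of 2 "3 :: real"] by simp
    then show ?thesis using D_pos by (simp add: K\<^sub>0_def ln_mult)
  qed
  also have "\<dots> \<le> - (t powr (- \<beta>))" using powr_radius_bounds(2)[OF z] by (simp add: r_def t_def)
  finally have le: "t powr (- \<beta>) \<le> 1 - ln (\<alpha> * norm (S z) / D)" by simp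
  then have pos: "1 - ln (\<alpha> * norm (S z) / D) > 0" using t by (smt (verit) powr_gt_zero)
  then show X0: "X (\<alpha> * norm (S z) / D) > 0" by (simp add: X_def)
  have "X (\<alpha> * norm (S z) / D) \<le> 1 / t powr (- \<beta>)"
    unfolding X_def using le pos t by (intro divide_left_mono) auto
  also have "\<dots> = t powr \<beta>" by (simp add: powr_minus_divide)
  finally have X: "X (\<alpha> * norm (S z) / D) \<le> t powr \<beta>" .
  have N: "N > 2" using N_ge_3 by simp
  from sobolev_weight_inequality[OF U_bounds(2)[OF z] r t U_D(1)[OF z] X0 beta_pos dr \<phi>(1) N \<beta>_def X dr1 \<phi>(2)]
  show "J z * (X (\<alpha> * norm (S z) / D) powr ((2 * N - 2) / (N - 2)) * \<Phi> (S z) powr (2 * N / (N - 2)))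
     \<le> \<beta> * \<psi> z powr (2 * N / (N - 2))"
    unfolding \<psi>_def J_def rad'_def Phi_S[OF z] t_def[symmetric] r_def[symmetric] \<phi>_def[symmetric] .
qed

text \<open>The inverse of \<open>S\<close>: the inversion is an involution and the radial equation
  is solved for t in closed form. Its continuity makes supports in \<open>U\<close> compact.\<close>

definition "T x = (let y = inversion P \<sigma> x in
  ((K\<^sub>0 - ln (norm y / (1 - \<delta> * norm y))) powr (- 1 / \<beta>) / norm y) *\<^sub>R inv Q y)"

lemma inv_Q: "inv Q (Q x) = x" "Q (inv Q x) = x" "norm (inv Q x) = norm x" "linear (inv Q)"
  using Q(1) orthogonal_transformation_bij[OF Q(1)] orthogonal_transformation_inv[OF Q(1)]
  by (auto simp: bij_is_inj bij_is_surj surj_f_inv_f orthogonal_transformation)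

lemma T_S:
  assumes "z \<in> U"
  shows "T (S z) = z"
proof -
  note U = U_D[OF assms] and b = U_bounds[OF assms]
  define t where "t = norm z"
  have t: "t > 0" using U(2) by (simp add: t_def)
  have "inversion P \<sigma> (S z) = Y z"
    unfolding S_def using b(1) sigma_pos by (intro inversion_inversion) auto
  moreover have "norm (Y z) = rad t" using norm_Y[OF U(2)] by (simp add: t_def)
  moreover have "(K\<^sub>0 - ln (h t)) powr (- 1 / \<beta>) = t"
    using t beta_pos by (simp add: h_def powr_powr)
  ultimately have "T (S z) = (t / rad t) *\<^sub>R inv Q (Y z)"
    by (simp add: T_def h_rad)
  then show ?thesis
    unfolding Y_def t_def[symmetric] using t rad_pos[of t]
    by (simp add: linear_scale[OF inv_Q(4)] inv_Q(1))
qed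

text \<open>Makes \<open>inversion_bounds\<close> available for every point of \<Omega>, and shows
  that the base of the power in \<open>T\<close> is positive.\<close>

lemma inversion_Omega:
  assumes "x \<in> \<Omega>"
  defines "y \<equiv> inversion P \<sigma> x"
  shows "x \<noteq> P" "inversion P \<sigma> y = x" "norm y < \<rho>" "norm y > 0" "norm y / (1 - \<delta> * norm y) > 0" "1 - \<delta> * norm y > 0"
    "K\<^sub>0 - ln (norm y / (1 - \<delta> * norm y)) > 0"
proof -
  note b = Omega_bounds[OF assms(1)]
  show xP: "x \<noteq> P" using b(5) by (auto simp: q_P)
  show yx: "inversion P \<sigma> y = x"
    unfolding y_def using xP sigma_pos by (intro inversion_inversion) auto
  have "y \<bullet> y = \<sigma> / q x * (x \<bullet> x)"
    using inner_inversion(1)[OF xP] unfolding PP q_P y_def .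
  also have "\<dots> \<le> 4 * (x \<bullet> x)"
  proof (rule mult_right_mono)
    show "\<sigma> / q x \<le> 4" using b(4,5) by (simp add: \<sigma>_def divide_le_eq)
  qed simp
  finally have "(norm y)\<^sup>2 \<le> (2 * norm x)\<^sup>2" by (simp add: power_mult_distrib power2_norm_eq_inner)
  then have "norm y \<le> 2 * norm x" by (rule power2_le_imp_le) simp
  also have "\<dots> \<le> 2 * D" using norm_le_D[OF assms(1)] by simp
  also have "\<dots> < \<rho>"
  proof -
    have "3\<^sup>2 \<le> N\<^sup>2" using N_ge_3 by (intro power_mono) auto
    then have "40 * 9 * D \<le> 40 * N\<^sup>2 * D" using D_pos by (intro mult_right_mono mult_left_mono) auto
    then show ?thesis using D_small D_pos by linarith
  qed
  finally show y\<rho>: "norm y < \<rho>" .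
  have "inversion P \<sigma> y \<in> \<Omega>" using yx assms(1) by simp
  note b' = inversion_bounds[OF this y\<rho>]
  show y0: "norm y > 0" using b'(6) by simp
  show d: "1 - \<delta> * norm y > 0" using b'(10) by simp
  show f: "norm y / (1 - \<delta> * norm y) > 0" using y0 d by simp
  have "ln (norm y / (1 - \<delta> * norm y)) \<le> ln (3 * D)"
    using b'(11) f D_pos by simp
  moreover have "2 / \<beta> > 0" using beta_pos by simp
  ultimately show "K\<^sub>0 - ln (norm y / (1 - \<delta> * norm y)) > 0" unfolding K\<^sub>0_def by linarith
qed

lemma
  assumes "x \<in> \<Omega>"
  shows T_in_U: "T x \<in> U" and S_T: "S (T x) = x"
proof -
  define y where "y = inversion P \<sigma> x"
  note y = inversion_Omega[OF assms, folded y_def]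
  have "inversion P \<sigma> y \<in> \<Omega>" using y(2) assms by simp
  note b = inversion_bounds[OF this y(3)]
  define r where "r = norm y"
  define l where "l = K\<^sub>0 - ln (r / (1 - \<delta> * r))"
  define t where "t = l powr (- 1 / \<beta>)"
  define z where "z = T x"
  have l: "l > 0" and r: "r > 0" "1 - \<delta> * r > 0" "r / (1 - \<delta> * r) > 0" using y by (auto simp: l_def r_def)
  have t: "t > 0" using l by (simp add: t_def)
  have tl: "t powr (- \<beta>) = l" using l beta_pos by (simp add: t_def powr_powr)
  have ht: "h t = r / (1 - \<delta> * r)" unfolding h_def tl l_def using r by simp
  have rt: "rad t = r"
    unfolding rad_def ht using r by (simp add: field_simps)
  have z: "z = (t / r) *\<^sub>R inv Q y"
    unfolding z_def T_def y_def[symmetric] Let_def r_def[symmetric] t_def l_def ..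
  have nz: "norm z = t" unfolding z using t r by (simp add: inv_Q(3) flip: r_def)
  have Yz: "Y z = y"
    unfolding Y_def nz rt using t r by (simp add: z linear_scale[OF linear_Q] inv_Q(2))
  have Sz: "S z = x" unfolding S_def Yz by (rule y(2))
  have "\<rho> * (r * (z $ i / t)) > 0" using c_inner_Y[of z] b(7) unfolding Yz nz rt by simp
  then have "z $ i > 0" using rho_pos r t by (simp add: zero_less_mult_iff zero_less_divide_iff)
  then have "z \<in> U" using y(3) assms nz rt Sz by (simp add: U_def r_def)
  then show "T x \<in> U" "S (T x) = x" using Sz by (auto simp: z_def)
qed

lemma S_image: "S ` U = \<Omega>"
  using U_bounds(5) T_in_U S_T by (metis image_eqI image_subsetI subsetI subset_antisym)

lemma inj_on_S: "inj_on S U"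
  using T_S by (metis inj_onI)

lemma continuous_on_T: "continuous_on \<Omega> T"
proof -
  have inv: "continuous_on \<Omega> (inversion P \<sigma>)"
    unfolding inversion_def[abs_def] using inversion_Omega(1) by (intro continuous_intros) auto
  have "continuous_on \<Omega> (\<lambda>x. inv Q (inversion P \<sigma> x))"
    using continuous_on_compose2[OF linear_continuous_on[OF linear_linear[THEN iffD2, OF inv_Q(4)]] inv, of UNIV] by simp
  then show ?thesis
    unfolding T_def[abs_def] Let_def
    using inversion_Omega(4-7) by (intro continuous_intros inv) (force dest: less_imp_neq)+
qed

text \<open>Unlike \<open>U\<close>, the region \<open>V\<close> does not mention \<open>S\<close>, so smoothness of \<open>S\<close> is proved there first.\<close>

definition "V = {z :: real ^ 'n. z $ i > 0 \<and> rad (norm z) < \<rho>}"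

lemma V_D: "z \<in> V \<Longrightarrow> z \<noteq> 0" "z \<in> V \<Longrightarrow> Y z \<noteq> P"
proof -
  show nz: "z \<in> V \<Longrightarrow> z \<noteq> 0" by (auto simp: V_def)
  assume z: "z \<in> V"
  then have "norm (Y z) < \<rho>" using norm_Y[OF nz[OF z]] by (simp add: V_def)
  then show "Y z \<noteq> P" using norm_P rho_pos by auto
qed

lemma continuous_on_rad: "continuous_on {0<..} rad"
  using DERIV_rad by (meson DERIV_isCont continuous_at_imp_continuous_on greaterThan_iff)

lemma open_V: "open V"
proof -
  have "continuous_on (half_space i) (\<lambda>z. rad (norm z))"
    by (rule continuous_on_compose2[OF continuous_on_rad])
      (auto intro!: continuous_intros simp: half_space_def)
  from continuous_open_preimage[OF this open_half_space open_lessThan[of \<rho>]]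
  show ?thesis by (simp add: V_def half_space_def vimage_def Collect_conj_eq)
qed

lemma U_V: "U = V \<inter> S -` \<Omega>"
  by (auto simp: U_def V_def)

lemma open_U: "open U"
proof -
  have "continuous_on V S"
    using has_derivative_continuous_on[of V S S'] has_derivative_S V_D has_derivative_at_withinI by blast
  from continuous_open_preimage[OF this open_V open_Omega] show ?thesis by (simp add: U_V)
qed

lemma U_subset_half_space: "U \<subseteq> half_space i"
  by (auto simp: U_def half_space_def)

text \<open>The norm of z enters only through real powers of z \<bullet> z, which is smooth and
  positive on \<open>V\<close>.\<close>

lemma Ck_on_S: "Ck_on k V (\<lambda>z. S z $ j)"
proof -
  note o = open_V
  define nn where "nn = (\<lambda>z :: real ^ 'n. (z - 0) \<bullet> (z - 0))"
  have nn: "Ck_on k V nn" "\<And>z. z \<in> V \<Longrightarrow> nn z > 0"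
    unfolding nn_def using Ck_on_inner[OF o, of k 0] V_D(1) by auto
  have nn_powr: "nn z powr (a / 2) = norm z powr a" for z a
    by (simp add: nn_def inner_powr_half)
  define H where "H = (\<lambda>z. exp (K\<^sub>0 - nn z powr (- \<beta> / 2)))"
  have H: "Ck_on k V H" unfolding H_def
    by (intro Ck_on_exp Ck_on_diff Ck_on_const Ck_on_powr o nn)
  have Hh: "H z = h (norm z)" if "z \<in> V" for z
    using nn_powr[of z "- \<beta>"] by (simp add: H_def h_def)
  define a where "a = (\<lambda>z. H z * (1 + \<delta> * H z) powr (- 1) * nn z powr (- 1 / 2))"
  have a: "Ck_on k V a" unfolding a_def
    by (intro Ck_on_mult Ck_on_powr Ck_on_add Ck_on_const o H nn)
      (auto simp: H_def intro!: add_pos_pos mult_pos_pos delta_pos)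
  have aa: "a z = rad (norm z) / norm z" if "z \<in> V" for z
  proof -
    have "nn z powr (- 1 / 2) = 1 / norm z"
      using nn_powr[of z "- 1"] V_D(1)[OF that] by (simp add: powr_minus_divide)
    moreover have "1 + \<delta> * h (norm z) > 0" using h_pos[of "norm z"] delta_pos by (simp add: add_pos_pos)
    ultimately show ?thesis unfolding a_def Hh[OF that] rad_def by (simp add: powr_minus_divide)
  qed
  have Y: "Ck_on k V (\<lambda>z. Y z $ j)" for j
  proof -
    have "Ck_on k V (\<lambda>z. a z * Q z $ j)"
    proof (intro Ck_on_mult o a Ck_on_linear)
      show "linear (\<lambda>z. Q z $ j)"
        using linear_compose[OF linear_Q, of "\<lambda>x. x $ j"] by (simp add: o_def linearI)
    qed
    then show ?thesis
      by (subst Ck_on_cong[OF o, of _ "\<lambda>z. a z * Q z $ j"]) (simp_all add: aa Y_def)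
  qed
  define w where "w = (\<lambda>z. (Y z - P) \<bullet> (Y z - P))"
  have w: "Ck_on k V w"
    unfolding w_def
    by (rule Ck_on_compose[OF o open_UNIV _ Y Ck_on_inner[OF open_UNIV]]) simp
  have w_pos: "w z > 0" if "z \<in> V" for z using V_D(2)[OF that] by (simp add: w_def)
  have "Ck_on k V (\<lambda>z. P $ j + \<sigma> * w z powr (- 1) * (Y z $ j - P $ j))"
    by (intro Ck_on_mult Ck_on_add Ck_on_diff Ck_on_const Ck_on_powr o Y w w_pos)
  then show ?thesis
    by (subst Ck_on_cong[OF o, of _ "\<lambda>z. P $ j + \<sigma> * w z powr (- 1) * (Y z $ j - P $ j)"])
      (use w_pos in \<open>simp_all add: S_def inversion_def w_def powr_minus_divide\<close>)
qed

lemma Ck_on_inverse_Phi: "Ck_on k \<Omega> (\<lambda>x. 1 / \<Phi> x)"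
proof -
  note o = open_Omega and b = Omega_bounds
  have A: "Ck_on k \<Omega> (\<lambda>x. x \<bullet> x)" using Ck_on_inner[OF o, of k 0] by simp
  have q: "Ck_on k \<Omega> q" unfolding q_P[abs_def] by (rule Ck_on_inner[OF o])
  have G: "Ck_on k \<Omega> G" unfolding G_def[abs_def]
    by (intro Ck_on_diff Ck_on_mult Ck_on_const o A Ck_on_linear) (auto intro!: linearI simp: inner_right_distrib)
  have n: "norm x = (x \<bullet> x) powr (1 / 2)" for x :: "real ^ 'n"
    by (simp add: powr_half_sqrt norm_eq_sqrt_inner)
  have "Ck_on k \<Omega> \<Phi>" unfolding \<Phi>_def[abs_def] n
    by (intro Ck_on_diff Ck_on_mult Ck_on_const Ck_on_powr o A G q b)
  then have "Ck_on k \<Omega> (\<lambda>x. \<Phi> x powr (- 1))"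
    by (intro Ck_on_powr o Phi_pos)
  moreover have "1 / \<Phi> x = \<Phi> x powr (- 1)" if "x \<in> \<Omega>" for x
    using Phi_pos[OF that] by (simp add: powr_minus_divide)
  ultimately show ?thesis
    using Ck_on_cong[OF o, of "\<lambda>x. 1 / \<Phi> x" "\<lambda>x. \<Phi> x powr (- 1)"] by blast
qed

lemma Ck_on_psi: "Ck_on k (half_space i) \<psi>"
proof -
  note o = open_half_space[of i]
  have nz: "z \<noteq> 0" if "z \<in> half_space i" for z using that by (auto simp: half_space_def)
  have A: "Ck_on k (half_space i) (\<lambda>x. x \<bullet> x)" using Ck_on_inner[OF o, of k 0] by simp
  have "Ck_on k (half_space i) (\<lambda>z. z $ i * (z \<bullet> z) powr (- \<gamma> / 2))"
    by (intro Ck_on_mult Ck_on_powr o A Ck_on_linear) (use nz in \<open>auto intro!: linearI\<close>)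
  then show ?thesis
    by (simp only: inner_powr_half \<psi>_def[abs_def])
qed

lemma has_derivative_psi:
  assumes "z \<in> half_space i"
  shows "(\<psi> has_derivative (\<lambda>v. \<psi> z * (half_space_field i \<gamma> z \<bullet> v))) (at z)"
proof -
  have z: "z $ i > 0" "z \<noteq> 0" using assms by (auto simp: half_space_def)
  have "((\<lambda>r. r powr (- \<gamma>)) has_real_derivative - \<gamma> * norm z powr (- \<gamma>) / norm z) (at (norm z))"
    using z(2) by (auto intro!: derivative_eq_intros simp: powr_diff)
  from has_derivative_compose[OF has_derivative_norm[OF z(2)] this[unfolded has_field_derivative_def]]
  have n: "((\<lambda>z. norm z powr (- \<gamma>)) has_derivative (\<lambda>v. - \<gamma> * norm z powr (- \<gamma>) / norm z * (v \<bullet> sgn z))) (at z)" .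
  have "((\<lambda>z. z $ i) has_derivative (\<lambda>v. v $ i)) (at z)"
    using bounded_linear.has_derivative[OF bounded_linear_vec_nth has_derivative_ident] .
  from has_derivative_mult[OF this n]
  show ?thesis unfolding \<psi>_def
  proof (rule has_derivative_eq_rhs, intro ext)
    fix v
    have W: "half_space_field i \<gamma> z \<bullet> v = v $ i / z $ i - \<gamma> / (norm z * norm z) * (z \<bullet> v)"
      by (simp add: half_space_field_def inner_diff_left inner_axis' norm_eq_sqrt_inner)
    have sgn: "v \<bullet> sgn z = (z \<bullet> v) / norm z" by (simp add: sgn_div_norm inner_commute divide_inverse mult.commute)
    show "z $ i * (- \<gamma> * norm z powr (- \<gamma>) / norm z * (v \<bullet> sgn z)) + v $ i * norm z powr (- \<gamma>)
      = z $ i * norm z powr (- \<gamma>) * (half_space_field i \<gamma> z \<bullet> v)"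
      unfolding W sgn using z by (simp add: field_simps)
  qed
qed

section \<open>Test functions pulled back to the half-space\<close>

definition "pullback u z = (if z \<in> U then \<psi> z * (u (S z) / \<Phi> (S z)) else 0)"

lemma pullback_test_function:
  assumes u: "u \<in> test_functions \<Omega>"
  shows "pullback u \<in> test_functions U"
proof -
  obtain K where K: "compact K" "K \<subseteq> \<Omega>" "\<And>x. x \<notin> K \<Longrightarrow> u x = 0"
    using test_functionsE[OF u] by metis
  define L where "L = T ` K"
  have L: "compact L" "L \<subseteq> U"
    using K continuous_on_T T_in_U unfolding L_def
    by (auto intro!: compact_continuous_image intro: continuous_on_subset)
  have zero: "pullback u z = 0" if "z \<notin> L" for z
  proof (cases "z \<in> U")
    case True
    then have "S z \<notin> K" using that T_S[OF True] unfolding L_def by (metis imageI)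
    then show ?thesis using K(3) by (simp add: pullback_def)
  qed (simp add: pullback_def)
  have sub: "closure {z. pullback u z \<noteq> 0} \<subseteq> L"
    using zero L(1) by (intro closure_minimal compact_imp_closed) auto
  have "compact (closure {z. pullback u z \<noteq> 0})"
    using compact_Int_closed[OF L(1) closed_closure, of "{z. pullback u z \<noteq> 0}"] sub by (simp add: Int_absorb1)
  moreover have "Ck_function k (pullback u)" for k
  proof -
    have "Ck_on k \<Omega> (\<lambda>x. u x * (1 / \<Phi> x))"
      using u Ck_on_subset[of k UNIV u \<Omega>]
      by (intro Ck_on_mult open_Omega Ck_on_inverse_Phi) (auto simp: test_functions_def smooth_function_def Ck_function_iff)
    then have "Ck_on k U (\<lambda>z. u (S z) * (1 / \<Phi> (S z)))"
      using U_bounds(5) Ck_on_subset[OF Ck_on_S, of U] U_V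
      by (intro Ck_on_compose[OF open_U open_Omega, of S k "\<lambda>x. u x * (1 / \<Phi> x)"]) auto
    then have "Ck_on k U (\<lambda>z. \<psi> z * (u (S z) * (1 / \<Phi> (S z))))"
      by (rule Ck_on_mult[OF open_U Ck_on_subset[OF Ck_on_psi U_subset_half_space]])
    then have 1: "Ck_on k U (pullback u)"
      by (subst Ck_on_cong[OF open_U, of _ "\<lambda>z. \<psi> z * (u (S z) * (1 / \<Phi> (S z)))"]) (simp_all add: pullback_def)
    have oL: "open (- L)" using L(1) by (simp add: compact_imp_closed open_Compl)
    have 2: "Ck_on k (- L) (pullback u)"
      by (subst Ck_on_cong[OF oL, of _ "\<lambda>z. 0"]) (use zero Ck_on_const[OF oL] in auto)
    have "U \<union> - L = UNIV" using L(2) by auto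
    with Ck_on_Un[OF open_U oL 1 2] show ?thesis by (simp add: Ck_function_iff)
  qed
  ultimately show ?thesis
    using sub L(2) by (auto simp: test_functions_def smooth_function_def)
qed

text \<open>Subtracting the logarithmic gradient leaves \<psi> times the gradient of (u/\<Phi>)
  \<circ> S. The chain rule brings in the stretch of \<open>S'\<close>, which
  \<open>gradient_weight\<close> trades for the Jacobian.\<close>

lemma pullback_gradient_le:
  assumes u: "u \<in> test_functions \<Omega>" and z: "z \<in> U"
  shows "(norm (grad (pullback u) z - pullback u z *\<^sub>R half_space_field i \<gamma> z))\<^sup>2
     \<le> \<beta> * (J z * (norm (grad u (S z) - u (S z) *\<^sub>R Z (S z)))\<^sup>2)"
proof -
  let ?x = "S z" and ?W = "half_space_field i \<gamma> z"
  note b = U_bounds[OF z]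
  have \<Phi>: "\<Phi> ?x > 0" using Phi_pos[OF b(5)] .
  define v where "v = grad u ?x - u ?x *\<^sub>R Z ?x"
  define L where "L = \<kappa> (Y z) * max (rad (norm z) / norm z) (rad' (norm z))"
  have L0: "L \<ge> 0" using b(2) rad_pos[of "norm z"] by (auto simp: L_def le_max_iff_disj)
  have "((\<lambda>x. u x / \<Phi> x) has_derivative (\<lambda>h. (v \<bullet> h) / \<Phi> ?x)) (at ?x)"
  proof -
    have nz: "\<Phi> ?x \<noteq> 0" using \<Phi> by simp
    show ?thesis
      by (rule has_derivative_eq_rhs[OF has_derivative_divide[OF test_functionsD(1)[OF u] has_derivative_Phi[OF b(5)] nz]])
        (use nz in \<open>simp add: v_def fun_eq_iff inner_diff_left field_simps\<close>)
  qed
  from has_derivative_compose[OF has_derivative_S[OF U_D(2)[OF z] b(1)] this]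
  have 1: "((\<lambda>z. u (S z) / \<Phi> (S z)) has_derivative (\<lambda>h. (v \<bullet> S' z h) / \<Phi> ?x)) (at z)" .
  have "((\<lambda>z. \<psi> z * (u (S z) / \<Phi> (S z))) has_derivative
     (\<lambda>h. \<psi> z * ((v \<bullet> S' z h) / \<Phi> ?x) + \<psi> z * (?W \<bullet> h) * (u ?x / \<Phi> ?x))) (at z)"
    by (rule has_derivative_mult[OF has_derivative_psi 1]) (use z U_subset_half_space in auto)
  then have "(pullback u has_derivative
     (\<lambda>h. \<psi> z * ((v \<bullet> S' z h) / \<Phi> ?x) + \<psi> z * (?W \<bullet> h) * (u ?x / \<Phi> ?x))) (at z)"
    by (rule has_derivative_transform_within_open[OF _ open_U z]) (simp add: pullback_def)
  from has_derivative_unique[OF test_functionsD(1)[OF pullback_test_function[OF u]] this]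
  have "grad (pullback u) z \<bullet> h = \<psi> z * ((v \<bullet> S' z h) / \<Phi> ?x) + \<psi> z * (?W \<bullet> h) * (u ?x / \<Phi> ?x)" for h
    by (rule fun_cong)
  then have g: "(grad (pullback u) z - pullback u z *\<^sub>R ?W) \<bullet> h = \<psi> z / \<Phi> ?x * (v \<bullet> S' z h)" for h
    using z by (simp add: pullback_def inner_diff_left)
  define g where "g = grad (pullback u) z - pullback u z *\<^sub>R ?W"
  have \<psi>: "\<psi> z > 0" using U_D(1,2)[OF z] by (simp add: \<psi>_def)
  \<comment> \<open>Testing the functional with its own gradient avoids the adjoint of
    \<open>S' z\<close>.\<close>
  have "norm g * norm g = \<psi> z / \<Phi> ?x * (v \<bullet> S' z g)"
    using g[of g] by (simp add: g_def flip: power2_norm_eq_inner power2_eq_square)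
  also have "\<dots> \<le> \<psi> z / \<Phi> ?x * (norm v * (L * norm g))"
  proof (rule mult_left_mono)
    have "v \<bullet> S' z g \<le> norm v * norm (S' z g)" by (rule norm_cauchy_schwarz)
    also have "\<dots> \<le> norm v * (L * norm g)"
      using norm_S'_le[OF U_D(2)[OF z] b(1), of g] by (intro mult_left_mono) (auto simp: L_def)
    finally show "v \<bullet> S' z g \<le> norm v * (L * norm g)" .
  qed (use \<psi> \<Phi> in auto)
  finally have "norm g * norm g \<le> (\<psi> z / \<Phi> ?x * L * norm v) * norm g" by (simp add: mult_ac)
  then have "norm g \<le> \<psi> z / \<Phi> ?x * L * norm v"
  proof (cases "norm g = 0")
    case True
    then show ?thesis using \<psi> \<Phi> L0 by simp
  next
    case False
    with \<open>norm g * norm g \<le> (\<psi> z / \<Phi> ?x * L * norm v) * norm g\<close> show ?thesis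
      by (intro mult_right_le_imp_le[of "norm g" "norm g"]) auto
  qed
  then have "(norm g)\<^sup>2 \<le> (\<psi> z / \<Phi> ?x * L * norm v)\<^sup>2" by (intro power_mono) auto
  also have "\<dots> = ((\<psi> z)\<^sup>2 * L\<^sup>2) / (\<Phi> ?x)\<^sup>2 * (norm v)\<^sup>2" by (simp add: power_mult_distrib power_divide)
  also have "\<dots> \<le> (\<beta> * J z) * (norm v)\<^sup>2"
  proof (rule mult_right_mono)
    show "((\<psi> z)\<^sup>2 * L\<^sup>2) / (\<Phi> ?x)\<^sup>2 \<le> \<beta> * J z"
      using gradient_weight[OF z] \<Phi> by (simp add: L_def pos_divide_le_eq)
  qed simp
  finally show ?thesis by (simp add: g_def v_def mult.assoc)
qed

lemma continuous_on_J: "continuous_on U J"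
proof -
  have r: "continuous_on U (\<lambda>z. rad (norm z))"
    by (rule continuous_on_compose2[OF continuous_on_rad]) (auto intro!: continuous_intros dest: U_D(2))
  have Q: "continuous_on U Q"
    by (rule linear_continuous_on[OF linear_linear[THEN iffD2, OF linear_Q]])
  have Y: "continuous_on U Y"
    unfolding Y_def[abs_def] using U_D(2) by (intro continuous_intros r Q) auto
  have "continuous_on U (\<lambda>z. \<kappa> (Y z))"
    unfolding \<kappa>_def using U_bounds(1) by (intro continuous_intros Y) auto
  moreover have "\<kappa> (Y z) \<noteq> 0" "norm z \<noteq> 0" "rad (norm z) / norm z \<noteq> 0" if "z \<in> U" for z
    using U_bounds(2)[OF that] U_D(2)[OF that] rad_pos[of "norm z"] by auto
  ultimately show ?thesis
    unfolding J_def[abs_def] rad'_def by (intro continuous_intros r) auto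
qed

lemma S_change_of_variables:
  assumes "continuous_on \<Omega> f" "set_integrable lborel \<Omega> f"
  shows "set_integrable lborel U (\<lambda>z. J z * f (S z))"
    "(LINT z:U|lborel. J z * f (S z)) = (LINT x:\<Omega>|lborel. f x)"
proof -
  have 1: "(S has_derivative S' z) (at z)" if "z \<in> U" for z
    using has_derivative_S U_D(2) U_bounds(1) that by blast
  have 2: "J z = \<bar>det (matrix (S' z))\<bar>" if "z \<in> U" for z
    using abs_det_S' U_D(2) U_bounds(1) that by metis
  from change_of_variables[OF open_U 1 inj_on_S continuous_on_J 2, unfolded S_image, OF _ _ assms open_Omega]
  show "set_integrable lborel U (\<lambda>z. J z * f (S z))"
    "(LINT z:U|lborel. J z * f (S z)) = (LINT x:\<Omega>|lborel. f x)"
    by simp_all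
qed

lemma pullback_energy_le:
  assumes u: "u \<in> test_functions \<Omega>"
  shows "(LINT z:half_space i|lborel. (norm (grad (pullback u) z - pullback u z *\<^sub>R half_space_field i \<gamma> z))\<^sup>2)
     \<le> \<beta> * (LINT x:\<Omega>|lborel. (norm (grad u x - u x *\<^sub>R Z x))\<^sup>2)"
proof -
  let ?w = "pullback u"
  let ?F = "\<lambda>x. (norm (grad u x - u x *\<^sub>R Z x))\<^sup>2"
  let ?f = "\<lambda>z. (norm (grad ?w z - ?w z *\<^sub>R half_space_field i \<gamma> z))\<^sup>2"
  note w = pullback_test_function[OF u]
  have w': "?w \<in> test_functions (half_space i)"
    using w U_subset_half_space by (auto simp: test_functions_def)
  have nz: "z $ i \<noteq> 0" "z \<bullet> z \<noteq> 0" if "z \<in> half_space i" for z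
    using that by (auto simp: half_space_def)
  have cF: "continuous_on \<Omega> ?F"
    by (intro continuous_intros continuous_on_Z test_functionsD[OF u])
  have cf: "continuous_on (half_space i) ?f"
    unfolding half_space_field_def
    by (intro continuous_intros test_functionsD[OF w]) (use nz in auto)
  have iF: "set_integrable lborel \<Omega> ?F"
    by (rule set_integrable_test_function[OF open_Omega u cF]) simp
  have if': "set_integrable lborel U ?f" "(LINT z:U|lborel. ?f z) = (LINT z|lborel. ?f z)"
    by (rule set_integrable_test_function[OF open_U w continuous_on_subset[OF cf U_subset_half_space]]; simp)+
  have "(LINT z:half_space i|lborel. ?f z) = (LINT z|lborel. ?f z)"
    by (rule set_integrable_test_function[OF open_half_space w' cf]) simp
  also have "\<dots> = (LINT z:U|lborel. ?f z)" using if'(2) by simp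
  also have "\<dots> \<le> (LINT z:U|lborel. \<beta> * (J z * ?F (S z)))"
    using pullback_gradient_le[OF u]
    by (intro set_integral_mono if'(1) set_integrable_mult_right S_change_of_variables(1)[OF cF iF]) auto
  also have "\<dots> = \<beta> * (LINT x:\<Omega>|lborel. ?F x)"
    unfolding set_integral_mult_right S_change_of_variables(2)[OF cF iF] ..
  finally show ?thesis .
qed

lemma weighted_norm_le_pullback:
  assumes u: "u \<in> test_functions \<Omega>" and \<alpha>: "0 < \<alpha>" "\<alpha> \<le> exp (- 2 / \<beta>) / 6"
  shows "(LINT x:\<Omega>|lborel. X (\<alpha> * norm x / D) powr ((2 * N - 2) / (N - 2)) * \<bar>u x\<bar> powr (2 * N / (N - 2)))
     \<le> \<beta> * (LINT z:half_space i|lborel. \<bar>pullback u z\<bar> powr (2 * N / (N - 2)))"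
proof -
  let ?w = "pullback u"
  define s where "s = 2 * N / (N - 2)"
  define p where "p = (2 * N - 2) / (N - 2)"
  have s: "s > 0" using N_ge_3 by (simp add: s_def)
  let ?F = "\<lambda>x. X (\<alpha> * norm x / D) powr p * \<bar>u x\<bar> powr s"
  let ?f = "\<lambda>z. \<bar>?w z\<bar> powr s"
  note w = pullback_test_function[OF u]
  have w': "?w \<in> test_functions (half_space i)"
    using w U_subset_half_space by (auto simp: test_functions_def)
  have X: "X (\<alpha> * norm x / D) > 0" if "x \<in> \<Omega>" for x
    using sobolev_weight(2)[OF T_in_U[OF that] \<alpha>] unfolding S_T[OF that] .
  then have X': "1 - ln (\<alpha> * norm x / D) > 0" if "x \<in> \<Omega>" for x
    using that by (simp add: X_def)
  have cu: "continuous_on A (\<lambda>x. \<bar>v x\<bar> powr s)" if "v \<in> test_functions B" for A B and v :: "real ^ 'n \<Rightarrow> real"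
    by (intro continuous_on_powr' continuous_intros test_functionsD[OF that]) (use s in auto)
  have cX: "continuous_on \<Omega> (\<lambda>x. X (\<alpha> * norm x / D))"
  proof -
    have "\<alpha> * norm x / D > 0" if "x \<in> \<Omega>" for x
      using \<alpha> D_pos Omega_bounds(1)[OF that] by simp
    then show ?thesis unfolding X_def using X' by (intro continuous_intros) (force dest: less_imp_neq)+
  qed
  have cF: "continuous_on \<Omega> ?F"
    by (intro continuous_intros cX cu[OF u]) (use X in \<open>force dest: less_imp_neq\<close>)
  have cf: "continuous_on A ?f" for A by (rule cu[OF w])
  have iF: "set_integrable lborel \<Omega> ?F"
    by (rule set_integrable_test_function[OF open_Omega u cF]) simp
  have if': "set_integrable lborel U ?f" "(LINT z:U|lborel. ?f z) = (LINT z|lborel. ?f z)"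
    by (rule set_integrable_test_function[OF open_U w cf]; simp)+
  have le: "J z * ?F (S z) \<le> \<beta> * ?f z" if z: "z \<in> U" for z
  proof -
    have \<Phi>: "\<Phi> (S z) > 0" using Phi_pos[OF U_bounds(5)[OF z]] .
    have \<psi>: "\<psi> z > 0" using U_D(1,2)[OF z] by (simp add: \<psi>_def)
    have "J z * ?F (S z) = (J z * (X (\<alpha> * norm (S z) / D) powr p * \<Phi> (S z) powr s)) * (\<bar>u (S z)\<bar> powr s / \<Phi> (S z) powr s)"
      using \<Phi> by simp
    also have "\<dots> \<le> (\<beta> * \<psi> z powr s) * (\<bar>u (S z)\<bar> powr s / \<Phi> (S z) powr s)"
      using sobolev_weight(1)[OF z \<alpha>] unfolding s_def p_def by (intro mult_right_mono) auto
    also have "\<dots> = \<beta> * ?f z"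
      using z \<psi> \<Phi> by (simp add: pullback_def abs_mult powr_mult powr_divide)
    finally show ?thesis .
  qed
  have "(LINT x:\<Omega>|lborel. ?F x) = (LINT z:U|lborel. J z * ?F (S z))"
    using S_change_of_variables(2)[OF cF iF] by simp
  also have "\<dots> \<le> (LINT z:U|lborel. \<beta> * ?f z)"
    using le by (intro set_integral_mono if'(1) set_integrable_mult_right S_change_of_variables(1)[OF cF iF]) auto
  also have "\<dots> = \<beta> * (LINT z|lborel. ?f z)"
    unfolding set_integral_mult_right if'(2) ..
  also have "(LINT z|lborel. ?f z) = (LINT z:half_space i|lborel. ?f z)"
    by (rule set_integrable_test_function(3)[OF open_half_space w' cf, symmetric]) simp
  finally show ?thesis unfolding s_def p_def .
qed

section \<open>Assembling the inequality on \<Omega>\<close>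

lemma hardy_supersolution:
  assumes u: "u \<in> test_functions \<Omega>"
  shows "(LINT x:\<Omega>|lborel. (norm (grad u x))\<^sup>2) - N\<^sup>2 / 4 * (LINT x:\<Omega>|lborel. (u x)\<^sup>2 / (norm x)\<^sup>2)
     \<ge> (LINT x:\<Omega>|lborel. (norm (grad u x - u x *\<^sub>R Z x))\<^sup>2)"
proof -
  let ?V = "\<lambda>x. (\<Sum>j\<in>UNIV. Z' x (axis j 1) $ j) + (norm (Z x))\<^sup>2"
  have i1: "set_integrable lborel \<Omega> (\<lambda>x. (norm (grad u x))\<^sup>2)"
    by (intro set_integrable_test_function[OF open_Omega u] continuous_intros test_functionsD[OF u]) simp
  have i2: "set_integrable lborel \<Omega> (\<lambda>x. (u x)\<^sup>2 / (norm x)\<^sup>2)"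
    using Omega_bounds(1)
    by (intro set_integrable_test_function[OF open_Omega u] continuous_intros test_functionsD[OF u]) auto
  have i3: "set_integrable lborel \<Omega> (\<lambda>x. (norm (grad u x))\<^sup>2 + (u x)\<^sup>2 * ?V x)"
    by (intro set_integrable_test_function[OF open_Omega u] continuous_intros test_functionsD[OF u]
        continuous_on_Z continuous_on_Z') simp
  note i4 = set_integrable_mult_right[OF i2, of "N\<^sup>2 / 4"]
  have "(LINT x:\<Omega>|lborel. (norm (grad u x - u x *\<^sub>R Z x))\<^sup>2)
     = (LINT x:\<Omega>|lborel. (norm (grad u x))\<^sup>2 + (u x)\<^sup>2 * ?V x)"
    using ground_state_identity[OF open_Omega u has_derivative_Z continuous_on_Z'] by simp
  also have "\<dots> \<le> (LINT x:\<Omega>|lborel. (norm (grad u x))\<^sup>2 - N\<^sup>2 / 4 * ((u x)\<^sup>2 / (norm x)\<^sup>2))"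
  proof (rule set_integral_mono[OF i3 set_integral_diff(1)[OF i1 i4]])
    fix x assume "x \<in> \<Omega>"
    then have "(u x)\<^sup>2 * ?V x \<le> (u x)\<^sup>2 * (- (N\<^sup>2 / 4) / (norm x)\<^sup>2)"
      by (intro mult_left_mono Z_supersolution) auto
    then show "(norm (grad u x))\<^sup>2 + (u x)\<^sup>2 * ?V x \<le> (norm (grad u x))\<^sup>2 - N\<^sup>2 / 4 * ((u x)\<^sup>2 / (norm x)\<^sup>2)"
      by (simp add: mult.commute)
  qed
  also have "\<dots> = (LINT x:\<Omega>|lborel. (norm (grad u x))\<^sup>2) - N\<^sup>2 / 4 * (LINT x:\<Omega>|lborel. (u x)\<^sup>2 / (norm x)\<^sup>2)"
    unfolding set_integral_diff(2)[OF i1 i4] set_integral_mult_right ..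
  finally show ?thesis by simp
qed

text \<open>From E \<le> \<beta> F and M \<le> \<beta> W the constant acquires 1/\<beta> through the
  energy and \<beta>^(-(N-2)/N) through the norm.\<close>

theorem hardy_sobolev:
  assumes u: "u \<in> test_functions \<Omega>" and \<alpha>: "0 < \<alpha>" "\<alpha> \<le> exp (- 2 / \<beta>) / 6"
  shows "(LINT x:\<Omega>|lborel. (norm (grad u x))\<^sup>2)
             \<ge> N\<^sup>2 / 4 * (LINT x:\<Omega>|lborel. (u x)\<^sup>2 / (norm x)\<^sup>2)
               + \<beta> powr (- (2 * (N - 1) / N)) * best_const i \<gamma>
                 * (LINT x:\<Omega>|lborel. X (\<alpha> * norm x / D) powr ((2 * N - 2) / (N - 2))
                        * \<bar>u x\<bar> powr (2 * N / (N - 2))) powr ((N - 2) / N)"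
proof -
  define M where "M = (LINT x:\<Omega>|lborel. X (\<alpha> * norm x / D) powr ((2 * N - 2) / (N - 2)) * \<bar>u x\<bar> powr (2 * N / (N - 2)))"
  define W where "W = (LINT z:half_space i|lborel. \<bar>pullback u z\<bar> powr (2 * N / (N - 2)))"
  define E where "E = (LINT z:half_space i|lborel. (norm (grad (pullback u) z - pullback u z *\<^sub>R half_space_field i \<gamma> z))\<^sup>2)"
  define F where "F = (LINT x:\<Omega>|lborel. (norm (grad u x - u x *\<^sub>R Z x))\<^sup>2)"
  have w': "pullback u \<in> test_functions (half_space i)"
    using pullback_test_function[OF u] U_subset_half_space by (auto simp: test_functions_def)
  note best = best_const_bound[OF w', of \<gamma>, folded N_def, folded W_def E_def]
  have EF: "E \<le> \<beta> * F" unfolding E_def F_def by (rule pullback_energy_le[OF u])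
  have MW: "M \<le> \<beta> * W" unfolding M_def W_def by (rule weighted_norm_le_pullback[OF u \<alpha>])
  have M0: "M \<ge> 0" unfolding M_def set_lebesgue_integral_def by (intro integral_nonneg_AE) auto
  have "F \<ge> \<beta> powr (- (2 * (N - 1) / N)) * best_const i \<gamma> * M powr ((N - 2) / N)"
  proof (cases "M = 0")
    \<comment> \<open>Here W may vanish, and then \<open>best_const_bound\<close> says nothing about
      the constant. As \<open>0 powr a\<close> is 0, it suffices that F \<ge> 0.\<close>
    case True
    have "\<beta> * F \<ge> 0" using EF best(1) by simp
    then have "F \<ge> 0" using beta_pos by (simp add: zero_le_mult_iff)
    then show ?thesis using True by simp
  next
    case False
    then have M: "M > 0" using M0 by simp
    have W: "W > 0" using M MW beta_pos by (smt (verit) mult_nonneg_nonpos)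
    have "\<beta> powr (- (2 * (N - 1) / N)) * best_const i \<gamma> * M powr ((N - 2) / N)
        = best_const i \<gamma> * (M / \<beta>) powr ((N - 2) / N) / \<beta>"
    proof -
      have "- (2 * (N - 1) / N) = - ((N - 2) / N) - 1" using N_ge_3 by (simp add: field_simps)
      then have "\<beta> powr (- (2 * (N - 1) / N)) = 1 / (\<beta> powr ((N - 2) / N) * \<beta>)"
        using beta_pos powr_minus_divide[of \<beta> "(N - 2) / N"] powr_diff[of \<beta> "- ((N - 2) / N)" 1] by simp
      then show ?thesis using M beta_pos by (simp add: powr_divide)
    qed
    also have "\<dots> \<le> best_const i \<gamma> * W powr ((N - 2) / N) / \<beta>"
    proof -
      have "M / \<beta> \<le> W" using MW beta_pos by (simp add: pos_divide_le_eq mult.commute)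
      then have "(M / \<beta>) powr ((N - 2) / N) \<le> W powr ((N - 2) / N)"
        using M beta_pos N_ge_3 by (intro powr_mono2) auto
      then show ?thesis
        using best(2)[OF W] beta_pos by (intro divide_right_mono mult_left_mono) auto
    qed
    also have "\<dots> \<le> E / \<beta>" using best(3)[OF W] beta_pos by (intro divide_right_mono) auto
    also have "\<dots> \<le> F" using EF beta_pos by (simp add: pos_divide_le_eq mult.commute)
    finally show ?thesis .
  qed
  then show ?thesis
    using hardy_supersolution[OF u] unfolding M_def F_def by linarith
qed

end

theorem theorem4:
  fixes \<gamma> n :: real
  assumes n_def: "n = real CARD('n::finite)"
    and dim: "CARD('n) \<ge> 3"
    and gamma: "0 \<le> \<gamma>" "\<gamma> < n / 2"
  shows "\<exists>r \<alpha>\<^sub>0 :: real. 0 < r \<and> r < 1 \<and> 0 < \<alpha>\<^sub>0 \<and> \<alpha>\<^sub>0 < 1 \<and>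
    (\<forall>(i :: 'n) (\<Omega> :: (real ^ 'n) set) (D :: real) (\<rho> :: real).
       open \<Omega> \<and> connected \<Omega> \<and> \<Omega> \<noteq> {} \<and> bounded \<Omega> \<and> 0 \<in> frontier \<Omega>
       \<and> D = (SUP x\<in>\<Omega>. norm x) \<and> exterior_ball_at_zero \<Omega> \<rho> \<and> \<rho> \<ge> D / r
       \<longrightarrow> (\<forall>\<alpha> u. 0 < \<alpha> \<and> \<alpha> \<le> \<alpha>\<^sub>0 \<and> u \<in> test_functions \<Omega> \<longrightarrow>
             (LINT x:\<Omega>|lborel. (norm (grad u x))\<^sup>2)
             \<ge> n\<^sup>2 / 4 * (LINT x:\<Omega>|lborel. (u x)\<^sup>2 / (norm x)\<^sup>2)
               + (n - 2 * \<gamma>) powr (- (2 * (n - 1) / n)) * best_const i \<gamma>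
                 * (LINT x:\<Omega>|lborel. X (\<alpha> * norm x / D) powr ((2 * n - 2) / (n - 2))
                        * \<bar>u x\<bar> powr (2 * n / (n - 2))) powr ((n - 2) / n)))"
proof -
  have n: "n \<ge> 3" using dim n_def by simp
  have n9: "n\<^sup>2 \<ge> 3\<^sup>2" using n by (intro power_mono) auto
  \<comment> \<open>With this value \<rho> \<ge> D/r is literally \<open>D_small\<close>.\<close>
  define r where "r = 1 / (40 * n\<^sup>2)"
  define \<alpha>\<^sub>0 where "\<alpha>\<^sub>0 = exp (- 2 / (n - 2 * \<gamma>)) / 6"
  have r: "0 < r" "r < 1" using n9 n by (auto simp: r_def)
  have "exp (- 2 / (n - 2 * \<gamma>)) \<le> 1" using gamma by simp
  then have "\<alpha>\<^sub>0 \<le> 1 / 6" unfolding \<alpha>\<^sub>0_def by (rule divide_right_mono) simp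
  then have \<alpha>0: "0 < \<alpha>\<^sub>0" "\<alpha>\<^sub>0 < 1" by (simp add: \<alpha>\<^sub>0_def, linarith)
  have main: "(LINT x:\<Omega>|lborel. (norm (grad u x))\<^sup>2)
             \<ge> n\<^sup>2 / 4 * (LINT x:\<Omega>|lborel. (u x)\<^sup>2 / (norm x)\<^sup>2)
               + (n - 2 * \<gamma>) powr (- (2 * (n - 1) / n)) * best_const i \<gamma>
                 * (LINT x:\<Omega>|lborel. X (\<alpha> * norm x / D) powr ((2 * n - 2) / (n - 2))
                        * \<bar>u x\<bar> powr (2 * n / (n - 2))) powr ((n - 2) / n)"
    if \<Omega>: "open \<Omega>" "\<Omega> \<noteq> {}" "bounded \<Omega>" "0 \<in> frontier \<Omega>" and D: "D = (SUP x\<in>\<Omega>. norm x)"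
      and ball: "exterior_ball_at_zero \<Omega> \<rho>" and \<rho>: "\<rho> \<ge> D / r"
      and \<alpha>: "0 < \<alpha>" "\<alpha> \<le> \<alpha>\<^sub>0" and u: "u \<in> test_functions \<Omega>"
    for i :: 'n and \<Omega> :: "(real ^ 'n) set" and D \<rho> \<alpha> :: real and u
  proof -
    obtain c where \<rho>0: "\<rho> > 0" and c: "0 \<in> frontier (ball c \<rho>)" "ball c \<rho> \<subseteq> UNIV - closure \<Omega>"
      using ball by (auto simp: exterior_ball_at_zero_def)
    have c\<rho>: "norm c = \<rho>" using c(1) \<rho>0 by (simp add: frontier_ball)
    have outside: "\<rho> < norm (x - c)" if x: "x \<in> \<Omega>" for x
    proof (rule ccontr)
      assume "\<not> \<rho> < norm (x - c)"
      then have "x \<in> cball c \<rho>" by (simp add: dist_norm norm_minus_commute)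
      \<comment> \<open>An open set that misses the open ball also misses its closure, whence the
        strict inequality.\<close>
      then have "x \<in> closure (ball c \<rho>)" using \<rho>0 by simp
      then have "\<Omega> \<inter> ball c \<rho> \<noteq> {}"
        using open_Int_closure_eq_empty[OF \<Omega>(1), of "ball c \<rho>"] x by blast
      then show False using c(2) closure_subset[of \<Omega>] by blast
    qed
    have bdd: "bdd_above (norm ` \<Omega>)"
      using \<Omega>(3) by (auto simp: bounded_iff intro: bdd_aboveI2)
    have le_D: "norm x \<le> D" if "x \<in> \<Omega>" for x
      unfolding D by (rule cSUP_upper[OF that bdd])
    have D0: "D > 0"
    proof -
      obtain x where x: "x \<in> \<Omega>" using \<Omega>(2) by blast
      have "x \<noteq> 0" using outside[OF x] c\<rho> by auto
      then show ?thesis using le_D[OF x] by (smt (verit) zero_less_norm_iff)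
    qed
    have D_small: "40 * n\<^sup>2 * D \<le> \<rho>" using \<rho> by (simp add: r_def mult.commute)
    have "norm (axis i 1 :: real ^ 'n) = norm ((1 / \<rho>) *\<^sub>R c)"
      using c\<rho> \<rho>0 by (simp add: norm_axis_1)
    then obtain Q :: "real ^ 'n \<Rightarrow> real ^ 'n" where Q: "orthogonal_transformation Q" "Q (axis i 1) = (1 / \<rho>) *\<^sub>R c"
      by (rule orthogonal_transformation_exists)
    interpret exterior_ball_geometry \<Omega> c n \<rho> D \<gamma> i Q
      by unfold_locales (fact n_def dim gamma(2) \<Omega>(1) \<rho>0 c\<rho> outside D0 le_D D_small Q)+
    show ?thesis
      using hardy_sobolev[OF u \<alpha>(1)] \<alpha>(2) unfolding \<beta>_def \<alpha>\<^sub>0_def .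
  qed
  show ?thesis
    by (rule exI[of _ r], rule exI[of _ \<alpha>\<^sub>0], intro conjI allI impI r \<alpha>0, elim conjE, rule main)
qed

end
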